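(* Let $\Gamma$ be a discrete group and $H\le\Gamma$ a commensurated subgroup. Let $X$ be a minimal $\Gamma$-space, and denote by $\pi_H:\partial_F(H,X)\to X$ the generalized Furstenberg boundary of $(H,X)$. Then there exists a unique action $(g,y)\mapsto T_g(y)$ of $\Gamma$ on $\partial_F(H,X)$ by homeomorphisms such that: (i) $T_h(y)=hy$ for every $h\in H$ and $y\in\partial_F(H,X)$; (ii) the map $\pi_H$ is $\Gamma$-equivariant, i.e. $\pi_H(T_g(y))=g\,\pi_H(y)$ for all $g\in\Gamma$ and $y\in\partial_F(H,X)$.
   Context: For a discrete group $G$, a $G$-space is a compact Hausdorff space with a continuous action of $G$; it is minimal if every $G$-orbit is dense. A $\Gamma$-space is regarded as an $H$-space by restricting the action to $H$. A factor map of $G$-spaces is a continuous $G$-equivariant surjection. A factor map $\pi_Y:Y\to X$ of $G$-spaces is a strongly proximal extension if for every Borel probability measure $\nu$ on $Y$ with $\mathrm{supp}(\nu)\subset\pi_Y^{-1}(x)$ for some $x\in X$, there is $y\in Y$ with $\delta_y$ in the weak* closure of the orbit $G\nu$. A $(G,X)$-boundary is a pair $(Y,\pi_Y)$ where $Y$ is a minimal $G$-space and $\pi_Y:Y\to X$ is a strongly proximal extension. The generalized Furstenberg boundary $(\partial_F(G,X),\pi_G)$ is the $(G,X)$-boundary (unique up to isomorphism over $X$) with the universal property: for every $(G,X)$-boundary $(Y,\pi_Y)$ there is a unique continuous $G$-equivariant surjection $\Phi:\partial_F(G,X)\to Y$ with $\pi_Y\circ\Phi=\pi_G$. A subgroup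 $H\le\Gamma$ is commensurated if $[H:H\cap gHg^{-1}]<\infty$ for every $g\in\Gamma$. *)

theory Defs
  imports "HOL-Probability.Giry_Monad" "HOL-Algebra.Group_Action"
begin

section \<open>Spaces with an action of a discrete group\<close>

text \<open>The group carries no topology, so joint continuity of \<open>G \<times> X \<rightarrow> X\<close> (with \<open>G\<close> discrete) amounts
  to continuity of each \<open>a g\<close>. The locale \<^locale>\<open>group_action\<close> makes every \<open>a g\<close> with \<open>g\<close> in \<open>G\<close>
  an extensional bijection of \<^term>\<open>topspace X\<close> and puts no constraint on \<open>a g\<close> for \<open>g\<close> outside
  the carrier; hence \<open>G_space (G\<lparr>carrier := H\<rparr>) X a\<close> regards \<open>X\<close> as an \<open>H\<close>-space for the
  restricted action.\<close>

definition G_space :: "('g, 'm) monoid_scheme \<Rightarrow> 'x topology \<Rightarrow> ('g \<Rightarrow> 'x \<Rightarrow> 'x) \<Rightarrow> bool" where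
  "G_space G X a \<longleftrightarrow>
     compact_space X \<and> Hausdorff_space X \<and> group_action G (topspace X) a \<and>
     (\<forall>g\<in>carrier G. continuous_map X X (a g))"

definition minimal_G_space ::
    "('g, 'm) monoid_scheme \<Rightarrow> 'x topology \<Rightarrow> ('g \<Rightarrow> 'x \<Rightarrow> 'x) \<Rightarrow> bool" where
  "minimal_G_space G X a \<longleftrightarrow>
     G_space G X a \<and> (\<forall>x\<in>topspace X. X closure_of (orbit G a x) = topspace X)"

definition factor_map ::
    "('g, 'm) monoid_scheme \<Rightarrow> 'y topology \<Rightarrow> ('g \<Rightarrow> 'y \<Rightarrow> 'y) \<Rightarrow>
     'x topology \<Rightarrow> ('g \<Rightarrow> 'x \<Rightarrow> 'x) \<Rightarrow> ('y \<Rightarrow> 'x) \<Rightarrow> bool" where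
  "factor_map G Y b X a p \<longleftrightarrow>
     G_space G Y b \<and> G_space G X a \<and>
     continuous_map Y X p \<and> p ` topspace Y = topspace X \<and>
     (\<forall>g\<in>carrier G. \<forall>y\<in>topspace Y. p (b g y) = a g (p y))"


section \<open>Borel probability measures and the weak* topology\<close>

definition borel_algebra :: "'y topology \<Rightarrow> 'y measure" where
  "borel_algebra Y = sigma (topspace Y) {U. openin Y U}"

definition borel_probs :: "'y topology \<Rightarrow> 'y measure set" where
  "borel_probs Y = {\<nu>. prob_space \<nu> \<and> sets \<nu> = sets (borel_algebra Y)}"

definition measure_support :: "'y topology \<Rightarrow> 'y measure \<Rightarrow> 'y set" where
  "measure_support Y \<nu> = {y \<in> topspace Y. \<forall>U. openin Y U \<and> y \<in> U \<longrightarrow> emeasure \<nu> U > 0}"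

text \<open>The initial topology for the functionals \<open>\<nu> \<mapsto> \<integral>f d\<nu>\<close>, with \<open>f\<close> a continuous real function.\<close>

definition weak_star :: "'y topology \<Rightarrow> 'y measure topology" where
  "weak_star Y =
     pullback_topology (borel_probs Y)
       (\<lambda>\<nu>. \<lambda>f\<in>{f. continuous_map Y euclideanreal f}. integral\<^sup>L \<nu> f)
       (product_topology (\<lambda>_. euclideanreal) {f. continuous_map Y euclideanreal f})"


section \<open>Boundaries\<close>

text \<open>Regularity of \<open>\<nu>\<close> is not demanded. On a compact Hausdorff space this is immaterial: the
  regular measure representing the functional of a Borel probability measure \<open>\<nu>\<close> has support
  contained in that of \<open>\<nu>\<close>, and weak* closures only depend on the functionals.\<close>

definition strongly_proximal_extension ::
    "('g, 'm) monoid_scheme \<Rightarrow> 'y topology \<Rightarrow> ('g \<Rightarrow> 'y \<Rightarrow> 'y) \<Rightarrow>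
     'x topology \<Rightarrow> ('g \<Rightarrow> 'x \<Rightarrow> 'x) \<Rightarrow> ('y \<Rightarrow> 'x) \<Rightarrow> bool" where
  "strongly_proximal_extension G Y b X a p \<longleftrightarrow>
     factor_map G Y b X a p \<and>
     (\<forall>\<nu>\<in>borel_probs Y.
        (\<exists>x\<in>topspace X. measure_support Y \<nu> \<subseteq> {y \<in> topspace Y. p y = x}) \<longrightarrow>
        (\<exists>y\<in>topspace Y. return (borel_algebra Y) y \<in>
           weak_star Y closure_of {distr \<nu> (borel_algebra Y) (b g) | g. g \<in> carrier G}))"

definition is_boundary ::
    "('g, 'm) monoid_scheme \<Rightarrow> 'x topology \<Rightarrow> ('g \<Rightarrow> 'x \<Rightarrow> 'x) \<Rightarrow>
     'y topology \<Rightarrow> ('g \<Rightarrow> 'y \<Rightarrow> 'y) \<Rightarrow> ('y \<Rightarrow> 'x) \<Rightarrow> bool" where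
  "is_boundary G X a Y b p \<longleftrightarrow>
     minimal_G_space G Y b \<and> strongly_proximal_extension G Y b X a p"

text \<open>A definition cannot quantify over the types of the test spaces \<open>Y\<close>. It is enough to let \<open>Y\<close>
  range over the spaces with points in \<^typ>\<open>'g set set\<close>: a minimal \<open>G\<close>-space has a dense orbit and
  so at most as many points as there are sets of subsets of \<open>G\<close>. The lemma
  \<open>furstenberg_boundary_universal\<close> below recovers the universal property for test spaces of
  arbitrary type. Morphisms are taken extensional, so that uniqueness is uniqueness on the space.\<close>

definition is_furstenberg_boundary ::
    "('g, 'm) monoid_scheme \<Rightarrow> 'x topology \<Rightarrow> ('g \<Rightarrow> 'x \<Rightarrow> 'x) \<Rightarrow>
     'b topology \<Rightarrow> ('g \<Rightarrow> 'b \<Rightarrow> 'b) \<Rightarrow> ('b \<Rightarrow> 'x) \<Rightarrow> bool" where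
  "is_furstenberg_boundary G X a B c \<pi> \<longleftrightarrow>
     is_boundary G X a B c \<pi> \<and>
     (\<forall>(Y :: 'g set set topology) b p. is_boundary G X a Y b p \<longrightarrow>
        (\<exists>!\<Phi>. \<Phi> \<in> extensional (topspace B) \<and> factor_map G B c Y b \<Phi> \<and>
              (\<forall>z\<in>topspace B. p (\<Phi> z) = \<pi> z)))"


section \<open>Commensurated subgroups\<close>

definition commensurated :: "('g, 'm) monoid_scheme \<Rightarrow> 'g set \<Rightarrow> bool" where
  "commensurated G H \<longleftrightarrow>
     subgroup H G \<and>
     (\<forall>g\<in>carrier G.
        finite (rcosets\<^bsub>G\<lparr>carrier := H\<rparr>\<^esub> (H \<inter> (g <#\<^bsub>G\<^esub> H #>\<^bsub>G\<^esub> inv\<^bsub>G\<^esub> g))))"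


section \<open>The universal property for test spaces of arbitrary type\<close>

lemma space_borel_algebra [simp]: "space (borel_algebra Y) = topspace Y"
  unfolding borel_algebra_def by (rule space_measure_of) (auto dest: openin_subset)

lemma openin_sets_borel_algebra: "openin Y U \<Longrightarrow> U \<in> sets (borel_algebra Y)"
  unfolding borel_algebra_def by (subst sets_measure_of) (auto dest: openin_subset)

lemma continuous_measurable_borel_algebra:
  assumes "continuous_map Y Z f"
  shows "f \<in> borel_algebra Y \<rightarrow>\<^sub>M borel_algebra Z"
proof -
  have "f \<in> borel_algebra Y \<rightarrow>\<^sub>M sigma (topspace Z) {U. openin Z U}"
  proof (rule measurable_measure_of)
    fix U assume "U \<in> {U. openin Z U}"
    then have "openin Y {x \<in> topspace Y. f x \<in> U}"
      using assms by (simp add: openin_continuous_map_preimage)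
    moreover have "f -` U \<inter> space (borel_algebra Y) = {x \<in> topspace Y. f x \<in> U}" by auto
    ultimately show "f -` U \<inter> space (borel_algebra Y) \<in> sets (borel_algebra Y)"
      by (simp add: openin_sets_borel_algebra)
  qed (use assms in \<open>auto simp: continuous_map_def dest: openin_subset\<close>)
  then show ?thesis by (simp add: borel_algebra_def)
qed

lemma continuous_real_measurable:
  assumes "continuous_map Y euclideanreal f"
  shows "f \<in> borel_measurable (borel_algebra Y)"
  using continuous_measurable_borel_algebra[OF assms]
  by (simp add: borel_algebra_def borel_def)

lemma borel_probs_distr:
  assumes "continuous_map Y Z f" "\<nu> \<in> borel_probs Y"
  shows "distr \<nu> (borel_algebra Z) f \<in> borel_probs Z"
proof -
  have "sets \<nu> = sets (borel_algebra Y)" using assms by (simp add: borel_probs_def)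
  then have "f \<in> \<nu> \<rightarrow>\<^sub>M borel_algebra Z"
    using continuous_measurable_borel_algebra[OF assms(1)] measurable_cong_sets by blast
  then show ?thesis using assms(2) by (simp add: borel_probs_def prob_space.prob_space_distr)
qed

lemma topspace_weak_star [simp]: "topspace (weak_star Y) = borel_probs Y"
  by (auto simp: weak_star_def topspace_pullback_topology)

lemma continuous_map_distr_weak_star:
  assumes f: "continuous_map Y Z f"
  shows "continuous_map (weak_star Y) (weak_star Z) (\<lambda>\<nu>. distr \<nu> (borel_algebra Z) f)"
  unfolding weak_star_def[of Z]
proof (rule continuous_map_pullback')
  let ?C = "\<lambda>Y. {h. continuous_map Y euclideanreal h}"
  let ?I = "\<lambda>Y \<nu>. \<lambda>h\<in>?C Y. integral\<^sup>L \<nu> h"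
  let ?P = "\<lambda>Y. product_topology (\<lambda>_. euclideanreal) (?C Y)"
  show "topspace (weak_star Y) \<subseteq> (\<lambda>\<nu>. distr \<nu> (borel_algebra Z) f) -` borel_probs Z"
    using borel_probs_distr[OF f] by auto
  have ev: "continuous_map (weak_star Y) euclideanreal (\<lambda>\<nu>. integral\<^sup>L (distr \<nu> (borel_algebra Z) f) h)"
    if h: "h \<in> ?C Z" for h
  proof -
    have hf: "h \<circ> f \<in> ?C Y" using f h continuous_map_compose by auto
    have "continuous_map (weak_star Y) euclideanreal ((\<lambda>u. u (h \<circ> f)) \<circ> ?I Y)"
      unfolding weak_star_def
      by (rule continuous_map_pullback) (rule continuous_map_product_projection[OF hf])
    moreover have "((\<lambda>u. u (h \<circ> f)) \<circ> ?I Y) \<nu> = integral\<^sup>L (distr \<nu> (borel_algebra Z) f) h"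
      if "\<nu> \<in> topspace (weak_star Y)" for \<nu>
    proof -
      have "sets \<nu> = sets (borel_algebra Y)" using that by (simp add: borel_probs_def)
      then have "f \<in> \<nu> \<rightarrow>\<^sub>M borel_algebra Z"
        using continuous_measurable_borel_algebra[OF f] measurable_cong_sets by blast
      then show ?thesis
        using h hf continuous_real_measurable[of Z h] integral_distr[of f \<nu> "borel_algebra Z" h]
        by (simp add: o_def)
    qed
    ultimately show ?thesis by (rule continuous_map_eq)
  qed
  show "continuous_map (weak_star Y) (?P Z) (?I Z \<circ> (\<lambda>\<nu>. distr \<nu> (borel_algebra Z) f))"
    using ev by (auto simp: continuous_map_componentwise)
qed

text \<open>A minimal space has at most as many points as there are sets of subsets of the group.\<close>

lemma minimal_G_space_inj:
  fixes G :: "('g, 'm) monoid_scheme"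
  assumes "minimal_G_space G Y b"
  shows "\<exists>f :: 'y \<Rightarrow> 'g set set. inj_on f (topspace Y)"
proof (cases "topspace Y = {}")
  case False
  then obtain y0 where y0: "y0 \<in> topspace Y" by blast
  define f where "f y = {A. A \<subseteq> carrier G \<and> y \<in> Y closure_of ((\<lambda>g. b g y0) ` A)}" for y
  have dense: "Y closure_of (orbit G b y0) = topspace Y" and haus: "Hausdorff_space Y"
    using assms y0 by (auto simp: minimal_G_space_def G_space_def)
  have "f y \<noteq> f y'" if y: "y \<in> topspace Y" and y': "y' \<in> topspace Y" and ne: "y \<noteq> y'" for y y'
  proof -
    obtain U V where UV: "openin Y U" "openin Y V" "y \<in> U" "y' \<in> V" "disjnt U V"
      using haus y y' ne unfolding Hausdorff_space_def by blast
    define A where "A = {g \<in> carrier G. b g y0 \<in> U}"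
    have "A \<in> f y"
    proof -
      have "\<exists>g\<in>A. b g y0 \<in> W" if W: "openin Y W" "y \<in> W" for W
      proof -
        have "openin Y (U \<inter> W)" "y \<in> U \<inter> W" using UV W by auto
        moreover have "y \<in> Y closure_of (orbit G b y0)" using dense y by simp
        ultimately obtain z where "z \<in> orbit G b y0" "z \<in> U \<inter> W"
          unfolding in_closure_of by blast
        then show ?thesis by (auto simp: orbit_def A_def)
      qed
      then show ?thesis using y by (auto simp: f_def A_def in_closure_of)
    qed
    moreover have "A \<notin> f y'"
    proof
      assume "A \<in> f y'"
      then obtain g where "g \<in> A" "b g y0 \<in> V"
        using UV unfolding f_def in_closure_of by blast
      then show False using UV by (auto simp: A_def disjnt_iff)
    qed
    ultimately show ?thesis by blast
  qed
  then show ?thesis unfolding inj_on_def by blast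
qed auto

locale space_copy =
  fixes G :: "('g, 'm) monoid_scheme" and Y :: "'y topology" and b and Z :: "'z topology" and f f'
  assumes homeo: "homeomorphic_maps Y Z f f'"
    and ext: "\<And>g. g \<in> carrier G \<Longrightarrow> b g \<in> topspace Y \<rightarrow> topspace Y"
begin

definition act :: "'g \<Rightarrow> 'z \<Rightarrow> 'z" where
  "act g = (\<lambda>z\<in>topspace Z. f (b g (f' z)))"

lemma cont: "continuous_map Y Z f" "continuous_map Z Y f'"
  and inv1: "\<And>y. y \<in> topspace Y \<Longrightarrow> f' (f y) = y"
  and inv2: "\<And>z. z \<in> topspace Z \<Longrightarrow> f (f' z) = z"
  using homeo by (auto simp: homeomorphic_maps_def)

lemma f_in: "y \<in> topspace Y \<Longrightarrow> f y \<in> topspace Z" and f'_in: "z \<in> topspace Z \<Longrightarrow> f' z \<in> topspace Y"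
  using cont by (auto simp: continuous_map_def)

lemma f_image: "f ` topspace Y = topspace Z" and f'_image: "f' ` topspace Z = topspace Y"
  using f_in f'_in inv1 inv2 by (force intro: rev_image_eqI)+

lemma act_f: "y \<in> topspace Y \<Longrightarrow> act g (f y) = f (b g y)"
  by (simp add: act_def f_in inv1)

lemma f'_act: "g \<in> carrier G \<Longrightarrow> z \<in> topspace Z \<Longrightarrow> f' (act g z) = b g (f' z)"
  using ext f'_in by (auto simp: act_def intro!: inv1)

lemma G_space_copy:
  assumes Y: "G_space G Y b"
  shows "G_space G Z act"
proof -
  have hs: "Y homeomorphic_space Z" using homeo homeomorphic_space_def by blast
  interpret group_action G "topspace Y" b using Y by (simp add: G_space_def)
  have G: "group G" using group_hom group_hom.axioms(1) by blast
  have bij: "act g \<in> Bij (topspace Z)" if g: "g \<in> carrier G" for g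
  proof -
    have "bij_betw (b g) (topspace Y) (topspace Y)"
      using bij_prop0[OF g] by (simp add: Bij_def)
    moreover have "bij_betw f (topspace Y) (topspace Z)" "bij_betw f' (topspace Z) (topspace Y)"
      using bij_betw_byWitness[of "topspace Y" f' f "topspace Z"]
        bij_betw_byWitness[of "topspace Z" f f' "topspace Y"] f_image f'_image inv1 inv2
      by (metis order_refl)+
    ultimately have "bij_betw (f \<circ> (b g \<circ> f')) (topspace Z) (topspace Z)"
      by (intro bij_betw_trans)
    then have "bij_betw (act g) (topspace Z) (topspace Z)"
      by (rule bij_betw_cong[THEN iffD1, rotated]) (simp add: act_def)
    then show ?thesis by (simp add: Bij_def act_def)
  qed
  have mult: "act (g \<otimes>\<^bsub>G\<^esub> h) = compose (topspace Z) (act g) (act h)"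
    if g: "g \<in> carrier G" and h: "h \<in> carrier G" for g h
  proof
    fix z show "act (g \<otimes>\<^bsub>G\<^esub> h) z = compose (topspace Z) (act g) (act h) z"
    proof (cases "z \<in> topspace Z")
      case True
      have "b (g \<otimes>\<^bsub>G\<^esub> h) (f' z) = b g (b h (f' z))"
        using composition_rule[OF f'_in[OF True] g h] .
      moreover have "b h (f' z) \<in> topspace Y" using ext[OF h] f'_in[OF True] by blast
      ultimately show ?thesis using True by (simp add: compose_def act_def f_in inv1)
    qed (simp add: compose_def act_def)
  qed
  have "group_action G (topspace Z) act"
    unfolding group_action_def group_hom_def group_hom_axioms_def
    using G group_BijGroup bij mult by (auto simp: hom_def BijGroup_def restrict_def)
  moreover have "continuous_map Z Z (act g)" if "g \<in> carrier G" for g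
  proof -
    have "continuous_map Y Y (b g)" using Y that by (simp add: G_space_def)
    then have "continuous_map Z Z (f \<circ> (b g \<circ> f'))"
      by (rule continuous_map_compose[OF continuous_map_compose[OF cont(2)] cont(1)])
    then show ?thesis by (rule continuous_map_eq) (simp add: act_def)
  qed
  moreover have "compact_space Z" "Hausdorff_space Z"
    using Y homeomorphic_compact_space[OF hs] homeomorphic_Hausdorff_space[OF hs]
    by (simp_all add: G_space_def)
  ultimately show ?thesis by (simp add: G_space_def)
qed

lemma minimal_copy:
  assumes Y: "minimal_G_space G Y b"
  shows "minimal_G_space G Z act"
proof -
  have "Z closure_of (orbit G act z) = topspace Z" if z: "z \<in> topspace Z" for z
  proof -
    have "f ` topspace Y = f ` (Y closure_of (orbit G b (f' z)))"
      using Y f'_in[OF z] by (simp add: minimal_G_space_def)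
    also have "\<dots> \<subseteq> Z closure_of (f ` orbit G b (f' z))"
      using cont(1) by (simp add: continuous_map_image_closure_subset)
    also have "f ` orbit G b (f' z) = orbit G act z"
      using z by (auto simp: orbit_def act_def)
    finally show ?thesis using f_image closure_of_subset_topspace by fastforce
  qed
  then show ?thesis using Y G_space_copy by (simp add: minimal_G_space_def)
qed

lemma boundary_copy:
  assumes Y: "is_boundary G X a Y b p"
  shows "is_boundary G X a Z act (p \<circ> f')"
proof -
  have sp: "strongly_proximal_extension G Y b X a p" and min: "minimal_G_space G Y b"
    using Y by (auto simp: is_boundary_def)
  have fm: "factor_map G Y b X a p" using sp by (simp add: strongly_proximal_extension_def)
  then have GY: "G_space G Y b" and pc: "continuous_map Y X p"
    by (auto simp: factor_map_def)
  have "factor_map G Z act X a (p \<circ> f')"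
    unfolding factor_map_def
  proof (intro conjI ballI)
    show "(p \<circ> f') ` topspace Z = topspace X"
      using fm f'_image unfolding factor_map_def by (simp only: image_comp[symmetric])
    show "continuous_map Z X (p \<circ> f')" using continuous_map_compose[OF cont(2) pc] .
  qed (use fm G_space_copy[OF GY] f'_act f'_in in \<open>auto simp: factor_map_def\<close>)
  moreover have "\<exists>z\<in>topspace Z. return (borel_algebra Z) z \<in>
           weak_star Z closure_of {distr \<nu> (borel_algebra Z) (act g) | g. g \<in> carrier G}"
    if \<nu>: "\<nu> \<in> borel_probs Z" and x: "x \<in> topspace X"
      and supp: "measure_support Z \<nu> \<subseteq> {z \<in> topspace Z. (p \<circ> f') z = x}" for \<nu> x
  proof -
    let ?BY = "borel_algebra Y" and ?BZ = "borel_algebra Z"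
    define \<mu> where "\<mu> = distr \<nu> ?BY f'"
    have mf: "f \<in> ?BY \<rightarrow>\<^sub>M ?BZ" and mf': "f' \<in> ?BZ \<rightarrow>\<^sub>M ?BY"
      using cont continuous_measurable_borel_algebra by blast+
    have s\<nu>: "sets \<nu> = sets ?BZ" using \<nu> by (simp add: borel_probs_def)
    then have sp\<nu>: "space \<nu> = topspace Z" using sets_eq_imp_space_eq[of \<nu> ?BZ] by simp
    have mf'\<nu>: "f' \<in> \<nu> \<rightarrow>\<^sub>M ?BY" using mf' s\<nu> measurable_cong_sets by blast
    have \<mu>: "\<mu> \<in> borel_probs Y" using borel_probs_distr[OF cont(2) \<nu>] by (simp add: \<mu>_def)
    have "p y = x" if y: "y \<in> measure_support Y \<mu>" for y
    proof -
      have yY: "y \<in> topspace Y" using y by (simp add: measure_support_def)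
      have "f y \<in> measure_support Z \<nu>"
        unfolding measure_support_def
      proof (intro CollectI conjI allI impI)
        fix V assume V: "openin Z V \<and> f y \<in> V"
        let ?U = "{u \<in> topspace Y. f u \<in> V}"
        have U: "openin Y ?U" using V cont(1) openin_continuous_map_preimage by blast
        then have "emeasure \<mu> ?U > 0" using y yY V by (auto simp: measure_support_def)
        moreover have "emeasure \<mu> ?U = emeasure \<nu> (f' -` ?U \<inter> space \<nu>)"
          unfolding \<mu>_def using mf'\<nu> U by (simp add: emeasure_distr openin_sets_borel_algebra)
        moreover have "f' -` ?U \<inter> space \<nu> = V"
          using V openin_subset f'_in inv2 by (fastforce simp: sp\<nu>)
        ultimately show "emeasure \<nu> V > 0" by simp
      qed (use yY f_in in auto)
      then show "p y = x" using supp inv1[OF yY] by auto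
    qed
    then have "measure_support Y \<mu> \<subseteq> {y \<in> topspace Y. p y = x}"
      by (auto simp: measure_support_def)
    then obtain y where y: "y \<in> topspace Y" and
      cl: "return ?BY y \<in> weak_star Y closure_of {distr \<mu> ?BY (b g) | g. g \<in> carrier G}"
      using sp \<mu> x unfolding strongly_proximal_extension_def by blast
    let ?D = "\<lambda>\<nu>. distr \<nu> ?BZ f"
    have "?D (return ?BY y) \<in> weak_star Z closure_of (?D ` {distr \<mu> ?BY (b g) | g. g \<in> carrier G})"
      using continuous_map_image_closure_subset[OF continuous_map_distr_weak_star[OF cont(1)]] cl
      by blast
    moreover have "?D (return ?BY y) = return ?BZ (f y)"
      using y mf by (intro distr_return) auto
    moreover have "?D (distr \<mu> ?BY (b g)) = distr \<nu> ?BZ (act g)" if g: "g \<in> carrier G" for g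
    proof -
      have mb: "b g \<in> ?BY \<rightarrow>\<^sub>M ?BY"
        using GY g by (intro continuous_measurable_borel_algebra) (simp add: G_space_def)
      have "distr \<mu> ?BY (b g) = distr \<nu> ?BY (b g \<circ> f')"
        unfolding \<mu>_def using mb mf'\<nu> by (intro distr_distr) auto
      moreover have "?D (distr \<nu> ?BY (b g \<circ> f')) = distr \<nu> ?BZ (f \<circ> (b g \<circ> f'))"
        using mb mf'\<nu> mf by (intro distr_distr) (auto intro: measurable_comp)
      moreover have "\<dots> = distr \<nu> ?BZ (act g)"
        by (intro distr_cong) (auto simp: act_def sp\<nu>)
      ultimately show ?thesis by simp
    qed
    then have "?D ` {distr \<mu> ?BY (b g) | g. g \<in> carrier G} = {distr \<nu> ?BZ (act g) | g. g \<in> carrier G}"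
      by (auto simp: image_def)
    ultimately show ?thesis using f_in[OF y] by auto
  qed
  ultimately show ?thesis
    using minimal_copy[OF min] by (auto simp: is_boundary_def strongly_proximal_extension_def)
qed

end

lemma ex1_implies_eq: "\<exists>!x. P x \<Longrightarrow> P x \<Longrightarrow> P y \<Longrightarrow> x = y"
  by blast

lemma furstenberg_boundary_universal:
  fixes G :: "('g, 'm) monoid_scheme" and Y :: "'y topology"
  assumes B: "is_furstenberg_boundary G X a B c \<pi>" and Y: "is_boundary G X a Y b p"
  shows "\<exists>!\<Phi>. \<Phi> \<in> extensional (topspace B) \<and> factor_map G B c Y b \<Phi> \<and>
              (\<forall>z\<in>topspace B. p (\<Phi> z) = \<pi> z)"
proof -
  have min: "minimal_G_space G Y b" using Y by (simp add: is_boundary_def)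
  then have GY: "G_space G Y b" by (simp add: minimal_G_space_def)
  obtain f :: "'y \<Rightarrow> 'g set set" where inj: "inj_on f (topspace Y)"
    using minimal_G_space_inj[OF min] by blast
  define f' where "f' = inv_into (topspace Y) f"
  define Z where "Z = pullback_topology (f ` topspace Y) f' Y"
  have inv: "\<And>y. y \<in> topspace Y \<Longrightarrow> f' (f y) = y" using inj by (simp add: f'_def)
  have "homeomorphic_maps Y Z f f'"
    unfolding homeomorphic_maps_def
  proof (intro conjI ballI)
    show "continuous_map Y Z f"
      unfolding Z_def
      by (rule continuous_map_pullback')
        (auto intro: continuous_map_eq[OF continuous_map_id] simp: inv)
    show "continuous_map Z Y f'"
      using continuous_map_pullback[OF continuous_map_id] by (auto simp: Z_def)
  qed (auto simp: inv Z_def topspace_pullback_topology)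
  moreover have "b g \<in> topspace Y \<rightarrow> topspace Y" if "g \<in> carrier G" for g
    using GY that by (auto simp: G_space_def continuous_map_def)
  ultimately interpret space_copy G Y b Z f f' by unfold_locales auto
  have GZ: "G_space G Z act" using G_space_copy[OF GY] .
  have to_Z: "factor_map G B c Z act (\<lambda>x\<in>topspace B. f (\<Phi> x))"
    if \<Phi>: "factor_map G B c Y b \<Phi>" for \<Phi>
  proof -
    have in_Y: "\<Phi> x \<in> topspace Y" if "x \<in> topspace B" for x using \<Phi> that by (auto simp: factor_map_def)
    have c: "continuous_map B Z (\<lambda>x\<in>topspace B. f (\<Phi> x))"
      using continuous_map_compose[of B Y \<Phi> Z f] \<Phi> cont
      by (auto simp: factor_map_def o_def intro: continuous_map_eq)
    have i: "(\<lambda>x\<in>topspace B. f (\<Phi> x)) ` topspace B = topspace Z"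
      using \<Phi> f_image by (auto simp: factor_map_def image_image[symmetric] simp del: image_image)
    have cB: "c g x \<in> topspace B" if "g \<in> carrier G" "x \<in> topspace B" for g x
      using \<Phi> that by (auto simp: factor_map_def G_space_def continuous_map_def)
    show ?thesis using \<Phi> GZ c i cB in_Y by (auto simp: factor_map_def act_f)
  qed
  have to_Y: "factor_map G B c Y b (\<lambda>x\<in>topspace B. f' (\<Psi> x))"
    if \<Psi>: "factor_map G B c Z act \<Psi>" for \<Psi>
  proof -
    have in_Z: "\<Psi> x \<in> topspace Z" if "x \<in> topspace B" for x using \<Psi> that by (auto simp: factor_map_def)
    have c: "continuous_map B Y (\<lambda>x\<in>topspace B. f' (\<Psi> x))"
      using continuous_map_compose[of B Z \<Psi> Y f'] \<Psi> cont
      by (auto simp: factor_map_def o_def intro: continuous_map_eq)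
    have i: "(\<lambda>x\<in>topspace B. f' (\<Psi> x)) ` topspace B = topspace Y"
      using \<Psi> f'_image by (auto simp: factor_map_def image_image[symmetric] simp del: image_image)
    have cB: "c g x \<in> topspace B" if "g \<in> carrier G" "x \<in> topspace B" for g x
      using \<Psi> that by (auto simp: factor_map_def G_space_def continuous_map_def)
    show ?thesis using \<Psi> GY c i cB in_Z by (auto simp: factor_map_def f'_act)
  qed
  have ex1: "\<exists>!\<Psi>. \<Psi> \<in> extensional (topspace B) \<and> factor_map G B c Z act \<Psi> \<and>
              (\<forall>z\<in>topspace B. (p \<circ> f') (\<Psi> z) = \<pi> z)"
    using B boundary_copy[OF Y] unfolding is_furstenberg_boundary_def by blast
  then obtain \<Psi> where \<Psi>: "factor_map G B c Z act \<Psi>" "\<forall>z\<in>topspace B. (p \<circ> f') (\<Psi> z) = \<pi> z"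
    by blast
  show ?thesis
  proof (rule ex_ex1I)
    show "\<exists>\<Phi>. \<Phi> \<in> extensional (topspace B) \<and> factor_map G B c Y b \<Phi> \<and>
              (\<forall>z\<in>topspace B. p (\<Phi> z) = \<pi> z)"
      using to_Y[OF \<Psi>(1)] \<Psi>(2) by (intro exI[of _ "\<lambda>x\<in>topspace B. f' (\<Psi> x)"]) auto
  next
    fix \<Phi>1 \<Phi>2
    assume 1: "\<Phi>1 \<in> extensional (topspace B) \<and> factor_map G B c Y b \<Phi>1 \<and>
              (\<forall>z\<in>topspace B. p (\<Phi>1 z) = \<pi> z)"
      and 2: "\<Phi>2 \<in> extensional (topspace B) \<and> factor_map G B c Y b \<Phi>2 \<and>
              (\<forall>z\<in>topspace B. p (\<Phi>2 z) = \<pi> z)"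
    have in_Y: "\<Phi>1 x \<in> topspace Y" "\<Phi>2 x \<in> topspace Y" if "x \<in> topspace B" for x
      using 1 2 that by (auto simp: factor_map_def)
    have "(\<lambda>x\<in>topspace B. f (\<Phi>1 x)) = (\<lambda>x\<in>topspace B. f (\<Phi>2 x))"
      by (rule ex1_implies_eq[OF ex1]) (use 1 2 to_Z in_Y inv in auto)
    then have "\<Phi>1 x = \<Phi>2 x" if "x \<in> topspace B" for x
      using that in_Y inv by (metis restrict_apply')
    then show "\<Phi>1 = \<Phi>2" using 1 2 by (metis extensionalityI)
  qed
qed

end

theory Submission
  imports Defs "HOL-Analysis.Urysohn" "HOL-Probability.Probability_Mass_Function"
begin

text \<open>Write \<open>Z\<close> for the space of maps \<open>z : \<Gamma> \<rightarrow> B\<close> with \<open>z(\<gamma>h) = h\<^sup>-\<^sup>1z(\<gamma>)\<close> for \<open>h\<close> in \<open>H\<close> such that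
  \<open>\<gamma> \<pi>(z(\<gamma>))\<close> does not depend on \<open>\<gamma>\<close>; the group acts by left translation. The coordinate \<open>\<gamma>\<close> of \<open>Z\<close>
  is \<open>B\<close> with the action of \<open>H \<inter> \<gamma>H\<gamma>\<^sup>-\<^sup>1\<close> twisted by conjugation. Since \<open>H\<close> is commensurated, this
  subgroup has finite index in \<open>H\<close>, and strong proximality passes to finite index subgroups; together with weak*
  compactness of the probability measures this makes a minimal \<open>H\<close>-subset of \<open>Z\<close> an
  \<open>(H,X)\<close>-boundary. The universal property maps \<open>B\<close> into it by some \<open>\<Phi>\<close>, and
  \<open>T\<^sub>\<gamma>(y) = \<Phi>(y)(\<gamma>\<^sup>-\<^sup>1)\<close>. That \<open>T\<close> is an action, and the only one, follows from
  proximality: two maps \<open>B \<rightarrow> B\<close> with the same twisted equivariance and the same composite with \<open>\<pi>\<close>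
  agree somewhere on each nonempty closed set invariant under a suitable finite index subgroup, and \<open>B\<close> is minimal.\<close>

section \<open>The Riesz representation theorem on compact Hausdorff spaces\<close>

text \<open>An element \<gamma> outside \<open>H\<close> twists the action on \<open>B\<close> into
  an action of a conjugate subgroup, so a single twisted copy of \<open>B\<close> is not a test
  space for the universal property of \<open>(H,X)\<close>. Collecting the copies for all \<gamma>
  restores an action of the whole of \<open>H\<close>, and the condition on \<gamma>
  \<pi>(z(\<gamma>)) keeps the result over \<open>X\<close>. The price is that strong proximality
  has to be shown for possibly infinitely many coordinates, each responding to a different finite
  index subgroup: finitely many are handled by intersecting the subgroups, the rest is compactness.
  Equality of maps meets the same obstacle. One equalizer is invariant only under a finite index
  subgroup, while minimality of \<open>B\<close> concerns \<open>H\<close>; therefore whole families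
  of pairs of maps are compared at once, chosen so that the common equalizer is
  \<open>H\<close>-invariant. \<open>B\<close> is not assumed metrizable and Borel measures are not
  assumed regular, so different measures may have the same integrals and the weak* topology may fail
  to be Hausdorff. Compactness arguments therefore take place among the functionals, where the Riesz
  theorem recognises the image of the probability measures as a closed set.\<close>

lemma compact_Hausdorff_urysohn:
  assumes "compact_space Y" "Hausdorff_space Y" "closedin Y S" "closedin Y T" "disjnt S T"
  obtains g where "continuous_map Y euclideanreal g" "\<forall>x\<in>topspace Y. 0 \<le> g x \<and> g x \<le> 1"
    "\<forall>x\<in>S. g x = 0" "\<forall>x\<in>T. g x = 1"
proof -
  have "normal_space Y" using assms compact_Hausdorff_or_regular_imp_normal_space by blast
  then obtain g where g: "continuous_map Y (top_of_set {0..1::real}) g" "g ` S \<subseteq> {0}" "g ` T \<subseteq> {1}"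
    using Urysohn_lemma[OF _ assms(3-5), of 0 1] by auto
  then show ?thesis
    by (intro that[of g]) (auto simp: continuous_map_in_subtopology)
qed

lemma compact_continuous_bounded:
  assumes "compact_space Y" "continuous_map Y euclideanreal f"
  obtains c where "0 < c" "\<forall>x\<in>topspace Y. \<bar>f x\<bar> \<le> c"
proof -
  have "compactin euclideanreal (f ` topspace Y)"
    using assms by (intro image_compactin) (auto simp: compact_space_def)
  then have "bounded (f ` topspace Y)" by (simp add: compact_imp_bounded)
  then obtain c where c: "0 < c" "\<forall>x\<in>topspace Y. \<bar>f x\<bar> \<le> c" by (auto simp: bounded_pos)
  then show ?thesis by (rule that)
qed

locale mean_functional =
  fixes Y :: "'y topology" and L :: "('y \<Rightarrow> real) \<Rightarrow> real"
  assumes compact: "compact_space Y" and Hausdorff: "Hausdorff_space Y"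
    and add: "\<And>f g. continuous_map Y euclideanreal f \<Longrightarrow> continuous_map Y euclideanreal g \<Longrightarrow>
      L (\<lambda>x. f x + g x) = L f + L g"
    and scale: "\<And>f c. continuous_map Y euclideanreal f \<Longrightarrow> L (\<lambda>x. c * f x) = c * L f"
    and nonneg: "\<And>f. continuous_map Y euclideanreal f \<Longrightarrow> (\<And>x. x \<in> topspace Y \<Longrightarrow> 0 \<le> f x) \<Longrightarrow> 0 \<le> L f"
    and one: "L (\<lambda>x. 1) = 1"
begin

lemma diff:
  assumes "continuous_map Y euclideanreal f" "continuous_map Y euclideanreal g"
  shows "L (\<lambda>x. f x - g x) = L f - L g"
proof -
  have "L (\<lambda>x. f x + (-1) * g x) = L f + L (\<lambda>x. (-1) * g x)"
    using assms by (intro add continuous_intros) auto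
  then show ?thesis using scale[OF assms(2), of "-1"] by simp
qed

text \<open>Positivity is only tested on \<open>topspace Y\<close>, so in particular functions that
  agree there get the same value of \<open>L\<close>, whatever they do outside.\<close>

lemma mono:
  assumes "continuous_map Y euclideanreal f" "continuous_map Y euclideanreal g"
    and "\<And>x. x \<in> topspace Y \<Longrightarrow> f x \<le> g x"
  shows "L f \<le> L g"
  using nonneg[of "\<lambda>x. g x - f x"] diff[OF assms(2,1)] assms by (auto intro: continuous_map_diff)

lemma const: "L (\<lambda>x. c) = c"
  using scale[of "\<lambda>x. 1" c] one by simp

lemma zero: "L (\<lambda>x. 0) = 0"
  by (rule const)

lemma sum:
  assumes "finite I" "\<And>i. i \<in> I \<Longrightarrow> continuous_map Y euclideanreal (f i)"
  shows "L (\<lambda>x. \<Sum>i\<in>I. f i x) = (\<Sum>i\<in>I. L (f i))"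
  using assms
proof (induction I rule: finite_induct)
  case (insert i I)
  then have "continuous_map Y euclideanreal (\<lambda>x. \<Sum>i\<in>I. f i x)"
    by (intro continuous_map_sum) auto
  then show ?case using insert add by simp
qed (simp add: zero)

section \<open>Contents of open sets\<close>

definition below :: "'y set \<Rightarrow> ('y \<Rightarrow> real) \<Rightarrow> bool" where
  "below U f \<longleftrightarrow> continuous_map Y euclideanreal f \<and>
     (\<forall>x\<in>topspace Y. 0 \<le> f x \<and> f x \<le> 1 \<and> (x \<notin> U \<longrightarrow> f x = 0))"

text \<open>The value of the representing measure on an open set in the classical construction. Test
  functions vanish off \<open>U\<close> instead of having compact support inside \<open>U\<close>;
  \<open>trunc\<close> supplies the compactness where it is wanted.\<close>

definition content :: "'y set \<Rightarrow> real" where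
  "content U = Sup (L ` {f. below U f})"

lemma below_cont: "below U f \<Longrightarrow> continuous_map Y euclideanreal f"
  by (simp add: below_def)

lemma below_zero: "below U (\<lambda>x. 0)"
  by (simp add: below_def)

lemma below_bounds: "below U f \<Longrightarrow> 0 \<le> L f \<and> L f \<le> 1"
  using nonneg[of f] mono[of f "\<lambda>x. 1"] one by (auto simp: below_def)

lemma below_bdd: "bdd_above (L ` {f. below U f})"
  using below_bounds by (auto intro!: bdd_aboveI[of _ 1])

lemma content_upper: "below U f \<Longrightarrow> L f \<le> content U"
  unfolding content_def by (rule cSup_upper[OF _ below_bdd]) auto

lemma content_least: "(\<And>f. below U f \<Longrightarrow> L f \<le> c) \<Longrightarrow> content U \<le> c"
  unfolding content_def by (rule cSup_least) (use below_zero in auto)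

lemma content_nonneg: "0 \<le> content U"
  using content_upper[OF below_zero] zero by simp

lemma content_le_1: "content U \<le> 1"
  using below_bounds by (blast intro: content_least)

lemma below_mono: "below U f \<Longrightarrow> U \<subseteq> V \<Longrightarrow> below V f"
  by (auto simp: below_def)

lemma content_mono: "U \<subseteq> V \<Longrightarrow> content U \<le> content V"
  by (rule content_least) (rule content_upper, rule below_mono)

lemma content_empty: "content {} = 0"
proof -
  have "L f \<le> 0" if "below {} f" for f
    using mono[of f "\<lambda>x. 0"] that zero by (auto simp: below_def)
  then show ?thesis using content_least content_nonneg antisym by metis
qed

lemma content_topspace: "content (topspace Y) = 1"
proof (rule antisym)
  have "below (topspace Y) (\<lambda>x. 1)" by (simp add: below_def)
  then show "1 \<le> content (topspace Y)" using content_upper one by fastforce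
qed (rule content_le_1)

text \<open>The positive part of \<open>f - e\<close>. For \<open>below U f\<close> and
  \<open>0 < e\<close> it vanishes off the closed, hence compact, set where
  \<open>e \<le> f\<close>, and this set lies inside \<open>U\<close>. By \<open>L_trunc\<close> the
  passage from \<open>f\<close> to it costs at most \<open>e\<close>.\<close>

definition trunc :: "real \<Rightarrow> ('y \<Rightarrow> real) \<Rightarrow> 'y \<Rightarrow> real" where
  "trunc e f x = max 0 (f x - e)"

lemma trunc_cont: "continuous_map Y euclideanreal f \<Longrightarrow> continuous_map Y euclideanreal (trunc e f)"
  unfolding trunc_def by (intro continuous_intros) auto

lemma L_trunc: "continuous_map Y euclideanreal f \<Longrightarrow> L f \<le> L (trunc e f) + e"
proof -
  assume f: "continuous_map Y euclideanreal f"
  have "L f \<le> L (\<lambda>x. trunc e f x + e)"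
    by (rule mono) (use f trunc_cont[OF f] in \<open>auto intro!: continuous_intros simp: trunc_def\<close>)
  also have "\<dots> = L (trunc e f) + e" using add trunc_cont[OF f] const by simp
  finally show ?thesis .
qed

lemma superlevel_closed: "continuous_map Y euclideanreal f \<Longrightarrow> closedin Y {x \<in> topspace Y. e \<le> f x}"
  using closedin_continuous_map_preimage[of Y euclideanreal f "{e..}"] by simp

lemma superlevel_open: "continuous_map Y euclideanreal f \<Longrightarrow> openin Y {x \<in> topspace Y. e < f x}"
  using openin_continuous_map_preimage[of Y euclideanreal f "{e<..}"] by simp

lemma openin_subset_Pow: "{U. openin Y U} \<subseteq> Pow (topspace Y)"
  by (auto dest: openin_subset)

text \<open>A test function for the union is truncated and then split by a Urysohn function
  \<open>g\<close> into test functions for \<open>U\<close> and for \<open>V\<close>.\<close>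

lemma content_Un:
  assumes U: "openin Y U" and V: "openin Y V"
  shows "content (U \<union> V) \<le> content U + content V"
proof (rule content_least)
  fix f assume f: "below (U \<union> V) f"
  then have fc: "continuous_map Y euclideanreal f" by (rule below_cont)
  have "L f \<le> (content U + content V) + e" if e: "0 < e" for e
  proof -
    let ?C = "{x \<in> topspace Y. e \<le> f x}"
    have c1: "closedin Y (?C - V)" using superlevel_closed[OF fc] V by (rule closedin_diff)
    have c2: "closedin Y (topspace Y - U)" using U by blast
    have dj: "disjnt (topspace Y - U) (?C - V)"
      using f e by (force simp: disjnt_iff below_def)
    \<comment> \<open>\<open>g = 0\<close> off \<open>U\<close> makes the first product vanish off
      \<open>U\<close>. Off \<open>V\<close> the second product vanishes as well: either
      \<open>f < e\<close> and the truncation is 0, or the point lies in \<open>?C - V\<close> and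
      \<open>1 - g\<close> is 0.\<close>
    obtain g where g: "continuous_map Y euclideanreal g"
      "\<forall>x\<in>topspace Y. 0 \<le> g x \<and> g x \<le> 1"
      "\<forall>x\<in>topspace Y - U. g x = 0" "\<forall>x\<in>?C - V. g x = 1"
      by (rule compact_Hausdorff_urysohn[OF compact Hausdorff c2 c1 dj])
    have tc: "continuous_map Y euclideanreal (trunc e f)" using trunc_cont[OF fc] .
    have t01: "0 \<le> trunc e f x \<and> trunc e f x \<le> 1" if "x \<in> topspace Y" for x
      using f e that by (force simp: trunc_def below_def)
    have b1: "below U (\<lambda>x. trunc e f x * g x)"
      unfolding below_def using tc g t01 by (auto intro!: continuous_intros mult_le_one)
    have b2: "below V (\<lambda>x. trunc e f x * (1 - g x))"
      unfolding below_def
    proof (intro conjI ballI impI)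
      fix x assume x: "x \<in> topspace Y" "x \<notin> V"
      show "trunc e f x * (1 - g x) = 0"
        using bspec[OF g(4), of x] x by (cases "e \<le> f x") (auto simp: trunc_def)
    qed (use tc g t01 in \<open>auto intro!: continuous_intros mult_le_one\<close>)
    have "L (trunc e f) = L (\<lambda>x. trunc e f x * g x + trunc e f x * (1 - g x))"
      by (simp add: algebra_simps)
    also have "\<dots> = L (\<lambda>x. trunc e f x * g x) + L (\<lambda>x. trunc e f x * (1 - g x))"
      using b1 b2 add below_cont by blast
    also have "\<dots> \<le> content U + content V"
      using content_upper[OF b1] content_upper[OF b2] by simp
    finally show ?thesis using L_trunc[OF fc, of e] by simp
  qed
  then show "L f \<le> content U + content V" by (rule field_le_epsilon)
qed

lemma content_UN_finite:
  assumes "finite I" "\<And>i. i \<in> I \<Longrightarrow> openin Y (U i)"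
  shows "content (\<Union>i\<in>I. U i) \<le> (\<Sum>i\<in>I. content (U i))"
  using assms
proof (induction I rule: finite_induct)
  case (insert i I)
  then have "content (U i \<union> (\<Union>i\<in>I. U i)) \<le> content (U i) + content (\<Union>i\<in>I. U i)"
    by (intro content_Un) auto
  then show ?case using insert by simp
qed (simp add: content_empty)

text \<open>Compactness of the set where \<open>e \<le> f\<close> leaves only finitely many of the
  \<open>U i\<close>, and finite subadditivity applies to the truncated function. The values are
  extended reals because the series may diverge.\<close>

lemma content_UN:
  fixes U :: "nat \<Rightarrow> 'y set"
  assumes U: "\<And>i. openin Y (U i)"
  shows "ennreal (content (\<Union>i. U i)) \<le> (\<Sum>i. ennreal (content (U i)))"
proof -
  have *: "ennreal (L f) \<le> (\<Sum>i. ennreal (content (U i)))" if f: "below (\<Union>i. U i) f" for f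
  proof (rule ennreal_le_epsilon)
    fix e :: real assume e: "0 < e"
    have fc: "continuous_map Y euclideanreal f" using f by (rule below_cont)
    let ?C = "{x \<in> topspace Y. e \<le> f x}"
    have "compactin Y ?C"
      using closedin_compact_space[OF compact superlevel_closed[OF fc]] .
    moreover have "?C \<subseteq> \<Union>(range U)" using f e by (force simp: below_def)
    ultimately obtain \<F> where \<F>: "finite \<F>" "\<F> \<subseteq> range U" "?C \<subseteq> \<Union>\<F>"
      using U compactinD[of Y ?C "range U"] by auto
    then obtain I where I: "finite I" "\<F> = U ` I" by (meson finite_subset_image)
    have "below (\<Union>i\<in>I. U i) (trunc e f)"
      unfolding below_def
    proof (intro conjI ballI impI)
      fix x assume x: "x \<in> topspace Y"
      show "trunc e f x \<le> 1" using f x e by (force simp: trunc_def below_def)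
      assume "x \<notin> (\<Union>i\<in>I. U i)"
      then have "x \<notin> ?C" using \<F> I by auto
      then show "trunc e f x = 0" using x by (simp add: trunc_def)
    qed (auto simp: trunc_cont[OF fc] trunc_def)
    then have "L (trunc e f) \<le> (\<Sum>i\<in>I. content (U i))"
      using content_upper content_UN_finite[OF I(1), of U] U by fastforce
    then have "L f \<le> (\<Sum>i\<in>I. content (U i)) + e" using L_trunc[OF fc, of e] by simp
    then have "ennreal (L f) \<le> ennreal ((\<Sum>i\<in>I. content (U i)) + e)" by (rule ennreal_leI)
    also have "\<dots> = (\<Sum>i\<in>I. ennreal (content (U i))) + ennreal e"
      using content_nonneg e by (simp add: sum_nonneg ennreal_plus)
    also have "(\<Sum>i\<in>I. ennreal (content (U i))) \<le> (\<Sum>i. ennreal (content (U i)))"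
      by (rule sum_le_suminf) (auto simp: I)
    finally show "ennreal (L f) \<le> (\<Sum>i. ennreal (content (U i))) + ennreal e"
      by (simp add: add_right_mono)
  qed
  show ?thesis
  proof (cases "(\<Sum>i. ennreal (content (U i)))" rule: ennreal_cases)
    case (real r)
    have "content (\<Union>i. U i) \<le> r"
      using * real by (intro content_least) (simp add: ennreal_le_iff)
    then show ?thesis using real by (simp add: ennreal_leI)
  qed simp
qed

section \<open>The outer measure and the Caratheodory condition\<close>

definition outer :: "'y set \<Rightarrow> ennreal" where
  "outer E = (INF U\<in>{U. openin Y U \<and> E \<subseteq> U}. ennreal (content U))"

lemma outer_lower: "openin Y U \<Longrightarrow> E \<subseteq> U \<Longrightarrow> outer E \<le> ennreal (content U)"
  unfolding outer_def by (rule INF_lower) auto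

lemma outer_open: "openin Y U \<Longrightarrow> outer U = ennreal (content U)"
  unfolding outer_def by (rule antisym, rule INF_lower)
    (auto intro!: INF_greatest ennreal_leI content_mono)

lemma outer_mono: "E \<subseteq> F \<Longrightarrow> outer E \<le> outer F"
  unfolding outer_def by (rule INF_superset_mono) auto

lemma outer_approx:
  assumes "E \<subseteq> topspace Y" "0 < e"
  obtains U where "openin Y U" "E \<subseteq> U" "ennreal (content U) \<le> outer E + ennreal e"
proof -
  have "outer E \<le> outer (topspace Y)" using assms outer_mono by blast
  then have "outer E \<noteq> \<infinity>" using outer_open[of "topspace Y"] by (auto simp: top_unique)
  then have "outer E < outer E + ennreal e" using assms by (simp add: ennreal_add_left_cancel_less)
  then obtain U where "openin Y U \<and> E \<subseteq> U" "ennreal (content U) < outer E + ennreal e"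
    unfolding outer_def INF_less_iff by auto
  then show ?thesis using that by (auto intro: less_imp_le)
qed

lemma outer_UN:
  fixes A :: "nat \<Rightarrow> 'y set"
  assumes A: "\<And>i. A i \<subseteq> topspace Y"
  shows "outer (\<Union>i. A i) \<le> (\<Sum>i. outer (A i))"
proof (rule ennreal_le_epsilon)
  fix e :: real assume e: "0 < e"
  \<comment> \<open>The errors \<open>e * (1/2) ^ Suc i\<close> add up to exactly
    \<open>e\<close>.\<close>
  have "\<exists>U. openin Y U \<and> A i \<subseteq> U \<and> ennreal (content U) \<le> outer (A i) + ennreal (e * (1/2) ^ Suc i)" for i
    using outer_approx[OF A, of "e * (1/2) ^ Suc i" i] e by (metis mult_pos_pos zero_less_power half_gt_zero zero_less_one)
  then obtain U where U: "\<And>i. openin Y (U i)" "\<And>i. A i \<subseteq> U i"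
    "\<And>i. ennreal (content (U i)) \<le> outer (A i) + ennreal (e * (1/2) ^ Suc i)" by metis
  have "outer (\<Union>i. A i) \<le> ennreal (content (\<Union>i. U i))" using U by (intro outer_lower) auto
  also have "\<dots> \<le> (\<Sum>i. ennreal (content (U i)))" using U by (intro content_UN)
  also have "\<dots> \<le> (\<Sum>i. outer (A i) + ennreal (e * (1/2) ^ Suc i))"
    using U by (intro suminf_le) auto
  also have "\<dots> = (\<Sum>i. outer (A i)) + (\<Sum>i. ennreal (e * (1/2) ^ Suc i))"
    by (intro suminf_add[symmetric]) auto
  also have "(\<Sum>i. ennreal (e * (1/2) ^ Suc i)) = ennreal e"
    using e sums_mult[OF power_half_series, of e]
    by (intro suminf_ennreal_eq) auto
  finally show "outer (\<Union>i. A i) \<le> (\<Sum>i. outer (A i)) + ennreal e" .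
qed

lemma outer_measure_space: "outer_measure_space (Pow (topspace Y)) outer"
  unfolding outer_measure_space_def
proof (intro conjI)
  show "positive (Pow (topspace Y)) outer"
    using outer_open[of "{}"] by (simp add: positive_def content_empty)
  show "increasing (Pow (topspace Y)) outer" using outer_mono by (auto simp: increasing_def)
  show "countably_subadditive (Pow (topspace Y)) outer"
    using outer_UN by (auto simp: countably_subadditive_def image_subset_iff)
qed

text \<open>Take \<open>f\<close> nearly optimal for \<open>V \<inter> U\<close> and any
  \<open>h\<close> below \<open>V - C\<close>, where \<open>C\<close> is the set on which
  \<open>d \<le> f\<close>. The truncation of \<open>f\<close> vanishes off \<open>C\<close> and
  \<open>h\<close> vanishes on \<open>C\<close>, so their sum is still bounded by 1 and is a test
  function for \<open>V\<close>. As \<open>V - U\<close> lies in \<open>V - C\<close>, additivity of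
  \<open>L\<close> gives the estimate.\<close>

lemma outer_split_open:
  assumes U: "openin Y U" and V: "openin Y V"
  shows "outer (V \<inter> U) + outer (V - U) \<le> outer V"
proof (rule ennreal_le_epsilon)
  fix e :: real assume "0 < e"
  \<comment> \<open>One \<open>d\<close> pays for the near optimality of \<open>f\<close>, the other
    for its truncation.\<close>
  define d where "d = e / 2"
  have d: "0 < d" "e = d + d" using \<open>0 < e\<close> by (auto simp: d_def)
  have "content (V \<inter> U) - d < content (V \<inter> U)" using d by simp
  then obtain f where f: "below (V \<inter> U) f" "content (V \<inter> U) - d < L f"
    unfolding content_def using less_cSup_iff[OF _ below_bdd] below_zero by blast
  have fc: "continuous_map Y euclideanreal f" using f below_cont by blast
  define C where "C = {x \<in> topspace Y. d \<le> f x}"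
  have VC: "openin Y (V - C)" using V superlevel_closed[OF fc] by (auto simp: C_def)
  have "V - U \<subseteq> V - C" using f d by (force simp: C_def below_def)
  then have o: "outer (V - U) \<le> ennreal (content (V - C))" using outer_lower VC by blast
  have "L h \<le> content V - (content (V \<inter> U) - d - d)" if h: "below (V - C) h" for h
  proof -
    have "below V (\<lambda>x. trunc d f x + h x)"
      unfolding below_def
    proof (intro conjI ballI impI)
      show "continuous_map Y euclideanreal (\<lambda>x. trunc d f x + h x)"
        using trunc_cont[OF fc] h below_cont by (intro continuous_intros) auto
    next
      fix x assume x: "x \<in> topspace Y"
      have h': "0 \<le> h x" "h x \<le> 1" "x \<in> C \<Longrightarrow> h x = 0" "x \<notin> V \<Longrightarrow> h x = 0"
        using h x by (auto simp: below_def)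
      have f': "0 \<le> f x" "f x \<le> 1" "x \<notin> V \<Longrightarrow> f x = 0" using f x by (auto simp: below_def)
      show "0 \<le> trunc d f x + h x" using h' by (simp add: trunc_def)
      show "trunc d f x + h x \<le> 1"
        using h' f' x d by (cases "x \<in> C") (auto simp: trunc_def C_def)
      show "trunc d f x + h x = 0" if "x \<notin> V" using h' f' d that by (simp add: trunc_def)
    qed
    then have "L (\<lambda>x. trunc d f x + h x) \<le> content V" by (rule content_upper)
    moreover have "L (\<lambda>x. trunc d f x + h x) = L (trunc d f) + L h"
      using trunc_cont[OF fc] below_cont[OF h] by (rule add)
    ultimately show ?thesis using L_trunc[OF fc, of d] f by simp
  qed
  then have "content (V - C) \<le> content V - (content (V \<inter> U) - d - d)" by (rule content_least)
  then have "content (V \<inter> U) + content (V - C) \<le> content V + e" using d by simp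
  then have "ennreal (content (V \<inter> U)) + ennreal (content (V - C)) \<le> ennreal (content V) + ennreal e"
    using content_nonneg \<open>0 < e\<close> by (simp flip: ennreal_plus add: ennreal_leI)
  then show "outer (V \<inter> U) + outer (V - U) \<le> outer V + ennreal e"
    using o U V outer_open[OF openin_Int[OF V U]] outer_open[of V]
    by (auto intro: order_trans[OF add_left_mono])
qed

text \<open>An arbitrary test set \<open>E\<close> is replaced by an open superset of nearly the
  same outer measure, for which \<open>outer_split_open\<close> applies; the opposite inequality is
  subadditivity.\<close>

lemma open_in_lambda_system:
  assumes U: "openin Y U"
  shows "U \<in> lambda_system (topspace Y) (Pow (topspace Y)) outer"
proof -
  have "outer (E \<inter> U) + outer (E - U) = outer E" if E: "E \<in> Pow (topspace Y)" for E
  proof (rule antisym)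
    show "outer (E \<inter> U) + outer (E - U) \<le> outer E"
    proof (rule ennreal_le_epsilon)
      fix e :: real assume "0 < e"
      then obtain V where V: "openin Y V" "E \<subseteq> V" "ennreal (content V) \<le> outer E + ennreal e"
        using outer_approx E by blast
      have "outer (E \<inter> U) + outer (E - U) \<le> outer (V \<inter> U) + outer (V - U)"
        using V by (intro add_mono outer_mono) auto
      also have "\<dots> \<le> outer V" using outer_split_open[OF U V(1)] .
      finally show "outer (E \<inter> U) + outer (E - U) \<le> outer E + ennreal e"
        using V outer_open by auto
    qed
    have "subadditive (Pow (topspace Y)) outer"
      using outer_measure_space ring_of_sets.countably_subadditive_subadditive[of "topspace Y" "Pow (topspace Y)" outer]
        sigma_algebra_Pow[of "topspace Y"]
      by (auto simp: outer_measure_space_def sigma_algebra_def algebra_def)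
    then have "outer ((E \<inter> U) \<union> (E - U)) \<le> outer (E \<inter> U) + outer (E - U)"
      using E by (intro subadditiveD) auto
    then show "outer E \<le> outer (E \<inter> U) + outer (E - U)" by (simp add: Int_Diff_Un)
  qed
  then show ?thesis
    using algebra.lambda_system_eq[of "topspace Y" "Pow (topspace Y)" outer] sigma_algebra_Pow[of "topspace Y"]
      openin_subset[OF U]
    by (auto simp: sigma_algebra_def)
qed

section \<open>The representing measure\<close>

definition rep :: "'y measure" where
  "rep = measure_of (topspace Y) {U. openin Y U} outer"

lemma sets_rep: "sets rep = sets (borel_algebra Y)"
  unfolding rep_def borel_algebra_def by (subst (1 2) sets_measure_of) (auto dest: openin_subset)

lemma space_rep: "space rep = topspace Y"
  using sets_eq_imp_space_eq[OF sets_rep] by simp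

text \<open>\<open>measure_of\<close> falls back to the zero measure unless its set function is a
  measure on the generated sigma-algebra. Caratheodory's lemma makes \<open>outer\<close> a measure
  on the lambda system, which contains the open sets and hence all Borel sets.\<close>

lemma emeasure_rep:
  assumes "openin Y U" shows "emeasure rep U = ennreal (content U)"
proof -
  let ?ls = "lambda_system (topspace Y) (Pow (topspace Y)) outer"
  have ms: "measure_space (topspace Y) ?ls outer"
    using sigma_algebra.caratheodory_lemma[OF sigma_algebra_Pow outer_measure_space] .
  have sub: "sigma_sets (topspace Y) {U. openin Y U} \<subseteq> ?ls"
    using ms open_in_lambda_system by (intro sigma_algebra.sigma_sets_subset) (auto simp: measure_space_def)
  have "measure_space (topspace Y) (sigma_sets (topspace Y) {U. openin Y U}) outer"
    using measure_down[OF ms _ sub] sigma_algebra_sigma_sets[of "{U. openin Y U}" "topspace Y"]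
    by (auto dest: openin_subset)
  then have "emeasure rep U = outer U"
    using openin_sets_borel_algebra[OF assms]
    by (intro emeasure_measure_of[OF rep_def])
      (auto simp: measure_space_def sets_rep openin_subset[THEN subsetD], auto simp: borel_algebra_def openin_subset_Pow)
  then show ?thesis using outer_open[OF assms] by simp
qed

lemma rep_prob_space: "prob_space rep"
  by (rule prob_spaceI) (simp add: space_rep emeasure_rep content_topspace)

lemma rep_probs: "rep \<in> borel_probs Y"
  using rep_prob_space sets_rep by (simp add: borel_probs_def)

lemma rep_integrable:
  assumes f: "continuous_map Y euclideanreal f" and "\<And>x. x \<in> topspace Y \<Longrightarrow> \<bar>f x\<bar> \<le> c"
  shows "integrable rep f"
proof -
  interpret R: prob_space rep by (rule rep_prob_space)
  have "f \<in> borel_measurable rep"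
    using continuous_real_measurable[OF f] by (simp add: measurable_cong_sets[OF sets_rep refl])
  moreover have "AE x in rep. norm (f x) \<le> c" using assms by (intro AE_I2) (simp add: space_rep)
  ultimately show ?thesis by (intro R.integrable_const_bound)
qed

text \<open>Cutting the range of \<open>f\<close> into \<open>n\<close> slices, each slice is below an open superlevel set.\<close>

lemma L_le_integral:
  assumes f: "continuous_map Y euclideanreal f" and f01: "\<And>x. x \<in> topspace Y \<Longrightarrow> 0 \<le> f x \<and> f x \<le> 1"
  shows "L f \<le> integral\<^sup>L rep f"
proof (rule field_le_epsilon)
  fix e :: real assume "0 < e"
  interpret R: prob_space rep by (rule rep_prob_space)
  obtain m where "1 / real (Suc m) < e" using \<open>0 < e\<close> by (rule nat_approx_posE)
  then obtain n where n: "0 < n" "1 / real n < e" by blast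
  define U where "U k = {x \<in> topspace Y. real k / n < f x}" for k
  \<comment> \<open>\<open>s k\<close> is the part of \<open>f\<close> between the heights
    \<open>k / n\<close> and \<open>(k + 1) / n\<close>. Rescaled by \<open>n\<close> it is a test
    function for \<open>U k\<close>, and the partial sums telescope to
    \<open>min (f x) (j / n)\<close>.\<close>
  define s where "s k x = max 0 (min (f x - real k / n) (1 / n))" for k x
  have sc: "continuous_map Y euclideanreal (s k)" for k
    unfolding s_def using f by (intro continuous_intros) auto
  have sn: "below (U k) (\<lambda>x. real n * s k x)" for k
  proof -
    have "0 \<le> n * s k x" "n * s k x \<le> n * (1 / n)" "s k x = 0" if "\<not> real k / n < f x" for x
      using that n by (auto simp: s_def)
    moreover have "0 \<le> n * s k x" "n * s k x \<le> n * (1 / n)" for x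
      using n by (intro mult_nonneg_nonneg mult_left_mono; simp add: s_def)+
    ultimately show ?thesis
      unfolding below_def U_def using sc n by (auto intro!: continuous_intros)
  qed
  have Uo: "openin Y (U k)" for k unfolding U_def by (rule superlevel_open[OF f])
  have slices: "(\<Sum>k<j. s k x) = min (f x) (real j / n)" if "x \<in> topspace Y" for j x
  proof (induction j)
    case (Suc j)
    have "real (Suc j) / n = real j / n + 1 / n" "0 < 1 / n" "0 \<le> real j / n"
      using n by (simp_all add: add_divide_distrib)
    moreover have "min y r + max 0 (min (y - r) t) = min y (r + t)" if "0 < t" for y r t :: real
      using that by (auto simp: min_def max_def)
    ultimately show ?case using Suc by (simp add: s_def del: of_nat_Suc)
  qed (use f01[OF that] in auto)
  \<comment> \<open>Every \<open>k\<close> that is counted satisfies \<open>k / n < f x\<close>, so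
    the step function exceeds \<open>f\<close> by at most one step \<open>1 / n\<close>; the bound
    \<open>j / n\<close> keeps the induction going when \<open>U j\<close> contributes.\<close>
  have steps: "(\<Sum>k<j. indicator (U k) x / real n) \<le> min (f x + 1 / n) (real j / n)"
    if "x \<in> topspace Y" for j x
  proof (induction j)
    case (Suc j)
    have "real (Suc j) / n = real j / n + 1 / n" "0 < 1 / n"
      using n by (simp_all add: add_divide_distrib)
    then show ?case using Suc that by (cases "x \<in> U j") (auto simp: U_def)
  qed (use f01[OF that] n in auto)
  have "L f \<le> L (\<lambda>x. \<Sum>k<n. s k x)"
    using sc f f01 n by (intro mono continuous_map_sum) (auto simp: slices)
  also have "\<dots> = (\<Sum>k<n. L (s k))" using sc by (intro sum) auto
  also have "\<dots> \<le> (\<Sum>k<n. measure rep (U k) / n)"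
  proof (rule sum_mono)
    fix k
    have "real n * L (s k) \<le> content (U k)"
      using content_upper[OF sn] scale[OF sc] by simp
    also have "\<dots> = measure rep (U k)"
      using emeasure_rep[OF Uo] by (simp add: measure_def content_nonneg)
    finally show "L (s k) \<le> measure rep (U k) / n" using n by (simp add: field_simps)
  qed
  also have "\<dots> = integral\<^sup>L rep (\<lambda>x. \<Sum>k<n. indicator (U k) x / real n)"
  proof -
    have "U k \<in> sets rep" for k using Uo sets_rep openin_sets_borel_algebra by auto
    then show ?thesis by (subst Bochner_Integration.integral_sum) (auto simp: R.emeasure_eq_measure)
  qed
  also have "\<dots> \<le> integral\<^sup>L rep (\<lambda>x. f x + 1 / n)"
  proof (rule integral_mono)
    have "U k \<in> sets rep" for k using Uo sets_rep openin_sets_borel_algebra by auto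
    then show "integrable rep (\<lambda>x. \<Sum>k<n. indicator (U k) x / real n)"
      by (intro Bochner_Integration.integrable_sum) (auto simp: R.emeasure_eq_measure)
    show "integrable rep (\<lambda>x. f x + 1 / n)"
      using rep_integrable[OF f, of 1] f01 by auto
    show "(\<Sum>k<n. indicator (U k) x / real n) \<le> f x + 1 / n" if "x \<in> space rep" for x
      using steps[of x n] that by (simp add: space_rep)
  qed
  also have "\<dots> = integral\<^sup>L rep f + 1 / n"
    using rep_integrable[OF f, of 1] f01 R.prob_space by (subst Bochner_Integration.integral_add) auto
  finally show "L f \<le> integral\<^sup>L rep f + e" using n by simp
qed

text \<open>\<open>L_le_integral\<close> is one-sided, but it applies to \<open>g\<close> and to
  \<open>1 - g\<close>, and both sides give the constant 1 the value 1. This forces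
  equality.\<close>

theorem riesz:
  assumes f: "continuous_map Y euclideanreal f"
  shows "L f = integral\<^sup>L rep f"
proof -
  interpret R: prob_space rep by (rule rep_prob_space)
  obtain c where c: "0 < c" "\<forall>x\<in>topspace Y. \<bar>f x\<bar> \<le> c"
    by (rule compact_continuous_bounded[OF compact f])
  \<comment> \<open>An affine change of scale: \<open>\<bar>f x\<bar> \<le> c\<close> places
    \<open>g\<close> between 0 and 1.\<close>
  define g where "g x = (f x + c) / (2 * c)" for x
  have gc: "continuous_map Y euclideanreal g"
    unfolding g_def using f c by (intro continuous_intros) auto
  have g01: "0 \<le> g x \<and> g x \<le> 1" if "x \<in> topspace Y" for x
    using c(1) bspec[OF c(2) that] by (auto simp: g_def field_simps abs_le_iff)
  have gi: "integrable rep g" using rep_integrable[OF gc, of 1] g01 by auto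
  have "L (\<lambda>x. 1 - g x) \<le> integral\<^sup>L rep (\<lambda>x. 1 - g x)"
    by (rule L_le_integral) (use gc g01 in \<open>auto intro!: continuous_intros\<close>)
  then have "1 - L g \<le> 1 - integral\<^sup>L rep g"
    using diff[of "\<lambda>x. 1" g] gc one gi R.prob_space by simp
  moreover have "L g \<le> integral\<^sup>L rep g" by (rule L_le_integral[OF gc g01])
  ultimately have eq: "L g = integral\<^sup>L rep g" by simp
  have fg: "f = (\<lambda>x. 2 * c * g x + - c)" using c by (auto simp: g_def field_simps)
  have "L f = 2 * c * L g - c"
    using add[of "\<lambda>x. 2 * c * g x" "\<lambda>x. - c"] scale[OF gc, of "2 * c"] const[of "- c"] gc
    by (subst fg) (simp add: continuous_map_real_mult_left)
  moreover have "integral\<^sup>L rep f = 2 * c * integral\<^sup>L rep g - c"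
    using gi R.prob_space by (subst fg) simp
  ultimately show ?thesis using eq by simp
qed

end

section \<open>The weak* topology\<close>

text \<open>Open sets of an initial topology are preimages, so a cover of \<open>A\<close> comes
  from a cover of its image. Points with the same image are not separated, which is the situation of
  measures with the same integrals.\<close>

lemma compact_space_pullback:
  assumes "compactin T (f ` A)"
  shows "compact_space (pullback_topology A f T)"
proof -
  have sub: "f ` A \<subseteq> topspace T" using assms compactin_subset_topspace by blast
  then have ts: "topspace (pullback_topology A f T) = A" by (auto simp: topspace_pullback_topology)
  show ?thesis
    unfolding compact_space_alt ts
  proof (intro allI impI, elim conjE)
    fix \<U> assume \<U>: "\<forall>U\<in>\<U>. openin (pullback_topology A f T) U" "A \<subseteq> \<Union>\<U>"
    then have "\<forall>U\<in>\<U>. \<exists>V. openin T V \<and> U = f -` V \<inter> A" by (simp add: openin_pullback_topology)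
    then obtain V where V: "\<And>U. U \<in> \<U> \<Longrightarrow> openin T (V U) \<and> U = f -` V U \<inter> A" by metis
    have "f ` A \<subseteq> \<Union>(V ` \<U>)"
    proof
      fix t assume "t \<in> f ` A"
      then obtain x U where "t = f x" "x \<in> A" "U \<in> \<U>" "x \<in> U" using \<U> by blast
      then show "t \<in> \<Union>(V ` \<U>)" using V[of U] by blast
    qed
    moreover have "\<forall>W\<in>V ` \<U>. openin T W" using V by blast
    ultimately obtain \<F> where \<F>: "finite \<F>" "\<F> \<subseteq> V ` \<U>" "f ` A \<subseteq> \<Union>\<F>"
      using assms unfolding compactin_def by meson
    then obtain \<G> where \<G>: "finite \<G>" "\<G> \<subseteq> \<U>" "\<F> = V ` \<G>" by (meson finite_subset_image)
    have "A \<subseteq> \<Union>\<G>"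
    proof
      fix x assume x: "x \<in> A"
      then obtain U where "U \<in> \<G>" "f x \<in> V U" using \<F> \<G> by blast
      then show "x \<in> \<Union>\<G>" using V[of U] \<G> x by blast
    qed
    then show "\<exists>\<F>. finite \<F> \<and> \<F> \<subseteq> \<U> \<and> A \<subseteq> \<Union>\<F>" using \<G> by blast
  qed
qed

definition integrals :: "'y topology \<Rightarrow> 'y measure \<Rightarrow> ('y \<Rightarrow> real) \<Rightarrow> real" where
  "integrals Y \<nu> = (\<lambda>f\<in>{f. continuous_map Y euclideanreal f}. integral\<^sup>L \<nu> f)"

abbreviation functionals :: "'y topology \<Rightarrow> (('y \<Rightarrow> real) \<Rightarrow> real) topology" where
  "functionals Y \<equiv> product_topology (\<lambda>_. euclideanreal) {f. continuous_map Y euclideanreal f}"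

lemma weak_star_eq: "weak_star Y = pullback_topology (borel_probs Y) (integrals Y) (functionals Y)"
  by (simp add: weak_star_def integrals_def[abs_def])

lemma continuous_integrals: "continuous_map (weak_star Y) (functionals Y) (integrals Y)"
  using continuous_map_pullback[OF continuous_map_id] by (auto simp: weak_star_eq)

lemma Hausdorff_functionals: "Hausdorff_space (functionals Y)"
  by (simp add: Hausdorff_space_product_topology)

lemma continuous_map_eval_functionals:
  "continuous_map Y euclideanreal f \<Longrightarrow> continuous_map (functionals Y) euclideanreal (\<lambda>\<phi>. \<phi> f)"
  by (rule continuous_map_product_projection) simp

lemma borel_probs_space: "\<nu> \<in> borel_probs Y \<Longrightarrow> space \<nu> = topspace Y"
  using sets_eq_imp_space_eq[of \<nu> "borel_algebra Y"] by (simp add: borel_probs_def)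

lemma borel_probs_open_sets: "\<nu> \<in> borel_probs Y \<Longrightarrow> openin Y U \<Longrightarrow> U \<in> sets \<nu>"
  by (simp add: borel_probs_def openin_sets_borel_algebra)

lemma borel_probs_measurable:
  assumes "\<nu> \<in> borel_probs Y" "continuous_map Y Z f"
  shows "f \<in> \<nu> \<rightarrow>\<^sub>M borel_algebra Z"
proof -
  have "sets \<nu> = sets (borel_algebra Y)" using assms(1) by (simp add: borel_probs_def)
  then show ?thesis
    using continuous_measurable_borel_algebra[OF assms(2)] measurable_cong_sets by blast
qed

lemma borel_probs_integrable:
  assumes "compact_space Y" "\<nu> \<in> borel_probs Y" "continuous_map Y euclideanreal f"
  shows "integrable \<nu> f"
proof -
  interpret prob_space \<nu> using assms by (simp add: borel_probs_def)
  obtain c where c: "\<forall>x\<in>topspace Y. \<bar>f x\<bar> \<le> c"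
    using compact_continuous_bounded[OF assms(1,3)] by blast
  have "sets \<nu> = sets (borel_algebra Y)" using assms by (simp add: borel_probs_def)
  then have "f \<in> borel_measurable \<nu>"
    using continuous_real_measurable[OF assms(3)] measurable_cong_sets by blast
  moreover have "AE x in \<nu>. norm (f x) \<le> c"
    using c borel_probs_space[OF assms(2)] by (intro AE_I2) simp
  ultimately show ?thesis by (intro integrable_const_bound)
qed

lemma integral_distr_continuous:
  assumes "\<nu> \<in> borel_probs Y" "continuous_map Y Z p" "continuous_map Z euclideanreal f"
  shows "integral\<^sup>L (distr \<nu> (borel_algebra Z) p) f = integral\<^sup>L \<nu> (\<lambda>y. f (p y))"
  by (rule integral_distr[OF borel_probs_measurable[OF assms(1,2)] continuous_real_measurable[OF assms(3)]])

lemma distr_distr_continuous: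
  assumes "\<nu> \<in> borel_probs Y" "continuous_map Y Z f" "continuous_map Z V g"
  shows "distr (distr \<nu> (borel_algebra Z) f) (borel_algebra V) g = distr \<nu> (borel_algebra V) (\<lambda>y. g (f y))"
  using distr_distr[OF continuous_measurable_borel_algebra[OF assms(3)] borel_probs_measurable[OF assms(1,2)]]
  by (simp add: o_def)

text \<open>The Riesz theorem read as a description of a set. As \<phi> is a point of the product it
  is extensional, so agreement on continuous functions makes it equal to
  \<open>integrals Y rep\<close>.\<close>

lemma mean_functional_iff_integrals:
  assumes Y: "compact_space Y" "Hausdorff_space Y" and \<phi>: "\<phi> \<in> topspace (functionals Y)"
  shows "mean_functional Y \<phi> \<longleftrightarrow> \<phi> \<in> integrals Y ` borel_probs Y"
proof
  assume "mean_functional Y \<phi>"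
  then interpret mean_functional Y \<phi> .
  have "\<phi> = integrals Y rep"
    using riesz \<phi> by (auto simp: integrals_def fun_eq_iff PiE_def extensional_def)
  then show "\<phi> \<in> integrals Y ` borel_probs Y" using rep_probs by blast
next
  assume "\<phi> \<in> integrals Y ` borel_probs Y"
  then obtain \<nu> where \<nu>: "\<nu> \<in> borel_probs Y" "\<phi> = integrals Y \<nu>" by blast
  interpret prob_space \<nu> using \<nu> by (simp add: borel_probs_def)
  have i: "continuous_map Y euclideanreal f \<Longrightarrow> integrable \<nu> f" for f
    using borel_probs_integrable Y \<nu> by blast
  show "mean_functional Y \<phi>"
  proof
    fix f assume "continuous_map Y euclideanreal f" "\<And>x. x \<in> topspace Y \<Longrightarrow> 0 \<le> f x"
    then show "0 \<le> \<phi> f"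
      using \<nu> borel_probs_space[OF \<nu>(1)] by (auto simp: integrals_def intro: integral_nonneg_AE AE_I2)
  qed (use Y \<nu> i prob_space in \<open>auto simp: integrals_def continuous_map_add continuous_map_real_mult_left\<close>)
qed

lemma mean_functional_iff:
  assumes Y: "compact_space Y" "Hausdorff_space Y"
  shows "mean_functional Y \<phi> \<longleftrightarrow>
    (\<forall>f g. continuous_map Y euclideanreal f \<longrightarrow> continuous_map Y euclideanreal g \<longrightarrow>
       \<phi> (\<lambda>x. f x + g x) = \<phi> f + \<phi> g) \<and>
    (\<forall>f c. continuous_map Y euclideanreal f \<longrightarrow> \<phi> (\<lambda>x. c * f x) = c * \<phi> f) \<and>
    (\<forall>f. continuous_map Y euclideanreal f \<longrightarrow> (\<forall>x\<in>topspace Y. 0 \<le> f x) \<longrightarrow> 0 \<le> \<phi> f) \<and>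
    \<phi> (\<lambda>x. 1) = 1"
  using Y unfolding mean_functional_def by auto

text \<open>Each axiom compares finitely many coordinates of \<phi> by an equation or inequality
  between continuous expressions, and such relations survive in the closure.\<close>

lemma closedin_mean_functionals:
  assumes Y: "compact_space Y" "Hausdorff_space Y"
  shows "closedin (functionals Y) {\<phi> \<in> topspace (functionals Y). mean_functional Y \<phi>}" (is "closedin ?P ?S")
proof -
  have "mean_functional Y \<phi>" if \<phi>: "\<phi> \<in> ?P closure_of ?S" for \<phi>
  proof -
    have S: "mean_functional Y \<psi>" if "\<psi> \<in> ?S" for \<psi> using that by simp
    note ev = continuous_map_eval_functionals
    have eq: "u \<phi> = v \<phi>"
      if "continuous_map ?P euclideanreal u" "continuous_map ?P euclideanreal v"
        "\<And>\<psi>. \<psi> \<in> ?S \<Longrightarrow> u \<psi> = v \<psi>" for u v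
      by (rule forall_in_closure_of_eq[OF \<phi> Hausdorff_space_euclidean that])
    show ?thesis
      unfolding mean_functional_iff[OF Y]
    proof (intro conjI allI impI)
      fix f g assume f: "continuous_map Y euclideanreal f" and g: "continuous_map Y euclideanreal g"
      show "\<phi> (\<lambda>x. f x + g x) = \<phi> f + \<phi> g"
        by (rule eq[of "\<lambda>\<psi>. \<psi> (\<lambda>x. f x + g x)" "\<lambda>\<psi>. \<psi> f + \<psi> g"])
          (use f g S in \<open>auto simp: mean_functional_iff[OF Y] intro!: continuous_map_add ev\<close>)
    next
      fix f c assume f: "continuous_map Y euclideanreal f"
      show "\<phi> (\<lambda>x. c * f x) = c * \<phi> f"
        by (rule eq[of "\<lambda>\<psi>. \<psi> (\<lambda>x. c * f x)" "\<lambda>\<psi>. c * \<psi> f"])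
          (use f S in \<open>auto simp: mean_functional_iff[OF Y] intro!: continuous_map_real_mult_left ev\<close>)
    next
      show "\<phi> (\<lambda>x. 1) = 1"
        by (rule eq[of "\<lambda>\<psi>. \<psi> (\<lambda>x. 1)" "\<lambda>\<psi>. 1"])
          (use S in \<open>auto simp: mean_functional_iff[OF Y] intro!: ev\<close>)
    next
      fix f assume f: "continuous_map Y euclideanreal f" "\<forall>x\<in>topspace Y. 0 \<le> f x"
      have "closedin ?P {\<psi> \<in> topspace ?P. \<psi> f \<in> {0..}}"
        by (rule closedin_continuous_map_preimage[OF ev[OF f(1)]]) simp
      then show "0 \<le> \<phi> f"
        using forall_in_closure_of[OF \<phi>, of "\<lambda>\<psi>. \<psi> f \<in> {0..}"] S f by (auto simp: mean_functional_iff[OF Y])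
    qed
  qed
  then have "?P closure_of ?S \<subseteq> ?S" using closure_of_subset_topspace[of ?P ?S] by blast
  moreover have "?S \<subseteq> topspace ?P" by blast
  ultimately show ?thesis using closure_of_subset_eq[of ?S ?P] by blast
qed

text \<open>The Banach-Alaoglu argument: the mean functionals form a closed subset of a Tychonoff
  box, and compactness is pulled back from there.\<close>

theorem compact_space_weak_star:
  assumes Y: "compact_space Y" "Hausdorff_space Y"
  shows "compact_space (weak_star Y)"
proof -
  let ?C = "{f. continuous_map Y euclideanreal f}"
  let ?S = "{\<phi> \<in> topspace (functionals Y). mean_functional Y \<phi>}"
  have "integrals Y ` borel_probs Y \<subseteq> topspace (functionals Y)"
    unfolding integrals_def by (simp add: image_subset_iff)
  then have S: "integrals Y ` borel_probs Y = ?S"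
    using mean_functional_iff_integrals[OF Y] by auto
  have "\<forall>f. \<exists>c. f \<in> ?C \<longrightarrow> (\<forall>x\<in>topspace Y. \<bar>f x\<bar> \<le> c)"
    using compact_continuous_bounded[OF Y(1)] by (metis mem_Collect_eq)
  then obtain c where c: "\<And>f. f \<in> ?C \<Longrightarrow> \<forall>x\<in>topspace Y. \<bar>f x\<bar> \<le> c f" by metis
  have "compactin (functionals Y) (\<Pi>\<^sub>E f\<in>?C. {- c f..c f})"
    by (simp add: compactin_PiE)
  moreover have "?S \<subseteq> (\<Pi>\<^sub>E f\<in>?C. {- c f..c f})"
  proof
    fix \<phi> assume \<phi>: "\<phi> \<in> ?S"
    then interpret mean_functional Y \<phi> by simp
    \<comment> \<open>The edges of the box come from comparing \<open>f\<close> with the constants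
      \<open>- c f\<close> and \<open>c f\<close>, which a mean functional fixes.\<close>
    have "- c f \<le> \<phi> f \<and> \<phi> f \<le> c f" if f: "f \<in> ?C" for f
      using mono[of "\<lambda>x. - c f" f] mono[of f "\<lambda>x. c f"] const c[OF f] f by (auto simp: abs_le_iff minus_le_iff)
    then show "\<phi> \<in> (\<Pi>\<^sub>E f\<in>?C. {- c f..c f})" using \<phi> by (auto simp: PiE_def)
  qed
  ultimately have "compactin (functionals Y) ?S"
    using closedin_mean_functionals[OF Y] by (rule closed_compactin)
  then show ?thesis using S by (simp add: weak_star_eq compact_space_pullback)
qed

section \<open>Measures that act like point masses\<close>

text \<open>Borel measures that need not be regular are not determined by their integrals, so being a
  point mass is replaced by having the same integrals as one.\<close>

definition concentrated :: "'y topology \<Rightarrow> 'y measure \<Rightarrow> 'y \<Rightarrow> bool" where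
  "concentrated Y \<nu> y \<longleftrightarrow> y \<in> topspace Y \<and> (\<forall>f. continuous_map Y euclideanreal f \<longrightarrow> integral\<^sup>L \<nu> f = f y)"

lemma return_borel_probs: "y \<in> topspace Y \<Longrightarrow> return (borel_algebra Y) y \<in> borel_probs Y"
  by (simp add: borel_probs_def prob_space_return)

lemma concentrated_return: "y \<in> topspace Y \<Longrightarrow> concentrated Y (return (borel_algebra Y) y) y"
  by (simp add: concentrated_def integral_return continuous_real_measurable)

lemma integrals_eq_iff:
  "integrals Y \<nu> = integrals Y \<nu>' \<longleftrightarrow>
     (\<forall>f. continuous_map Y euclideanreal f \<longrightarrow> integral\<^sup>L \<nu> f = integral\<^sup>L \<nu>' f)"
  by (simp add: integrals_def restrict_def fun_eq_iff if_distrib[of "\<lambda>x. x = _"] cong: if_cong)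

lemma concentrated_iff_integrals:
  "y \<in> topspace Y \<Longrightarrow> concentrated Y \<nu> y \<longleftrightarrow> integrals Y \<nu> = integrals Y (return (borel_algebra Y) y)"
  using concentrated_return[of y Y] by (simp add: concentrated_def integrals_eq_iff)

text \<open>Weak* open sets cannot tell apart two measures with the same integrals, so a measure
  acting as evaluation at \<open>y\<close> may be exchanged for the point mass.\<close>

lemma weak_star_closure_concentrated:
  assumes "\<nu> \<in> weak_star Y closure_of S" "concentrated Y \<nu> y"
  shows "return (borel_algebra Y) y \<in> weak_star Y closure_of S"
proof -
  have y: "y \<in> topspace Y" using assms by (simp add: concentrated_def)
  have eq: "integrals Y \<nu> = integrals Y (return (borel_algebra Y) y)"
    using assms y by (simp add: concentrated_iff_integrals)
  have "\<nu> \<in> borel_probs Y" using assms(1) closure_of_subset_topspace[of "weak_star Y" S] by auto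
  then have "return (borel_algebra Y) y \<in> U \<longleftrightarrow> \<nu> \<in> U" if U: "openin (weak_star Y) U" for U
  proof -
    obtain V where "U = integrals Y -` V \<inter> borel_probs Y"
      using U by (auto simp: weak_star_eq openin_pullback_topology)
    then show ?thesis using eq return_borel_probs[OF y] \<open>\<nu> \<in> borel_probs Y\<close> by simp
  qed
  then show ?thesis using assms(1) return_borel_probs[OF y] unfolding in_closure_of by auto
qed

text \<open>The evaluations \<delta> form a continuous image of the compact space \<open>Y\<close>
  in the Hausdorff space of functionals, hence a closed set, whose preimage this is.\<close>

lemma closedin_concentrated:
  assumes Y: "compact_space Y"
  shows "closedin (weak_star Y) {\<nu> \<in> borel_probs Y. \<exists>y. concentrated Y \<nu> y}"
proof -
  let ?C = "{f. continuous_map Y euclideanreal f}"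
  define \<delta> where "\<delta> y = (\<lambda>f\<in>?C. f y)" for y
  have "continuous_map Y (functionals Y) \<delta>"
    by (auto simp: \<delta>_def continuous_map_componentwise)
  then have "compactin (functionals Y) (\<delta> ` topspace Y)"
    using Y by (intro image_compactin) (auto simp: compact_space_def)
  then have "closedin (functionals Y) (\<delta> ` topspace Y)"
    using Hausdorff_functionals compactin_imp_closedin by blast
  then have "closedin (weak_star Y) {\<nu> \<in> topspace (weak_star Y). integrals Y \<nu> \<in> \<delta> ` topspace Y}"
    by (rule closedin_continuous_map_preimage[OF continuous_integrals])
  moreover have "integrals Y \<nu> \<in> \<delta> ` topspace Y \<longleftrightarrow> (\<exists>y. concentrated Y \<nu> y)" for \<nu>
    by (auto simp: \<delta>_def integrals_def concentrated_def fun_eq_iff image_iff)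
  ultimately show ?thesis by simp
qed

lemma closedin_concentrated_distr:
  assumes Y: "compact_space Y" and q: "continuous_map Z Y q"
  shows "closedin (weak_star Z) {\<nu> \<in> borel_probs Z. \<exists>y. concentrated Y (distr \<nu> (borel_algebra Y) q) y}"
proof -
  let ?d = "\<lambda>\<nu>. distr \<nu> (borel_algebra Y) q"
  have "{\<nu> \<in> topspace (weak_star Z). ?d \<nu> \<in> {\<nu> \<in> borel_probs Y. \<exists>y. concentrated Y \<nu> y}} =
      {\<nu> \<in> borel_probs Z. \<exists>y. concentrated Y (?d \<nu>) y}"
    using borel_probs_distr[OF q] by auto
  then show ?thesis
    using closedin_continuous_map_preimage[OF continuous_map_distr_weak_star[OF q] closedin_concentrated[OF Y]]
    by simp
qed

lemma continuous_map_integral_weak_star: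
  assumes "continuous_map Y euclideanreal f"
  shows "continuous_map (weak_star Y) euclideanreal (\<lambda>\<nu>. integral\<^sup>L \<nu> f)"
proof -
  have "continuous_map (weak_star Y) euclideanreal ((\<lambda>\<phi>. \<phi> f) \<circ> integrals Y)"
    by (rule continuous_map_compose[OF continuous_integrals continuous_map_eval_functionals[OF assms]])
  then show ?thesis using assms by (simp add: integrals_def o_def)
qed

lemma concentrated_distr:
  assumes "\<nu> \<in> borel_probs Y" "concentrated Y \<nu> y" "continuous_map Y Z f"
  shows "concentrated Z (distr \<nu> (borel_algebra Z) f) (f y)"
  unfolding concentrated_def
proof (intro conjI allI impI)
  show "f y \<in> topspace Z" using assms by (auto simp: concentrated_def continuous_map_def)
  fix g assume g: "continuous_map Z euclideanreal g"
  then have "continuous_map Y euclideanreal (\<lambda>y. g (f y))"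
    using continuous_map_compose[OF assms(3) g] by (simp add: o_def)
  then show "integral\<^sup>L (distr \<nu> (borel_algebra Z) f) g = g (f y)"
    using assms integral_distr_continuous[OF assms(1,3) g] by (simp add: concentrated_def)
qed

text \<open>The closure of \<open>S\<close> is compact, so its image in \<open>functionals Y\<close>
  is compact and, that space being Hausdorff, closed; it therefore contains the limit functional.
  Inside \<open>weak_star Y\<close> itself compact sets could fail to be closed.\<close>

lemma lift_concentrated:
  assumes Z: "compact_space Z" "Hausdorff_space Z" and q: "continuous_map Z Y q" and y: "y \<in> topspace Y"
    and cl: "return (borel_algebra Y) y \<in> weak_star Y closure_of ((\<lambda>\<nu>. distr \<nu> (borel_algebra Y) q) ` S)"
    and S: "S \<subseteq> borel_probs Z"
  obtains \<phi> where "\<phi> \<in> weak_star Z closure_of S" "concentrated Y (distr \<phi> (borel_algebra Y) q) y"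
proof -
  let ?d = "\<lambda>\<nu>. distr \<nu> (borel_algebra Y) q" and ?K = "weak_star Z closure_of S"
  have m: "continuous_map (weak_star Z) (functionals Y) (integrals Y \<circ> ?d)"
    using continuous_map_compose[OF continuous_map_distr_weak_star[OF q] continuous_integrals] .
  have "compactin (weak_star Z) ?K"
    by (rule closedin_compact_space[OF compact_space_weak_star[OF Z] closedin_closure_of])
  then have closed: "closedin (functionals Y) ((integrals Y \<circ> ?d) ` ?K)"
    by (rule compactin_imp_closedin[OF Hausdorff_functionals image_compactin[OF _ m]])
  have "integrals Y (return (borel_algebra Y) y) \<in> functionals Y closure_of (integrals Y ` ?d ` S)"
    by (rule subsetD[OF continuous_map_image_closure_subset[OF continuous_integrals] imageI[OF cl]])
  moreover have "integrals Y ` ?d ` S \<subseteq> (integrals Y \<circ> ?d) ` ?K"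
    using closure_of_subset[of S "weak_star Z"] S by (auto simp: image_comp)
  then have "functionals Y closure_of (integrals Y ` ?d ` S) \<subseteq> (integrals Y \<circ> ?d) ` ?K"
    using closed by (rule closure_of_minimal)
  ultimately obtain \<phi> where "\<phi> \<in> ?K" "integrals Y (?d \<phi>) = integrals Y (return (borel_algebra Y) y)"
    by auto
  then show ?thesis using that y by (simp add: concentrated_iff_integrals)
qed

text \<open>Without regularity an uncountable union of null open sets may have positive measure. A
  closed set is compact, so finitely many null open sets already cover it.\<close>

lemma emeasure_eq_0_disjoint_support:
  assumes Y: "compact_space Y" and \<nu>: "\<nu> \<in> borel_probs Y"
    and A: "closedin Y A" "A \<inter> measure_support Y \<nu> = {}"
  shows "emeasure \<nu> A = 0"
proof -
  note s = borel_probs_open_sets[OF \<nu>]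
  let ?\<U> = "{U. openin Y U \<and> emeasure \<nu> U = 0}"
  have "A \<subseteq> \<Union>?\<U>"
  proof
    fix x assume "x \<in> A"
    then have "x \<in> topspace Y" "x \<notin> measure_support Y \<nu>"
      using closedin_subset[OF A(1)] A(2) by auto
    then obtain U where "openin Y U" "x \<in> U" "\<not> 0 < emeasure \<nu> U"
      unfolding measure_support_def by blast
    then show "x \<in> \<Union>?\<U>" by (auto simp: not_gr_zero)
  qed
  then have "\<exists>\<F>. finite \<F> \<and> \<F> \<subseteq> ?\<U> \<and> A \<subseteq> \<Union>\<F>"
    by (rule compactinD[OF closedin_compact_space[OF Y A(1)], rotated]) simp
  then obtain \<F> where \<F>: "finite \<F>" "\<F> \<subseteq> ?\<U>" "A \<subseteq> \<Union>\<F>" by blast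
  have "\<Union>\<F> \<in> null_sets \<nu>"
    using \<F> s by (intro null_sets.finite_Union) auto
  moreover have "\<Union>\<F> \<in> sets \<nu>" using \<F> s by (intro sets.finite_Union) auto
  ultimately show ?thesis using \<F> emeasure_mono[of A "\<Union>\<F>" \<nu>] by (auto simp: null_sets_def)
qed

lemma measure_support_nonempty:
  assumes "compact_space Y" "\<nu> \<in> borel_probs Y"
  shows "measure_support Y \<nu> \<noteq> {}"
proof
  assume "measure_support Y \<nu> = {}"
  then have "emeasure \<nu> (topspace Y) = 0"
    using emeasure_eq_0_disjoint_support[OF assms closedin_topspace] by simp
  moreover have "emeasure \<nu> (topspace Y) = 1"
    using assms prob_space.emeasure_space_1[of \<nu>] borel_probs_space[of \<nu> Y] by (simp add: borel_probs_def)
  ultimately show False by simp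
qed

text \<open>The complement of the fibre is open and may have positive measure. For one continuous
  \<open>f\<close>, however, the points with \<open>f (p y) \<noteq> f x\<close> form a countable
  union of closed sets missing the support, so \<open>f (p y)\<close> is almost surely
  constant.\<close>

lemma concentrated_of_support:
  assumes Y: "compact_space Y" and \<nu>: "\<nu> \<in> borel_probs Y" and p: "continuous_map Y X p"
    and supp: "measure_support Y \<nu> \<subseteq> {y \<in> topspace Y. p y = x}" and x: "x \<in> topspace X"
  shows "concentrated X (distr \<nu> (borel_algebra X) p) x"
  unfolding concentrated_def
proof (intro conjI allI impI x)
  fix f assume f: "continuous_map X euclideanreal f"
  interpret prob_space \<nu> using \<nu> by (simp add: borel_probs_def)
  have fp: "continuous_map Y euclideanreal (\<lambda>y. f (p y))"
    using continuous_map_compose[OF p f] by (simp add: o_def)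
  define A where "A n = {y \<in> topspace Y. 1 / real (Suc n) \<le> \<bar>f (p y) - f x\<bar>}" for n
  have cA: "closedin Y (A n)" for n
  proof -
    have "continuous_map Y euclideanreal (\<lambda>y. \<bar>f (p y) - f x\<bar>)"
      using fp by (intro continuous_map_real_abs continuous_map_diff) auto
    from closedin_continuous_map_preimage[OF this, of "{1 / real (Suc n)..}"]
    show ?thesis by (simp add: A_def)
  qed
  have "emeasure \<nu> (A n) = 0" for n
    using supp by (intro emeasure_eq_0_disjoint_support[OF Y \<nu> cA]) (auto simp: A_def)
  moreover have "A n \<in> sets \<nu>" for n
  proof -
    have "topspace Y - A n \<in> sets \<nu>"
      using cA[of n] by (intro borel_probs_open_sets[OF \<nu>]) blast
    then have "space \<nu> - (topspace Y - A n) \<in> sets \<nu>" by (rule sets.compl_sets)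
    moreover have "space \<nu> - (topspace Y - A n) = A n"
      using borel_probs_space[OF \<nu>] by (auto simp: A_def)
    ultimately show ?thesis by simp
  qed
  ultimately have "(\<Union>n. A n) \<in> null_sets \<nu>" by (intro null_sets_UN) auto
  moreover have "{y \<in> space \<nu>. f (p y) \<noteq> f x} \<subseteq> (\<Union>n. A n)"
  proof
    fix y assume y: "y \<in> {y \<in> space \<nu>. f (p y) \<noteq> f x}"
    then have "0 < \<bar>f (p y) - f x\<bar>" by simp
    then obtain n where "1 / real (Suc n) < \<bar>f (p y) - f x\<bar>" by (rule nat_approx_posE)
    then show "y \<in> (\<Union>n. A n)" using y borel_probs_space[OF \<nu>] by (auto simp: A_def intro!: less_imp_le)
  qed
  ultimately have "AE y in \<nu>. f (p y) = f x" by (rule AE_I')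
  then have "integral\<^sup>L \<nu> (\<lambda>y. f (p y)) = integral\<^sup>L \<nu> (\<lambda>y. f x)"
    using borel_probs_integrable[OF Y \<nu> fp] by (intro integral_cong_AE) auto
  then show "integral\<^sup>L (distr \<nu> (borel_algebra X) p) f = f x"
    using integral_distr_continuous[OF \<nu> p f] prob_space by simp
qed

text \<open>A Urysohn function vanishing at \<open>x\<close> and equal to 1 at \<open>q z\<close>
  exceeds 1/2 on a neighbourhood of positive measure, so its integral cannot be the value 0 at
  \<open>x\<close>.\<close>

lemma support_of_concentrated:
  assumes Y: "compact_space Y" and \<nu>: "\<nu> \<in> borel_probs Y" and q: "continuous_map Y X q"
    and X: "compact_space X" "Hausdorff_space X"
    and conc: "concentrated X (distr \<nu> (borel_algebra X) q) x" and z: "z \<in> measure_support Y \<nu>"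
  shows "q z = x"
proof (rule ccontr)
  assume ne: "q z \<noteq> x"
  interpret prob_space \<nu> using \<nu> by (simp add: borel_probs_def)
  have zY: "z \<in> topspace Y" using z by (simp add: measure_support_def)
  then have "q z \<in> topspace X" "x \<in> topspace X"
    using q conc by (auto simp: continuous_map_def concentrated_def)
  then have c: "closedin X {x}" "closedin X {q z}" "disjnt {x} {q z}"
    using X ne closedin_Hausdorff_sing_eq[of X] by auto
  obtain f where f: "continuous_map X euclideanreal f" "\<forall>u\<in>topspace X. 0 \<le> f u \<and> f u \<le> 1"
    "\<forall>u\<in>{x}. f u = 0" "\<forall>u\<in>{q z}. f u = 1"
    by (rule compact_Hausdorff_urysohn[OF X c])
  have fq: "continuous_map Y euclideanreal (\<lambda>y. f (q y))"
    using continuous_map_compose[OF q f(1)] by (simp add: o_def)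
  define U where "U = {y \<in> topspace Y. f (q y) \<in> {1/2<..}}"
  have U: "openin Y U"
    unfolding U_def by (rule openin_continuous_map_preimage[OF fq]) simp
  have "z \<in> U" unfolding U_def using f zY by simp
  then have "0 < emeasure \<nu> U" using z U unfolding measure_support_def by blast
  then have "0 < measure \<nu> U" by (simp add: emeasure_eq_measure)
  have sU: "U \<in> sets \<nu>" by (rule borel_probs_open_sets[OF \<nu> U])
  note \<open>0 < measure \<nu> U\<close>
  moreover have "integral\<^sup>L \<nu> (\<lambda>y. indicator U y / 2) \<le> integral\<^sup>L \<nu> (\<lambda>y. f (q y))"
  proof (rule integral_mono)
    show "integrable \<nu> (\<lambda>y. indicator U y / 2 :: real)" using sU by (simp add: emeasure_eq_measure)
    fix y assume "y \<in> space \<nu>"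
    then have "q y \<in> topspace X" using q borel_probs_space[OF \<nu>] by (auto simp: continuous_map_def)
    then show "indicator U y / 2 \<le> f (q y)" using f by (auto simp: U_def indicator_def)
  qed (rule borel_probs_integrable[OF Y \<nu> fq])
  moreover have "integral\<^sup>L \<nu> (\<lambda>y. indicator U y / 2) = measure \<nu> U / 2"
    using sU by simp
  moreover have "integral\<^sup>L \<nu> (\<lambda>y. f (q y)) = 0"
    using conc f integral_distr_continuous[OF \<nu> q f(1)] by (simp add: concentrated_def)
  ultimately show False by simp
qed

section \<open>Minimal spaces\<close>

lemma G_space_action:
  assumes "G_space G X a"
  shows "\<And>g x. g \<in> carrier G \<Longrightarrow> x \<in> topspace X \<Longrightarrow> a g x \<in> topspace X"
    and "\<And>g h x. g \<in> carrier G \<Longrightarrow> h \<in> carrier G \<Longrightarrow> x \<in> topspace X \<Longrightarrow> a (g \<otimes>\<^bsub>G\<^esub> h) x = a g (a h x)"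
    and "\<And>x. x \<in> topspace X \<Longrightarrow> a \<one>\<^bsub>G\<^esub> x = x"
    and "\<And>g. g \<in> carrier G \<Longrightarrow> continuous_map X X (a g)"
proof -
  interpret group_action G "topspace X" a using assms by (simp add: G_space_def)
  show "\<And>g x. g \<in> carrier G \<Longrightarrow> x \<in> topspace X \<Longrightarrow> a g x \<in> topspace X"
    by (rule element_image) auto
  show "\<And>g h x. g \<in> carrier G \<Longrightarrow> h \<in> carrier G \<Longrightarrow> x \<in> topspace X \<Longrightarrow> a (g \<otimes>\<^bsub>G\<^esub> h) x = a g (a h x)"
    by (rule composition_rule)
  show "\<And>x. x \<in> topspace X \<Longrightarrow> a \<one>\<^bsub>G\<^esub> x = x"
    using id_eq_one by (metis restrict_apply')
  show "\<And>g. g \<in> carrier G \<Longrightarrow> continuous_map X X (a g)" using assms by (simp add: G_space_def)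
qed

lemma group_actionI:
  fixes G (structure)
  assumes "group G"
    and closed: "\<And>g x. g \<in> carrier G \<Longrightarrow> x \<in> E \<Longrightarrow> \<phi> g x \<in> E"
    and ext: "\<And>g. g \<in> carrier G \<Longrightarrow> \<phi> g \<in> extensional E"
    and mult: "\<And>g h x. g \<in> carrier G \<Longrightarrow> h \<in> carrier G \<Longrightarrow> x \<in> E \<Longrightarrow> \<phi> (g \<otimes> h) x = \<phi> g (\<phi> h x)"
    and one: "\<And>x. x \<in> E \<Longrightarrow> \<phi> \<one> x = x"
  shows "group_action G E \<phi>"
proof -
  interpret group G by fact
  have "\<phi> g \<in> Bij E" if g: "g \<in> carrier G" for g
  proof -
    have "\<phi> (inv g) (\<phi> g x) = x" "\<phi> g (\<phi> (inv g) x) = x" if "x \<in> E" for x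
      using g that mult[of "inv g" g x] mult[of g "inv g" x] one by auto
    then have "bij_betw (\<phi> g) E E"
      using closed g by (intro bij_betw_byWitness[where f' = "\<phi> (inv g)"]) auto
    then show ?thesis using ext g by (simp add: Bij_def)
  qed
  moreover have "\<phi> (g \<otimes> h) = compose E (\<phi> g) (\<phi> h)" if "g \<in> carrier G" "h \<in> carrier G" for g h
    by (rule extensionalityI[of _ E]) (use ext mult that in \<open>auto simp: compose_def\<close>)
  ultimately show ?thesis
    unfolding group_action_def group_hom_def group_hom_axioms_def
    using group_BijGroup is_group by (auto simp: hom_def BijGroup_def restrict_def)
qed

lemma minimal_G_space_closed_invariant:
  assumes "minimal_G_space G X a" "closedin X E" "E \<noteq> {}"
    and "\<And>g x. g \<in> carrier G \<Longrightarrow> x \<in> E \<Longrightarrow> a g x \<in> E"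
  shows "E = topspace X"
proof -
  obtain x where x: "x \<in> E" using assms by blast
  then have "orbit G a x \<subseteq> E" using assms(4) by (auto simp: orbit_def)
  then have "X closure_of orbit G a x \<subseteq> E" using assms(2) by (rule closure_of_minimal)
  moreover have "x \<in> topspace X" using x assms(2) closedin_subset by blast
  ultimately show ?thesis using assms(1,2) closedin_subset by (fastforce simp: minimal_G_space_def)
qed

lemma minimal_G_spaceI:
  assumes X: "G_space G X a"
    and min: "\<And>E. closedin X E \<Longrightarrow> E \<noteq> {} \<Longrightarrow> (\<And>g x. g \<in> carrier G \<Longrightarrow> x \<in> E \<Longrightarrow> a g x \<in> E) \<Longrightarrow> E = topspace X"
  shows "minimal_G_space G X a"
  unfolding minimal_G_space_def
proof (intro conjI ballI X)
  fix x assume x: "x \<in> topspace X"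
  note act = G_space_action[OF X]
  interpret group_action G "topspace X" a using X by (simp add: G_space_def)
  have G: "group G" using group_hom group_hom.axioms(1) by blast
  let ?E = "X closure_of orbit G a x"
  have "a \<one>\<^bsub>G\<^esub> x \<in> orbit G a x" using G by (auto simp: orbit_def intro: group.is_monoid monoid.one_closed)
  then have "x \<in> ?E" using act(3)[OF x] x by (auto simp: in_closure_of)
  moreover have "a g y \<in> ?E" if g: "g \<in> carrier G" and y: "y \<in> ?E" for g y
  proof -
    have "a g ` orbit G a x \<subseteq> orbit G a x"
    proof
      fix z assume "z \<in> a g ` orbit G a x"
      then obtain h where h: "h \<in> carrier G" "z = a g (a h x)" by (auto simp: orbit_def)
      then have "z = a (g \<otimes>\<^bsub>G\<^esub> h) x" using act(2)[OF g] x by simp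
      moreover have "g \<otimes>\<^bsub>G\<^esub> h \<in> carrier G" using G g h by (simp add: group.is_monoid monoid.m_closed)
      ultimately show "z \<in> orbit G a x" by (auto simp: orbit_def)
    qed
    then have "a g ` ?E \<subseteq> ?E"
      using continuous_map_image_closure_subset[OF act(4)[OF g], of "orbit G a x"] closure_of_mono by blast
    then show ?thesis using y by blast
  qed
  ultimately show "?E = topspace X" by (intro min) auto
qed

text \<open>Zorn's lemma for closed invariant nonempty sets under reverse inclusion; compactness
  keeps the intersection of a chain nonempty.\<close>

lemma closed_invariant_minimal:
  assumes Y: "compact_space Y" "topspace Y \<noteq> {}"
    and D: "\<And>g y. g \<in> D \<Longrightarrow> y \<in> topspace Y \<Longrightarrow> g y \<in> topspace Y"
  obtains M where "closedin Y M" "M \<noteq> {}" "\<forall>g\<in>D. \<forall>y\<in>M. g y \<in> M"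
    "\<forall>E. closedin Y E \<and> E \<noteq> {} \<and> E \<subseteq> M \<and> (\<forall>g\<in>D. \<forall>y\<in>E. g y \<in> E) \<longrightarrow> E = M"
proof -
  let ?A = "{M. closedin Y M \<and> M \<noteq> {} \<and> (\<forall>g\<in>D. \<forall>y\<in>M. g y \<in> M)}"
  have "\<exists>m\<in>?A. \<forall>a\<in>?A. m \<supseteq> a \<longrightarrow> a = m"
  proof (rule predicate_Zorn)
    show "partial_order_on ?A (relation_of (\<supseteq>) ?A)"
      by (rule partial_order_on_relation_ofI) auto
    fix C assume C: "C \<in> Chains (relation_of (\<supseteq>) ?A)"
    then have CA: "C \<subseteq> ?A" by (rule Chains_relation_of)
    have chain: "U \<subseteq> V \<or> V \<subseteq> U" if "U \<in> C" "V \<in> C" for U V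
    proof -
      have "(U, V) \<in> relation_of (\<supseteq>) ?A \<or> (V, U) \<in> relation_of (\<supseteq>) ?A"
        using C that unfolding Chains_def by blast
      then show ?thesis unfolding relation_of_def by blast
    qed
    \<comment> \<open>A finite nonempty subfamily of a chain contains its own intersection, which
      gives the finite intersection property.\<close>
    have fin: "\<F> \<noteq> {} \<Longrightarrow> \<Inter>\<F> \<in> \<F>" if "finite \<F>" "\<F> \<subseteq> C" for \<F>
      using that
    proof (induction \<F> rule: finite_induct)
      case (insert U \<F>)
      show ?case
      proof (cases "\<F> = {}")
        case False
        then have "\<Inter>\<F> \<in> \<F>" using insert by auto
        then have "U \<subseteq> \<Inter>\<F> \<or> \<Inter>\<F> \<subseteq> U" using insert by (intro chain) auto
        then have "\<Inter>(insert U \<F>) = U \<or> \<Inter>(insert U \<F>) = \<Inter>\<F>"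
          by (metis Inter_insert inf.absorb1 inf.absorb2)
        then show ?thesis using \<open>\<Inter>\<F> \<in> \<F>\<close> by auto
      qed simp
    qed simp
    show "\<exists>u\<in>?A. \<forall>a\<in>C. a \<supseteq> u"
    proof (cases "C = {}")
      case True
      then show ?thesis using Y D by (intro bexI[of _ "topspace Y"]) auto
    next
      case False
      have "\<Inter>\<F> \<noteq> {}" if "finite \<F>" "\<F> \<subseteq> C" for \<F>
        using fin[OF that] CA that by (cases "\<F> = {}") auto
      moreover have "\<forall>M\<in>C. closedin Y M" using CA by blast
      ultimately have "\<Inter>C \<noteq> {}" using spec[OF Y(1)[unfolded compact_space_fip], of C] by blast
      moreover have "closedin Y (\<Inter>C)" using CA False by (intro closedin_Inter) auto
      moreover have "\<forall>g\<in>D. \<forall>y\<in>\<Inter>C. g y \<in> \<Inter>C" using CA by blast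
      ultimately show ?thesis by (intro bexI[of _ "\<Inter>C"]) auto
    qed
  qed
  then obtain M where M: "M \<in> ?A" "\<forall>E\<in>?A. M \<supseteq> E \<longrightarrow> E = M" by blast
  show ?thesis
  proof (rule that)
    show "\<forall>E. closedin Y E \<and> E \<noteq> {} \<and> E \<subseteq> M \<and> (\<forall>g\<in>D. \<forall>y\<in>E. g y \<in> E) \<longrightarrow> E = M"
      using M(2) by simp
  qed (use M(1) in simp_all)
qed

section \<open>Boundaries of commensurated subgroups\<close>

text \<open>The universal property of \<open>B\<close> is left out on purpose: it enters at a single
  point, where \<open>B\<close> is mapped into the coinduced space.\<close>

locale commensurated_boundary =
  fixes \<Gamma> :: "('g, 'm) monoid_scheme" (structure) and H :: "'g set"
    and X :: "'x topology" and a :: "'g \<Rightarrow> 'x \<Rightarrow> 'x"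
    and B :: "'b topology" and c :: "'g \<Rightarrow> 'b \<Rightarrow> 'b" and \<pi> :: "'b \<Rightarrow> 'x"
  assumes group: "group \<Gamma>" and commensurated: "commensurated \<Gamma> H"
    and X: "G_space \<Gamma> X a"
    and boundary: "is_boundary (\<Gamma>\<lparr>carrier := H\<rparr>) X a B c \<pi>"
begin

sublocale group \<Gamma> by (rule group)

lemma subgroup: "subgroup H \<Gamma>"
  using commensurated by (simp add: commensurated_def)

lemma H_group: "group (\<Gamma>\<lparr>carrier := H\<rparr>)"
  using subgroup_imp_group[OF subgroup] .

lemmas H_closed [simp] = subgroup.m_closed[OF subgroup] subgroup.m_inv_closed[OF subgroup]
  subgroup.one_closed[OF subgroup]

lemma H_carrier [simp]: "h \<in> H \<Longrightarrow> h \<in> carrier \<Gamma>"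
  using subgroup.subset[OF subgroup] by blast

lemmas a_action = G_space_action[OF X]

lemma sp: "strongly_proximal_extension (\<Gamma>\<lparr>carrier := H\<rparr>) B c X a \<pi>"
  and B_minimal: "minimal_G_space (\<Gamma>\<lparr>carrier := H\<rparr>) B c"
  using boundary by (auto simp: is_boundary_def)

lemma fm: "factor_map (\<Gamma>\<lparr>carrier := H\<rparr>) B c X a \<pi>"
  using sp by (simp add: strongly_proximal_extension_def)

lemma B: "G_space (\<Gamma>\<lparr>carrier := H\<rparr>) B c" and X_H: "G_space (\<Gamma>\<lparr>carrier := H\<rparr>) X a"
  and \<pi>_cont: "continuous_map B X \<pi>" and \<pi>_surj: "\<pi> ` topspace B = topspace X"
  and \<pi>_equiv: "h \<in> H \<Longrightarrow> y \<in> topspace B \<Longrightarrow> \<pi> (c h y) = a h (\<pi> y)"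
  using fm by (auto simp: factor_map_def)

lemmas c_action = G_space_action[OF B, simplified]

lemma compact_B: "compact_space B" and Hausdorff_B: "Hausdorff_space B"
  and compact_X: "compact_space X" and Hausdorff_X: "Hausdorff_space X"
  using B X by (auto simp: G_space_def)

lemma \<pi>_in: "y \<in> topspace B \<Longrightarrow> \<pi> y \<in> topspace X"
  using \<pi>_surj by blast

section \<open>Finite index subgroups respecting finitely many conjugations\<close>

definition small :: "'g set \<Rightarrow> 'g set" where
  "small F = {h \<in> H. \<forall>g\<in>F. g \<otimes> h \<otimes> inv g \<in> H}"

lemma small_subset: "small F \<subseteq> H"
  by (auto simp: small_def)

lemma small_antimono: "F \<subseteq> F' \<Longrightarrow> small F' \<subseteq> small F"
  by (auto simp: small_def)

lemma inv_cancel [simp]: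
  assumes "x \<in> carrier \<Gamma>" "y \<in> carrier \<Gamma>"
  shows "inv x \<otimes> (x \<otimes> y) = y" "x \<otimes> (inv x \<otimes> y) = y"
  using assms by (simp_all add: m_assoc[symmetric])

lemma conj_inv:
  assumes "g \<in> carrier \<Gamma>" "h \<in> carrier \<Gamma>"
  shows "g \<otimes> inv h \<otimes> inv g = inv (g \<otimes> h \<otimes> inv g)"
  using assms by (simp add: inv_mult_group m_assoc)

lemma small_inv: "F \<subseteq> carrier \<Gamma> \<Longrightarrow> h \<in> small F \<Longrightarrow> inv h \<in> small F"
  by (auto simp: small_def conj_inv subset_iff)

lemma small_singleton:
  assumes g: "g \<in> carrier \<Gamma>"
  shows "small {g} = H \<inter> (inv g <# H #> g)"
proof -
  have "g \<otimes> h \<otimes> inv g \<in> H \<longleftrightarrow> (\<exists>k\<in>H. h = inv g \<otimes> k \<otimes> g)" if "h \<in> H" for h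
  proof
    assume "g \<otimes> h \<otimes> inv g \<in> H"
    moreover have "h = inv g \<otimes> (g \<otimes> h \<otimes> inv g) \<otimes> g"
      using g that by (simp add: m_assoc)
    ultimately show "\<exists>k\<in>H. h = inv g \<otimes> k \<otimes> g" by blast
  next
    assume "\<exists>k\<in>H. h = inv g \<otimes> k \<otimes> g"
    then obtain k where k: "k \<in> H" "h = inv g \<otimes> k \<otimes> g" by blast
    then have "g \<otimes> h \<otimes> inv g = k" using g by (simp add: m_assoc)
    then show "g \<otimes> h \<otimes> inv g \<in> H" using k by simp
  qed
  then show ?thesis by (auto simp: small_def l_coset_def r_coset_def)
qed

text \<open>An intersection of finitely many finite index subgroups: \<open>h\<close> is classified
  by its tuple of cosets, there are finitely many tuples, and \<open>R\<close> contains one element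
  for each.\<close>

lemma small_finite_index:
  assumes F: "finite F" "F \<subseteq> carrier \<Gamma>"
  obtains R where "finite R" "R \<subseteq> H" "\<forall>h\<in>H. \<exists>r\<in>R. \<exists>k\<in>small F. h = r \<otimes> k"
proof -
  define Q where "Q g = small {g}" for g
  \<comment> \<open>Commensuration counts right cosets; the inverse turns them into left cosets, as
    required for \<open>h = r \<otimes> k\<close>.\<close>
  define f where "f h = (\<lambda>g\<in>F. Q g #> inv h)" for h
  have "finite ((\<lambda>h. Q g #> h) ` H)" if "g \<in> F" for g
  proof -
    have g: "g \<in> carrier \<Gamma>" using that F by blast
    have "finite (rcosets\<^bsub>\<Gamma>\<lparr>carrier := H\<rparr>\<^esub> (H \<inter> (inv g <# H #> inv (inv g))))"
      using commensurated inv_closed[OF g] unfolding commensurated_def by blast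
    then have "finite (rcosets\<^bsub>\<Gamma>\<lparr>carrier := H\<rparr>\<^esub> Q g)"
      using g small_singleton[OF g] by (simp add: Q_def)
    moreover have "rcosets\<^bsub>\<Gamma>\<lparr>carrier := H\<rparr>\<^esub> Q g = (\<lambda>h. Q g #> h) ` H"
      by (auto simp: RCOSETS_def r_coset_def)
    ultimately show ?thesis by simp
  qed
  then have "finite (\<Pi>\<^sub>E g\<in>F. (\<lambda>h. Q g #> h) ` H)" using F by (intro finite_PiE)
  moreover have "f ` H \<subseteq> (\<Pi>\<^sub>E g\<in>F. (\<lambda>h. Q g #> h) ` H)" by (auto simp: f_def)
  ultimately have "finite (f ` H)" by (rule finite_subset[rotated])
  then obtain R where R: "R \<subseteq> H" "finite R" "f ` H = f ` R"
    using finite_subset_image[of "f ` H" f H] by auto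
  have "\<exists>r\<in>R. \<exists>k\<in>small F. h = r \<otimes> k" if h: "h \<in> H" for h
  proof -
    obtain r where r: "r \<in> R" "f h = f r" using R(3) h by blast
    then have rH: "r \<in> H" using R by blast
    have "inv r \<otimes> h \<in> small {g}" if g: "g \<in> F" for g
    proof -
      have gc: "g \<in> carrier \<Gamma>" using g F by blast
      have "\<one> \<in> Q g" using gc by (simp add: Q_def small_def)
      then have "inv h \<in> Q g #> inv h" using h by (force simp: r_coset_def)
      also have "Q g #> inv h = Q g #> inv r"
        using fun_cong[OF r(2), of g] g by (simp add: f_def)
      finally obtain k where k: "k \<in> small {g}" "inv h = k \<otimes> inv r"
        by (auto simp: r_coset_def Q_def)
      have kc: "k \<in> carrier \<Gamma>" using k small_subset[of "{g}"] H_carrier by blast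
      have "inv k = inv r \<otimes> h"
      proof -
        have "k = inv h \<otimes> r" using k h rH kc by (simp add: m_assoc)
        then show ?thesis using h rH by (simp add: inv_mult_group)
      qed
      moreover have "inv k \<in> small {g}" using small_inv[of "{g}" k] k gc by simp
      ultimately show ?thesis by simp
    qed
    then have "inv r \<otimes> h \<in> small F" using h rH by (auto simp: small_def)
    moreover have "h = r \<otimes> (inv r \<otimes> h)" using h rH by (simp add: m_assoc[symmetric])
    ultimately show ?thesis using r by blast
  qed
  then have "\<forall>h\<in>H. \<exists>r\<in>R. \<exists>k\<in>small F. h = r \<otimes> k" by blast
  then show ?thesis by (rule that[OF R(2,1)])
qed

text \<open>The twist by \<gamma> turns \<open>small F\<close> into its conjugate, which contains
  the group \<open>small\<close> of the enlarged set: conjugating \<open>k'\<close> by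
  \<open>inv \<gamma>\<close> has to land in \<open>H\<close>, and conjugating the result by
  \<delta> amounts to conjugating \<open>k'\<close> by
  \<open>\<delta> \<otimes> inv \<gamma>\<close>.\<close>

lemma small_conjugate:
  assumes \<gamma>: "\<gamma> \<in> F" and F: "F \<subseteq> carrier \<Gamma>"
    and k': "k' \<in> small (insert (inv \<gamma>) ((\<lambda>\<delta>. \<delta> \<otimes> inv \<gamma>) ` F))"
  obtains k where "k \<in> small F" "k' = \<gamma> \<otimes> k \<otimes> inv \<gamma>"
proof
  have \<gamma>c: "\<gamma> \<in> carrier \<Gamma>" using \<gamma> F by blast
  have k'H: "k' \<in> H" using k' small_subset by blast
  let ?k = "inv \<gamma> \<otimes> k' \<otimes> \<gamma>"
  show "k' = \<gamma> \<otimes> ?k \<otimes> inv \<gamma>" using \<gamma>c k'H by (simp add: m_assoc)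
  have "?k \<in> H" using k' \<gamma>c by (simp add: small_def)
  moreover have "\<delta> \<otimes> ?k \<otimes> inv \<delta> \<in> H" if \<delta>: "\<delta> \<in> F" for \<delta>
  proof -
    have \<delta>c: "\<delta> \<in> carrier \<Gamma>" using \<delta> F by blast
    have "(\<delta> \<otimes> inv \<gamma>) \<otimes> k' \<otimes> inv (\<delta> \<otimes> inv \<gamma>) \<in> H" using k' \<delta> by (auto simp: small_def)
    moreover have "(\<delta> \<otimes> inv \<gamma>) \<otimes> k' \<otimes> inv (\<delta> \<otimes> inv \<gamma>) = \<delta> \<otimes> ?k \<otimes> inv \<delta>"
      using \<gamma>c \<delta>c k'H by (simp add: m_assoc inv_mult_group)
    ultimately show ?thesis by simp
  qed
  ultimately show "?k \<in> small F" by (simp add: small_def)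
qed

section \<open>Strong proximality along finite index subgroups\<close>

abbreviation push :: "'b measure \<Rightarrow> 'g \<Rightarrow> 'b measure" where
  "push \<nu> h \<equiv> distr \<nu> (borel_algebra B) (c h)"

lemma push_mult:
  assumes "\<nu> \<in> borel_probs B" "h \<in> H" "k \<in> H"
  shows "push (push \<nu> k) h = push \<nu> (h \<otimes> k)"
proof -
  have "push (push \<nu> k) h = distr \<nu> (borel_algebra B) (\<lambda>y. c h (c k y))"
    by (rule distr_distr_continuous[OF assms(1) c_action(4)[OF assms(3)] c_action(4)[OF assms(2)]])
  also have "\<dots> = push \<nu> (h \<otimes> k)"
    using assms c_action(2) borel_probs_space[OF assms(1)] by (intro distr_cong) auto
  finally show ?thesis .
qed

text \<open>The \<open>H\<close>-orbit of \<nu> is a finite union of translates of its orbit under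
  \<open>small F\<close>. Closure commutes with finite unions, so the limit point mass lies over one
  translate by \<open>r\<close>, and applying \<open>inv r\<close> brings it back.\<close>

lemma strongly_proximal_small:
  assumes F: "finite F" "F \<subseteq> carrier \<Gamma>" and \<nu>: "\<nu> \<in> borel_probs B" and x: "x \<in> topspace X"
    and supp: "measure_support B \<nu> \<subseteq> {y \<in> topspace B. \<pi> y = x}"
  obtains y where "y \<in> topspace B"
    "return (borel_algebra B) y \<in> weak_star B closure_of (push \<nu> ` small F)"
proof -
  obtain R where R: "finite R" "R \<subseteq> H" "\<forall>h\<in>H. \<exists>r\<in>R. \<exists>k\<in>small F. h = r \<otimes> k"
    by (rule small_finite_index[OF F])
  let ?S = "push \<nu> ` small F" and ?D = "\<lambda>r \<mu>. distr \<mu> (borel_algebra B) (c r)"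
  have S: "?S \<subseteq> borel_probs B"
    using \<nu> c_action(4) borel_probs_distr small_subset by blast
  obtain y where y: "y \<in> topspace B"
    "return (borel_algebra B) y \<in> weak_star B closure_of {push \<nu> h |h. h \<in> H}"
    using sp \<nu> x supp unfolding strongly_proximal_extension_def by auto
  have "{push \<nu> h |h. h \<in> H} \<subseteq> \<Union>((\<lambda>r. ?D r ` ?S) ` R)"
  proof
    fix \<mu> assume "\<mu> \<in> {push \<nu> h |h. h \<in> H}"
    then obtain h where h: "h \<in> H" "\<mu> = push \<nu> h" by blast
    then obtain r k where rk: "r \<in> R" "k \<in> small F" "h = r \<otimes> k" using R(3) by blast
    then have "k \<in> H" "r \<in> H" using R small_subset by blast+
    then have "\<mu> = ?D r (push \<nu> k)" using h rk push_mult[OF \<nu>, of r k] by simp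
    then have "\<mu> \<in> ?D r ` ?S" using rk(2) by blast
    then show "\<mu> \<in> \<Union>((\<lambda>r. ?D r ` ?S) ` R)" using rk(1) by (rule UN_I[rotated])
  qed
  then have "return (borel_algebra B) y \<in> weak_star B closure_of \<Union>((\<lambda>r. ?D r ` ?S) ` R)"
    by (rule subsetD[OF closure_of_mono y(2)])
  then obtain r where r: "r \<in> R" "return (borel_algebra B) y \<in> weak_star B closure_of (?D r ` ?S)"
    using R(1) by (auto simp: closure_of_Union)
  have rH: "r \<in> H" using r R by blast
  have "?D (inv r) (return (borel_algebra B) y) \<in> weak_star B closure_of (?D (inv r) ` ?D r ` ?S)"
    using continuous_map_image_closure_subset[OF continuous_map_distr_weak_star[OF c_action(4)[of "inv r"]], of "?D r ` ?S"] r rH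
    by auto
  moreover have "?D (inv r) (?D r \<mu>) = \<mu>" if \<mu>: "\<mu> \<in> ?S" for \<mu>
  proof -
    obtain k where k: "k \<in> small F" "\<mu> = push \<nu> k" using \<mu> by blast
    then have "k \<in> H" using small_subset by blast
    then show ?thesis using k rH \<nu> by (simp add: push_mult m_assoc[symmetric])
  qed
  then have "?D (inv r) ` ?D r ` ?S = ?S" by (simp add: image_image)
  moreover have "?D (inv r) (return (borel_algebra B) y) = return (borel_algebra B) (c (inv r) y)"
    using y rH c_action(4) by (intro distr_return) (auto intro: continuous_measurable_borel_algebra)
  ultimately show ?thesis using that[of "c (inv r) y"] c_action(1) y rH by simp
qed

text \<open>Strong proximality applied to half the sum of two point masses.\<close>

lemma pair_proximal:
  assumes F: "finite F" "F \<subseteq> carrier \<Gamma>" and y: "y1 \<in> topspace B" "y2 \<in> topspace B" "\<pi> y1 = \<pi> y2"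
  obtains w where "w \<in> topspace B"
    "\<forall>U. openin B U \<and> w \<in> U \<longrightarrow> (\<exists>k\<in>small F. c k y1 \<in> U \<and> c k y2 \<in> U)"
proof -
  define e where "e b = (if b then y1 else y2)" for b
  \<comment> \<open>A fair coin pushed forward along \<open>e\<close>, so that integrals against it
    are averages of two values.\<close>
  define \<nu> where "\<nu> = distr (measure_pmf (bernoulli_pmf (1/2))) (borel_algebra B) e"
  have me: "e \<in> measure_pmf (bernoulli_pmf (1/2)) \<rightarrow>\<^sub>M borel_algebra B"
    using y by (auto simp: e_def)
  have \<nu>: "\<nu> \<in> borel_probs B"
    unfolding \<nu>_def borel_probs_def
    using prob_space.prob_space_distr[OF measure_pmf.prob_space_axioms me] by simp
  have int: "integral\<^sup>L \<nu> f = (f y1 + f y2) / 2" if "continuous_map B euclideanreal f" for f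
    unfolding \<nu>_def using integral_distr[OF me continuous_real_measurable[OF that]]
    by (simp add: e_def field_simps)
  have "measure_support B \<nu> \<subseteq> {y1, y2}"
  proof
    fix z assume z: "z \<in> measure_support B \<nu>"
    show "z \<in> {y1, y2}"
    proof (rule ccontr)
      assume "z \<notin> {y1, y2}"
      define U where "U = topspace B - {y1, y2}"
      have "openin B U" "z \<in> U"
        using z \<open>z \<notin> {y1, y2}\<close> y Hausdorff_B closedin_Hausdorff_finite[of B "{y1, y2}"]
        by (auto simp: U_def measure_support_def closedin_def)
      then have "0 < emeasure \<nu> U" using z unfolding measure_support_def by blast
      moreover have "emeasure \<nu> U = emeasure (measure_pmf (bernoulli_pmf (1/2))) (e -` U \<inter> space (measure_pmf (bernoulli_pmf (1/2))))"
        unfolding \<nu>_def using me \<open>openin B U\<close> openin_sets_borel_algebra by (intro emeasure_distr) auto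
      moreover have "e -` U = {}" by (auto simp: e_def U_def)
      ultimately show False by simp
    qed
  qed
  then have "measure_support B \<nu> \<subseteq> {y \<in> topspace B. \<pi> y = \<pi> y1}" using y by auto
  then obtain w where w: "w \<in> topspace B"
    "return (borel_algebra B) w \<in> weak_star B closure_of (push \<nu> ` small F)"
    by (rule strongly_proximal_small[OF F \<nu> \<pi>_in[OF y(1)]])
  have "\<exists>k\<in>small F. c k y1 \<in> U \<and> c k y2 \<in> U" if U: "openin B U" "w \<in> U" for U
  proof -
    have "closedin B {w}" "closedin B (topspace B - U)" "disjnt {w} (topspace B - U)"
      using w U Hausdorff_B closedin_Hausdorff_sing_eq[of B w] by (auto simp: disjnt_def)
    then obtain f where f: "continuous_map B euclideanreal f" "\<forall>u\<in>topspace B. 0 \<le> f u \<and> f u \<le> 1"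
      "\<forall>u\<in>{w}. f u = 0" "\<forall>u\<in>topspace B - U. f u = 1"
      by (rule compact_Hausdorff_urysohn[OF compact_B Hausdorff_B])
    \<comment> \<open>Since \<open>f\<close> is nonnegative, an average below 1/2 forces both values
      below 1, whereas \<open>f\<close> equals 1 off \<open>U\<close>.\<close>
    define V where "V = {\<mu> \<in> topspace (weak_star B). integral\<^sup>L \<mu> f \<in> {..<1/2}}"
    have "openin (weak_star B) V"
      unfolding V_def
      by (rule openin_continuous_map_preimage[OF continuous_map_integral_weak_star[OF f(1)]]) simp
    moreover have "return (borel_algebra B) w \<in> V"
      using concentrated_return[OF w(1)] return_borel_probs[OF w(1)] f by (simp add: V_def concentrated_def)
    ultimately have "\<exists>\<mu>\<in>push \<nu> ` small F. \<mu> \<in> V" using w(2) unfolding in_closure_of by blast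
    then obtain k where k: "k \<in> small F" "push \<nu> k \<in> V" by blast
    have kH: "k \<in> H" using k small_subset by blast
    have fc: "continuous_map B euclideanreal (\<lambda>y. f (c k y))"
      using continuous_map_compose[OF c_action(4)[OF kH] f(1)] by (simp add: o_def)
    have "(f (c k y1) + f (c k y2)) / 2 < 1 / 2"
      using k(2) integral_distr_continuous[OF \<nu> c_action(4)[OF kH] f(1)] int[OF fc] by (simp add: V_def)
    moreover have "c k y1 \<in> topspace B" "c k y2 \<in> topspace B" using c_action(1)[OF kH] y by auto
    moreover from this have "0 \<le> f (c k y1)" "0 \<le> f (c k y2)" using f(2) by auto
    ultimately have "f (c k y1) < 1 \<and> f (c k y2) < 1" by (auto simp: field_simps)
    then have "c k y1 \<in> U" "c k y2 \<in> U"
      using f(4) \<open>c k y1 \<in> topspace B\<close> \<open>c k y2 \<in> topspace B\<close> by (metis DiffI less_irrefl)+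
    then show ?thesis using k by blast
  qed
  then show ?thesis using that w by blast
qed

text \<open>If the maps disagreed throughout \<open>A\<close>, the pairs \<open>(f v, f' v)\<close>
  with \<open>v\<close> in \<open>A\<close> would form a compact set missing the diagonal. But
  \<open>f y\<close> and \<open>f' y\<close> lie in one fibre, so elements of the form
  \<open>\<gamma> \<otimes> k \<otimes> inv \<gamma>\<close> bring this pair close to the diagonal,
  and the moved pair is the one belonging to \<open>c k y\<close>, still in
  \<open>A\<close>.\<close>

lemma equalizer_meets_invariant:
  assumes A: "closedin B A" "A \<noteq> {}" "\<And>k y. k \<in> small F \<Longrightarrow> y \<in> A \<Longrightarrow> c k y \<in> A"
    and F: "finite F" "F \<subseteq> carrier \<Gamma>" "\<gamma> \<in> F"
    and f: "continuous_map B B f" "continuous_map B B f'" "\<And>y. y \<in> topspace B \<Longrightarrow> \<pi> (f y) = \<pi> (f' y)"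
    and equiv: "\<And>k y. k \<in> small F \<Longrightarrow> y \<in> topspace B \<Longrightarrow> f (c k y) = c (\<gamma> \<otimes> k \<otimes> inv \<gamma>) (f y)"
      "\<And>k y. k \<in> small F \<Longrightarrow> y \<in> topspace B \<Longrightarrow> f' (c k y) = c (\<gamma> \<otimes> k \<otimes> inv \<gamma>) (f' y)"
  shows "\<exists>v\<in>A. f v = f' v"
proof (rule ccontr)
  assume neg: "\<not> (\<exists>v\<in>A. f v = f' v)"
  obtain y where y: "y \<in> A" "y \<in> topspace B" using A closedin_subset by blast
  \<comment> \<open>Chosen so that \<open>small F'\<close> consists of conjugates by \<gamma> of
    elements of \<open>small F\<close>, as in \<open>small_conjugate\<close>.\<close>
  define F' where "F' = insert (inv \<gamma>) ((\<lambda>\<delta>. \<delta> \<otimes> inv \<gamma>) ` F)"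
  have F': "finite F'" "F' \<subseteq> carrier \<Gamma>" using F by (auto simp: F'_def)
  have fy: "f y \<in> topspace B" "f' y \<in> topspace B" using f y by (auto simp: continuous_map_def)
  obtain w where w: "w \<in> topspace B"
    "\<forall>U. openin B U \<and> w \<in> U \<longrightarrow> (\<exists>k\<in>small F'. c k (f y) \<in> U \<and> c k (f' y) \<in> U)"
    by (rule pair_proximal[OF F' fy f(3)[OF y(2)]])
  let ?m = "\<lambda>v. (f v, f' v)"
  have "compactin (prod_topology B B) (?m ` A)"
    using closedin_compact_space[OF compact_B A(1)] f
    by (intro image_compactin continuous_map_pairedI) auto
  then have clm: "closedin (prod_topology B B) (?m ` A)"
    using Hausdorff_B by (intro compactin_imp_closedin) (auto simp: Hausdorff_space_prod_topology)
  define N where "N = topspace (prod_topology B B) - ?m ` A"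
  have "openin (prod_topology B B) N"
    unfolding N_def using openin_topspace clm by (rule openin_diff)
  moreover have "(w, w) \<notin> ?m ` A"
  proof
    assume "(w, w) \<in> ?m ` A"
    then have "\<exists>v\<in>A. f v = f' v" by (metis (no_types, lifting) imageE prod.inject)
    then show False using neg by contradiction
  qed
  then have "(w, w) \<in> N" using w(1) by (simp add: N_def)
  ultimately obtain U V where UV: "openin B U" "openin B V" "w \<in> U" "w \<in> V" "U \<times> V \<subseteq> N"
    unfolding openin_prod_topology_alt by meson
  then have "openin B (U \<inter> V)" "w \<in> U \<inter> V" by auto
  then obtain k' where k': "k' \<in> small F'" "c k' (f y) \<in> U \<inter> V" "c k' (f' y) \<in> U \<inter> V"
    using w(2) by blast
  obtain k where k: "k \<in> small F" "k' = \<gamma> \<otimes> k \<otimes> inv \<gamma>"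
    using small_conjugate[OF F(3,2)] k'(1) unfolding F'_def by blast
  have "?m (c k y) \<in> U \<times> V" using k k' equiv y by auto
  moreover have "c k y \<in> A" using A k y by blast
  ultimately show False using UV(5) unfolding N_def by blast
qed

text \<open>A single equalizer is invariant only under \<open>small (F i)\<close>. Finite
  intersections of equalizers are nonempty by repeated use of
  \<open>equalizer_meets_invariant\<close>, the full intersection by compactness;
  \<open>invar\<close> makes it \<open>H\<close>-invariant, and minimality of \<open>B\<close>
  finishes.\<close>

lemma equalizer_topspace:
  fixes f f' :: "'i \<Rightarrow> 'b \<Rightarrow> 'b"
  assumes F: "\<And>i. i \<in> I \<Longrightarrow> finite (F i) \<and> F i \<subseteq> carrier \<Gamma> \<and> \<gamma> i \<in> F i"
    and f: "\<And>i. i \<in> I \<Longrightarrow> continuous_map B B (f i)" "\<And>i. i \<in> I \<Longrightarrow> continuous_map B B (f' i)"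
      "\<And>i y. i \<in> I \<Longrightarrow> y \<in> topspace B \<Longrightarrow> \<pi> (f i y) = \<pi> (f' i y)"
    and equiv: "\<And>i k y. i \<in> I \<Longrightarrow> k \<in> small (F i) \<Longrightarrow> y \<in> topspace B \<Longrightarrow>
        f i (c k y) = c (\<gamma> i \<otimes> k \<otimes> inv (\<gamma> i)) (f i y)"
      "\<And>i k y. i \<in> I \<Longrightarrow> k \<in> small (F i) \<Longrightarrow> y \<in> topspace B \<Longrightarrow>
        f' i (c k y) = c (\<gamma> i \<otimes> k \<otimes> inv (\<gamma> i)) (f' i y)"
    and invar: "\<And>h y. h \<in> H \<Longrightarrow> y \<in> topspace B \<Longrightarrow> (\<And>i. i \<in> I \<Longrightarrow> f i y = f' i y) \<Longrightarrow>
      \<forall>i\<in>I. f i (c h y) = f' i (c h y)"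
    and i: "i \<in> I" and y: "y \<in> topspace B"
  shows "f i y = f' i y"
proof -
  define E where "E i = {y \<in> topspace B. f i y = f' i y}" for i
  have E_closed: "closedin B (E i)" if "i \<in> I" for i
    unfolding E_def using closedin_continuous_maps_eq[OF Hausdorff_B f(1,2)] that by blast
  have E_invar: "c k y \<in> E j" if "j \<in> I" "k \<in> small (F j)" "y \<in> E j" for j k y
  proof -
    have "k \<in> H" using that small_subset by blast
    then show ?thesis using that equiv c_action(1) by (auto simp: E_def)
  qed
  have fin: "topspace B \<inter> (\<Inter>j\<in>J. E j) \<noteq> {}" if "finite J" "J \<subseteq> I" for J
    using that
  proof (induction J rule: finite_induct)
    case empty
    then show ?case using y by auto
  next
    case (insert j J)
    let ?A = "topspace B \<inter> (\<Inter>j\<in>J. E j)"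
    \<comment> \<open>The group \<open>small ?F\<close> lies in all the groups involved, so it
      preserves \<open>?A\<close> and respects the twist of the new pair of maps.\<close>
    let ?F = "\<Union>j\<in>insert j J. F j"
    have small_F: "small ?F \<subseteq> small (F l)" if "l \<in> insert j J" for l
      using that by (intro small_antimono) auto
    have F_fin: "finite ?F" "?F \<subseteq> carrier \<Gamma>" "\<gamma> j \<in> ?F"
      using F insert by (auto dest!: subsetD)
    have jI: "j \<in> I" using insert by auto
    have "closedin B ?A"
      using E_closed insert by (cases "J = {}") (auto intro!: closedin_Int closedin_INT)
    moreover have "?A \<noteq> {}" using insert by auto
    moreover have "c k y \<in> ?A" if k: "k \<in> small ?F" and y: "y \<in> ?A" for k y
    proof -
      have "k \<in> H" using k small_subset by blast
      moreover have "c k y \<in> E l" if l: "l \<in> J" for l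
        using E_invar[of l k y] small_F[of l] k y l insert by auto
      ultimately show ?thesis using y c_action(1) by auto
    qed
    ultimately have "\<exists>v\<in>?A. f j v = f' j v"
      using equiv[OF jI] f[OF jI] small_F[of j]
      by (intro equalizer_meets_invariant[OF _ _ _ F_fin, of ?A "f j" "f' j"]) auto
    then show ?case by (auto simp: E_def)
  qed
  define E0 where "E0 = (\<Inter>i\<in>I. E i)"
  have "\<Inter>\<F> \<noteq> {}" if \<F>: "finite \<F>" "\<F> \<subseteq> E ` I" for \<F>
  proof -
    obtain J where "finite J" "J \<subseteq> I" "\<F> = E ` J" using \<F> by (meson finite_subset_image)
    then show ?thesis using fin by blast
  qed
  then have "E0 \<noteq> {}"
    using compact_B E_closed unfolding compact_space_fip E0_def by (metis (no_types, lifting) imageE)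
  moreover have "closedin B E0" unfolding E0_def using E_closed i by (intro closedin_INT) auto
  moreover have "c h z \<in> E0" if "h \<in> H" "z \<in> E0" for h z
    using invar[of h z] that c_action(1) i by (auto simp: E0_def E_def)
  ultimately have "E0 = topspace B"
    using minimal_G_space_closed_invariant[OF B_minimal, of E0] by simp
  then show ?thesis using y i by (auto simp: E0_def E_def)
qed

text \<open>The coordinates \<open>q \<gamma>\<close> are equivariant only along \<open>H \<inter> \<gamma> H inv \<gamma>\<close>, and twisted by
  conjugation. A limit of translates of \<open>\<nu>\<close> is made concentrated in one coordinate after the other,
  using at each stage a finite index subgroup that respects all coordinates treated so far.\<close>

lemma strongly_proximal_of_coordinates:
  assumes W: "factor_map (\<Gamma>\<lparr>carrier := H\<rparr>) W d X a p"
    and q: "\<And>\<gamma>. \<gamma> \<in> carrier \<Gamma> \<Longrightarrow> continuous_map W B (q \<gamma>)"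
    and sep: "\<And>z z'. z \<in> topspace W \<Longrightarrow> z' \<in> topspace W \<Longrightarrow>
      (\<And>\<gamma>. \<gamma> \<in> carrier \<Gamma> \<Longrightarrow> q \<gamma> z = q \<gamma> z') \<Longrightarrow> z = z'"
    and fib: "\<And>\<gamma> z. \<gamma> \<in> carrier \<Gamma> \<Longrightarrow> z \<in> topspace W \<Longrightarrow> \<pi> (q \<gamma> z) = a (inv \<gamma>) (p z)"
    and equiv: "\<And>\<gamma> h z. \<gamma> \<in> carrier \<Gamma> \<Longrightarrow> h \<in> H \<Longrightarrow> inv \<gamma> \<otimes> h \<otimes> \<gamma> \<in> H \<Longrightarrow> z \<in> topspace W \<Longrightarrow>
      q \<gamma> (d h z) = c (inv \<gamma> \<otimes> h \<otimes> \<gamma>) (q \<gamma> z)"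
  shows "strongly_proximal_extension (\<Gamma>\<lparr>carrier := H\<rparr>) W d X a p"
proof -
  have GW: "G_space (\<Gamma>\<lparr>carrier := H\<rparr>) W d" and p: "continuous_map W X p"
    and p_equiv: "\<And>h z. h \<in> H \<Longrightarrow> z \<in> topspace W \<Longrightarrow> p (d h z) = a h (p z)"
    using W by (auto simp: factor_map_def)
  note d = G_space_action[OF GW, simplified]
  have compact_W: "compact_space W" and Hausdorff_W: "Hausdorff_space W"
    using GW by (auto simp: G_space_def)
  let ?BW = "borel_algebra W" and ?BB = "borel_algebra B" and ?BX = "borel_algebra X"
  define D where "D h \<mu> = distr \<mu> ?BW (d h)" for h \<mu>
  have D_probs: "D h \<mu> \<in> borel_probs W" if "h \<in> H" "\<mu> \<in> borel_probs W" for h \<mu>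
    unfolding D_def using borel_probs_distr[OF d(4)] that by blast
  have D_mult: "D h (D k \<mu>) = D (h \<otimes> k) \<mu>" if h: "h \<in> H" "k \<in> H" and \<mu>: "\<mu> \<in> borel_probs W" for h k \<mu>
  proof -
    have "D h (D k \<mu>) = distr \<mu> ?BW (\<lambda>z. d h (d k z))"
      unfolding D_def by (rule distr_distr_continuous[OF \<mu> d(4)[OF h(2)] d(4)[OF h(1)]])
    also have "\<dots> = D (h \<otimes> k) \<mu>"
      unfolding D_def using d(2)[OF h] borel_probs_space[OF \<mu>] by (intro distr_cong) auto
    finally show ?thesis .
  qed
  have "\<exists>z\<in>topspace W. return ?BW z \<in> weak_star W closure_of {distr \<nu> ?BW (d h) |h. h \<in> H}"
    if \<nu>: "\<nu> \<in> borel_probs W" and x: "x \<in> topspace X"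
      and supp: "measure_support W \<nu> \<subseteq> {z \<in> topspace W. p z = x}" for \<nu> x
  proof -
    define S where "S = {D h \<nu> |h. h \<in> H}"
    define Cl where "Cl = weak_star W closure_of S"
    \<comment> \<open>The base point may move in \<open>X\<close> when translates of \<nu> are taken
      to the limit; being concentrated over some point of \<open>X\<close> is a closed condition and
      survives.\<close>
    define CX where "CX = {\<mu> \<in> borel_probs W. \<exists>x. concentrated X (distr \<mu> ?BX p) x}"
    define C where "C \<gamma> = {\<mu> \<in> borel_probs W. \<exists>y. concentrated B (distr \<mu> ?BB (q \<gamma>)) y}" for \<gamma>
    have S_probs: "S \<subseteq> borel_probs W" using D_probs \<nu> by (auto simp: S_def)
    have Cl_probs: "Cl \<subseteq> borel_probs W"
      unfolding Cl_def using closure_of_subset_topspace[of "weak_star W" S] by simp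
    have Cl_closed: "closedin (weak_star W) Cl" by (simp add: Cl_def)
    have CX_closed: "closedin (weak_star W) CX"
      unfolding CX_def by (rule closedin_concentrated_distr[OF compact_X p])
    have C_closed: "closedin (weak_star W) (C \<gamma>)" if "\<gamma> \<in> carrier \<Gamma>" for \<gamma>
      unfolding C_def by (rule closedin_concentrated_distr[OF compact_B q[OF that]])
    have D_Cl: "D h \<mu> \<in> Cl" if h: "h \<in> H" and \<mu>: "\<mu> \<in> Cl" for h \<mu>
    proof -
      have "D h ` S \<subseteq> S"
        using D_mult h \<nu> unfolding S_def by auto
      then have "weak_star W closure_of (D h ` S) \<subseteq> Cl" unfolding Cl_def by (rule closure_of_mono)
      moreover have "D h ` Cl \<subseteq> weak_star W closure_of (D h ` S)"
        unfolding Cl_def D_def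
        by (rule continuous_map_image_closure_subset[OF continuous_map_distr_weak_star[OF d(4)[OF h]]])
      ultimately show ?thesis using \<mu> by blast
    qed
    have "S \<subseteq> CX"
    proof
      fix \<mu> assume "\<mu> \<in> S"
      then obtain h where h: "h \<in> H" "\<mu> = D h \<nu>" by (auto simp: S_def)
      have "continuous_map W X (\<lambda>z. p (d h z))"
        using continuous_map_compose[OF d(4)[OF h(1)] p] by (simp add: o_def)
      moreover have "measure_support W \<nu> \<subseteq> {z \<in> topspace W. p (d h z) = a h x}"
        using supp p_equiv[OF h(1)] by auto
      moreover have "a h x \<in> topspace X" using a_action(1) h x by simp
      ultimately have "concentrated X (distr \<nu> ?BX (\<lambda>z. p (d h z))) (a h x)"
        by (rule concentrated_of_support[OF compact_W \<nu>])
      then show "\<mu> \<in> CX"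
        using distr_distr_continuous[OF \<nu> d(4)[OF h(1)] p] D_probs[OF h(1) \<nu>] h(2) by (auto simp: CX_def D_def)
    qed
    then have Cl_CX: "Cl \<subseteq> CX" unfolding Cl_def using CX_closed by (rule closure_of_minimal)
    have step: "Cl \<inter> (\<Inter>\<gamma>\<in>J. C \<gamma>) \<noteq> {}" if "finite J" "J \<subseteq> carrier \<Gamma>" for J
      using that
    proof (induction J rule: finite_induct)
      case empty
      have "D \<one> \<nu> \<in> S" by (auto simp: S_def)
      then have "D \<one> \<nu> \<in> Cl"
        unfolding Cl_def using closure_of_subset[of S "weak_star W"] S_probs by auto
      then show ?case by auto
    next
      case (insert \<gamma> J)
      then obtain \<mu> where \<mu>: "\<mu> \<in> Cl" "\<forall>\<delta>\<in>J. \<mu> \<in> C \<delta>" by auto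
      have \<mu>P: "\<mu> \<in> borel_probs W" using \<mu> Cl_probs by blast
      have \<gamma>: "\<gamma> \<in> carrier \<Gamma>" using insert by simp
      define F where "F = m_inv \<Gamma> ` insert \<gamma> J"
      have F: "finite F" "F \<subseteq> carrier \<Gamma>" "inv \<gamma> \<in> F" using insert by (auto simp: F_def)
      have small_F: "k \<in> H \<and> inv \<delta> \<otimes> k \<otimes> \<delta> \<in> H"
        if "k \<in> small F" "\<delta> \<in> insert \<gamma> J" for k \<delta>
      proof -
        have "inv \<delta> \<otimes> k \<otimes> inv (inv \<delta>) \<in> H" using that by (auto simp: small_def F_def)
        moreover have "inv (inv \<delta>) = \<delta>" using that insert by auto
        ultimately show ?thesis using that small_subset by auto
      qed
      have marginal: "distr (D k \<mu>) ?BB (q \<delta>) = push (distr \<mu> ?BB (q \<delta>)) (inv \<delta> \<otimes> k \<otimes> \<delta>)"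
        if k: "k \<in> small F" and \<delta>: "\<delta> \<in> insert \<gamma> J" for k \<delta>
      proof -
        have \<delta>c: "\<delta> \<in> carrier \<Gamma>" using \<delta> insert by auto
        note kH = small_F[OF k \<delta>]
        have "distr (D k \<mu>) ?BB (q \<delta>) = distr \<mu> ?BB (\<lambda>z. q \<delta> (d k z))"
          unfolding D_def using kH by (intro distr_distr_continuous[OF \<mu>P _ q[OF \<delta>c]] d(4)) simp
        also have "\<dots> = distr \<mu> ?BB (\<lambda>z. c (inv \<delta> \<otimes> k \<otimes> \<delta>) (q \<delta> z))"
          using equiv[OF \<delta>c] kH borel_probs_space[OF \<mu>P] by (intro distr_cong) auto
        also have "\<dots> = push (distr \<mu> ?BB (q \<delta>)) (inv \<delta> \<otimes> k \<otimes> \<delta>)"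
          using kH by (intro distr_distr_continuous[symmetric, OF \<mu>P q[OF \<delta>c]] c_action(4)) simp
        finally show ?thesis .
      qed
      \<comment> \<open>Moving \<mu> by \<open>small F\<close> moves each marginal treated so far by
        an element of \<open>H\<close>, so these marginals stay concentrated, also in the
        closure.\<close>
      define S' where "S' = (\<lambda>k. D k \<mu>) ` small F"
      have S'_Cl: "S' \<subseteq> Cl" using D_Cl[OF subsetD[OF small_subset] \<mu>(1)] by (auto simp: S'_def)
      have S'_C: "S' \<subseteq> C \<delta>" if \<delta>: "\<delta> \<in> J" for \<delta>
      proof
        fix \<mu>' assume "\<mu>' \<in> S'"
        then obtain k where k: "k \<in> small F" "\<mu>' = D k \<mu>" by (auto simp: S'_def)
        have \<delta>c: "\<delta> \<in> carrier \<Gamma>" using \<delta> insert by auto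
        have kH: "inv \<delta> \<otimes> k \<otimes> \<delta> \<in> H" using small_F[OF k(1), of \<delta>] \<delta> by simp
        obtain y where "concentrated B (distr \<mu> ?BB (q \<delta>)) y" using \<mu> \<delta> by (auto simp: C_def)
        then have "concentrated B (push (distr \<mu> ?BB (q \<delta>)) (inv \<delta> \<otimes> k \<otimes> \<delta>)) (c (inv \<delta> \<otimes> k \<otimes> \<delta>) y)"
          by (intro concentrated_distr[OF borel_probs_distr[OF q[OF \<delta>c] \<mu>P]] c_action(4)[OF kH])
        then have "concentrated B (distr \<mu>' ?BB (q \<delta>)) (c (inv \<delta> \<otimes> k \<otimes> \<delta>) y)"
          using marginal[OF k(1), of \<delta>] \<delta> k(2) by simp
        moreover have "\<mu>' \<in> borel_probs W" using \<open>\<mu>' \<in> S'\<close> S'_Cl Cl_probs by blast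
        ultimately show "\<mu>' \<in> C \<delta>" by (auto simp: C_def)
      qed
      let ?\<nu>1 = "distr \<mu> ?BB (q \<gamma>)"
      have \<nu>1: "?\<nu>1 \<in> borel_probs B" by (rule borel_probs_distr[OF q[OF \<gamma>] \<mu>P])
      obtain x1 where x1: "concentrated X (distr \<mu> ?BX p) x1" using Cl_CX \<mu> by (auto simp: CX_def)
      have a\<gamma>: "continuous_map X X (a (inv \<gamma>))" using a_action(4) \<gamma> by simp
      have "distr ?\<nu>1 ?BX \<pi> = distr \<mu> ?BX (\<lambda>z. \<pi> (q \<gamma> z))"
        by (rule distr_distr_continuous[OF \<mu>P q[OF \<gamma>] \<pi>_cont])
      also have "\<dots> = distr \<mu> ?BX (\<lambda>z. a (inv \<gamma>) (p z))"
        using fib[OF \<gamma>] borel_probs_space[OF \<mu>P] by (intro distr_cong) auto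
      also have "\<dots> = distr (distr \<mu> ?BX p) ?BX (a (inv \<gamma>))"
        by (rule distr_distr_continuous[symmetric, OF \<mu>P p a\<gamma>])
      finally have "concentrated X (distr ?\<nu>1 ?BX \<pi>) (a (inv \<gamma>) x1)"
        using concentrated_distr[OF borel_probs_distr[OF p \<mu>P] x1 a\<gamma>] by simp
      \<comment> \<open>This is where the condition on fibres is used: the marginal of \<mu> sits in
        one fibre of \<pi>, so strong proximality of \<open>B\<close> applies to it.\<close>
      then have supp1: "measure_support B ?\<nu>1 \<subseteq> {y \<in> topspace B. \<pi> y = a (inv \<gamma>) x1}"
        using support_of_concentrated[OF compact_B \<nu>1 \<pi>_cont compact_X Hausdorff_X]
        by (auto simp: measure_support_def)
      have x1': "a (inv \<gamma>) x1 \<in> topspace X"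
        using x1 a_action(1) \<gamma> by (simp add: concentrated_def)
      \<comment> \<open>The elements of \<open>small F\<close> act on the marginal at \<gamma>
        through their conjugates by \<open>inv \<gamma>\<close>, and all of \<open>small F'\<close>
        arises in this way.\<close>
      define F' where "F' = insert (inv (inv \<gamma>)) ((\<lambda>\<delta>. \<delta> \<otimes> inv (inv \<gamma>)) ` F)"
      have F': "finite F'" "F' \<subseteq> carrier \<Gamma>" using F \<gamma> by (auto simp: F'_def)
      obtain y where y: "y \<in> topspace B"
        "return ?BB y \<in> weak_star B closure_of (push ?\<nu>1 ` small F')"
        by (rule strongly_proximal_small[OF F' \<nu>1 x1' supp1])
      have "push ?\<nu>1 ` small F' \<subseteq> (\<lambda>\<mu>. distr \<mu> ?BB (q \<gamma>)) ` S'"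
      proof
        fix \<mu>' assume "\<mu>' \<in> push ?\<nu>1 ` small F'"
        then obtain k' where k': "k' \<in> small F'" "\<mu>' = push ?\<nu>1 k'" by blast
        obtain k where k: "k \<in> small F" "k' = inv \<gamma> \<otimes> k \<otimes> inv (inv \<gamma>)"
          using small_conjugate[OF F(3,2)] k'(1) unfolding F'_def by blast
        then have "\<mu>' = distr (D k \<mu>) ?BB (q \<gamma>)" using marginal[OF k(1), of \<gamma>] k' \<gamma> by simp
        then show "\<mu>' \<in> (\<lambda>\<mu>. distr \<mu> ?BB (q \<gamma>)) ` S'" using k(1) by (auto simp: S'_def)
      qed
      then have "return ?BB y \<in> weak_star B closure_of ((\<lambda>\<mu>. distr \<mu> ?BB (q \<gamma>)) ` S')"
        by (rule subsetD[OF closure_of_mono y(2)])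
      moreover have "S' \<subseteq> borel_probs W" using S'_Cl Cl_probs by blast
      ultimately obtain \<phi> where \<phi>: "\<phi> \<in> weak_star W closure_of S'" "concentrated B (distr \<phi> ?BB (q \<gamma>)) y"
        by (rule lift_concentrated[OF compact_W Hausdorff_W q[OF \<gamma>] y(1)])
      have "\<phi> \<in> Cl" using \<phi>(1) closure_of_minimal[OF S'_Cl Cl_closed] by blast
      moreover have "\<phi> \<in> C \<delta>" if "\<delta> \<in> J" for \<delta>
        using \<phi>(1) closure_of_minimal[OF S'_C[OF that] C_closed[of \<delta>]] that insert by blast
      moreover have "\<phi> \<in> C \<gamma>" using \<phi>(2) \<open>\<phi> \<in> Cl\<close> Cl_probs by (auto simp: C_def)
      ultimately show ?case by blast
    qed
    have "Cl \<inter> (\<Inter>\<gamma>\<in>carrier \<Gamma>. C \<gamma>) \<noteq> {}"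
    proof -
      let ?\<U> = "insert Cl (C ` carrier \<Gamma>)"
      have "\<Inter>\<F> \<noteq> {}" if \<F>: "finite \<F>" "\<F> \<subseteq> ?\<U>" for \<F>
      proof -
        have "finite (\<F> - {Cl})" "\<F> - {Cl} \<subseteq> C ` carrier \<Gamma>" using \<F> by auto
        then obtain J where J: "finite J" "J \<subseteq> carrier \<Gamma>" "\<F> - {Cl} = C ` J"
          by (meson finite_subset_image)
        then have "Cl \<inter> \<Inter>(\<F> - {Cl}) \<noteq> {}" using step[of J] by simp
        moreover have "Cl \<inter> \<Inter>(\<F> - {Cl}) \<subseteq> \<Inter>\<F>" by blast
        ultimately show ?thesis by blast
      qed
      moreover have "\<forall>K\<in>?\<U>. closedin (weak_star W) K" using Cl_closed C_closed by blast
      ultimately have "\<Inter>?\<U> \<noteq> {}"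
        using spec[OF compact_space_weak_star[OF compact_W Hausdorff_W, unfolded compact_space_fip], of ?\<U>]
        by blast
      then show ?thesis by simp
    qed
    then obtain \<phi> where \<phi>: "\<phi> \<in> Cl" "\<forall>\<gamma>\<in>carrier \<Gamma>. \<phi> \<in> C \<gamma>" by blast
    have \<phi>P: "\<phi> \<in> borel_probs W" using \<phi> Cl_probs by blast
    obtain z where z: "z \<in> measure_support W \<phi>"
      using measure_support_nonempty[OF compact_W \<phi>P] by blast
    have zW: "z \<in> topspace W" using z by (simp add: measure_support_def)
    \<comment> \<open>Every coordinate is constant on the support and the coordinates separate
      points. The map \<open>id\<close> brings the claim into the form used by
      \<open>concentrated_of_support\<close>.\<close>
    have "measure_support W \<phi> \<subseteq> {z' \<in> topspace W. id z' = z}"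
    proof
      fix z' assume z': "z' \<in> measure_support W \<phi>"
      have "q \<gamma> z' = q \<gamma> z" if \<gamma>: "\<gamma> \<in> carrier \<Gamma>" for \<gamma>
      proof -
        obtain y where "concentrated B (distr \<phi> ?BB (q \<gamma>)) y" using \<phi> \<gamma> by (auto simp: C_def)
        note * = support_of_concentrated[OF compact_W \<phi>P q[OF \<gamma>] compact_B Hausdorff_B this]
        show ?thesis using *[OF z] *[OF z'] by simp
      qed
      moreover have "z' \<in> topspace W" using z' by (simp add: measure_support_def)
      ultimately show "z' \<in> {z' \<in> topspace W. id z' = z}" using sep[of z' z] zW by simp
    qed
    then have "concentrated W (distr \<phi> ?BW id) z"
      by (rule concentrated_of_support[OF compact_W \<phi>P continuous_map_id _ zW])
    then have "concentrated W \<phi> z"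
      using integral_distr_continuous[OF \<phi>P continuous_map_id] by (simp add: concentrated_def)
    then have "return ?BW z \<in> Cl"
      using \<phi>(1) unfolding Cl_def by (intro weak_star_closure_concentrated)
    then show ?thesis using zW by (auto simp: Cl_def S_def D_def)
  qed
  then show ?thesis using W by (auto simp: strongly_proximal_extension_def)
qed

text \<open>Minimality passes from \<open>B\<close> to its factor. It will make the projection from
  a minimal subset of the coinduced space onto \<open>X\<close> surjective.\<close>

lemma X_minimal: "minimal_G_space (\<Gamma>\<lparr>carrier := H\<rparr>) X a"
proof (rule minimal_G_spaceI[OF X_H])
  fix E assume E: "closedin X E" "E \<noteq> {}" "\<And>g x. g \<in> carrier (\<Gamma>\<lparr>carrier := H\<rparr>) \<Longrightarrow> x \<in> E \<Longrightarrow> a g x \<in> E"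
  let ?E = "{y \<in> topspace B. \<pi> y \<in> E}"
  obtain x where "x \<in> E" "x \<in> topspace X" using E(1,2) closedin_subset by blast
  then obtain y where y: "y \<in> topspace B" "\<pi> y = x" using \<pi>_surj by (metis imageE)
  have "?E = topspace B"
  proof (rule minimal_G_space_closed_invariant[OF B_minimal])
    show "closedin B ?E" using closedin_continuous_map_preimage[OF \<pi>_cont E(1)] .
    show "?E \<noteq> {}" using y \<open>x \<in> E\<close> by auto
  qed (use E(3) c_action(1) \<pi>_equiv in auto)
  then have "topspace X \<subseteq> E" using \<pi>_surj by (metis (no_types, lifting) image_subset_iff mem_Collect_eq)
  then show "E = topspace X" using closedin_subset[OF E(1)] by (rule antisym[rotated])
qed

subsection \<open>The coinduced space\<close>

text \<open>The coinduced space cut down over \<open>X\<close>: with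
  \<open>x = \<pi> (z \<one>)\<close>, the coordinate \<open>z \<gamma>\<close> is a point of the
  fibre over \<open>a (inv \<gamma>) x\<close>.\<close>

definition coind :: "('g \<Rightarrow> 'b) set" where
  "coind = {z \<in> (\<Pi>\<^sub>E \<gamma>\<in>carrier \<Gamma>. topspace B).
     (\<forall>\<gamma>\<in>carrier \<Gamma>. \<forall>h\<in>H. z (\<gamma> \<otimes> h) = c (inv h) (z \<gamma>)) \<and>
     (\<forall>\<gamma>\<in>carrier \<Gamma>. a \<gamma> (\<pi> (z \<gamma>)) = \<pi> (z \<one>))}"

abbreviation pow_top :: "('g \<Rightarrow> 'b) topology" where
  "pow_top \<equiv> product_topology (\<lambda>_. B) (carrier \<Gamma>)"

definition translate :: "'g \<Rightarrow> ('g \<Rightarrow> 'b) \<Rightarrow> 'g \<Rightarrow> 'b" where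
  "translate h z = (\<lambda>\<gamma>\<in>carrier \<Gamma>. z (inv h \<otimes> \<gamma>))"

lemma coind_in: "z \<in> coind \<Longrightarrow> \<gamma> \<in> carrier \<Gamma> \<Longrightarrow> z \<gamma> \<in> topspace B"
  and coind_mult: "z \<in> coind \<Longrightarrow> \<gamma> \<in> carrier \<Gamma> \<Longrightarrow> h \<in> H \<Longrightarrow> z (\<gamma> \<otimes> h) = c (inv h) (z \<gamma>)"
  and coind_fibre: "z \<in> coind \<Longrightarrow> \<gamma> \<in> carrier \<Gamma> \<Longrightarrow> a \<gamma> (\<pi> (z \<gamma>)) = \<pi> (z \<one>)"
  and coind_ext: "z \<in> coind \<Longrightarrow> z \<in> extensional (carrier \<Gamma>)"
  by (auto simp: coind_def PiE_def)

lemma coordinate_cont: "\<gamma> \<in> carrier \<Gamma> \<Longrightarrow> continuous_map pow_top B (\<lambda>z. z \<gamma>)"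
  by (rule continuous_map_product_projection)

lemma closedin_coind: "closedin pow_top coind"
proof -
  let ?P1 = "\<lambda>(\<gamma>, h). {z \<in> topspace pow_top. z (\<gamma> \<otimes> h) = c (inv h) (z \<gamma>)}"
  let ?P2 = "\<lambda>\<gamma>. {z \<in> topspace pow_top. a \<gamma> (\<pi> (z \<gamma>)) = \<pi> (z \<one>)}"
  have "closedin pow_top (?P1 i)" if i\<Gamma>: "i \<in> carrier \<Gamma> \<times> H" for i
  proof -
    obtain \<gamma> h where i: "i = (\<gamma>, h)" "\<gamma> \<in> carrier \<Gamma>" "h \<in> H" using i\<Gamma> by auto
    have "continuous_map pow_top B (\<lambda>z. c (inv h) (z \<gamma>))"
      using continuous_map_compose[OF coordinate_cont[OF i(2)] c_action(4)[of "inv h"]] i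
      by (simp add: o_def)
    then show ?thesis
      unfolding i(1) prod.case using i by (intro closedin_continuous_maps_eq[OF Hausdorff_B coordinate_cont]) auto
  qed
  moreover have "closedin pow_top (?P2 \<gamma>)" if \<gamma>: "\<gamma> \<in> carrier \<Gamma>" for \<gamma>
  proof -
    have \<pi>c: "continuous_map pow_top X (\<lambda>z. \<pi> (z \<delta>))" if "\<delta> \<in> carrier \<Gamma>" for \<delta>
      using continuous_map_compose[OF coordinate_cont[OF that] \<pi>_cont] by (simp add: o_def)
    have "continuous_map pow_top X (\<lambda>z. a \<gamma> (\<pi> (z \<gamma>)))"
      using continuous_map_compose[OF \<pi>c[OF \<gamma>] a_action(4)[OF \<gamma>]] by (simp add: o_def)
    then show ?thesis by (rule closedin_continuous_maps_eq[OF Hausdorff_X _ \<pi>c[OF one_closed]])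
  qed
  moreover have "H \<noteq> {}" "carrier \<Gamma> \<noteq> {}" using H_closed(3) one_closed by blast+
  ultimately have "closedin pow_top ((\<Inter>i\<in>carrier \<Gamma> \<times> H. ?P1 i) \<inter> (\<Inter>\<gamma>\<in>carrier \<Gamma>. ?P2 \<gamma>))"
    by (intro closedin_Int closedin_INT) auto
  moreover have "(\<Inter>i\<in>carrier \<Gamma> \<times> H. ?P1 i) \<inter> (\<Inter>\<gamma>\<in>carrier \<Gamma>. ?P2 \<gamma>) = coind"
    using \<open>H \<noteq> {}\<close> \<open>carrier \<Gamma> \<noteq> {}\<close> by (auto simp: coind_def)
  ultimately show ?thesis by simp
qed

lemma translate_coind:
  assumes h: "h \<in> H" and z: "z \<in> coind"
  shows "translate h z \<in> coind"
proof -
  have hz: "translate h z \<one> = c h (z \<one>)"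
    using h coind_mult[OF z one_closed, of "inv h"] by (simp add: translate_def)
  have "a \<gamma> (\<pi> (translate h z \<gamma>)) = \<pi> (translate h z \<one>)" if \<gamma>: "\<gamma> \<in> carrier \<Gamma>" for \<gamma>
  proof -
    let ?u = "z (inv h \<otimes> \<gamma>)"
    have u: "?u \<in> topspace B" using coind_in[OF z] h \<gamma> by simp
    have "a \<gamma> (\<pi> ?u) = a (h \<otimes> (inv h \<otimes> \<gamma>)) (\<pi> ?u)" using h \<gamma> by simp
    also have "\<dots> = a h (a (inv h \<otimes> \<gamma>) (\<pi> ?u))" using h \<gamma> \<pi>_in[OF u] by (intro a_action(2)) auto
    also have "\<dots> = a h (\<pi> (z \<one>))" using coind_fibre[OF z, of "inv h \<otimes> \<gamma>"] h \<gamma> by simp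
    also have "\<dots> = \<pi> (translate h z \<one>)" using hz h \<pi>_equiv coind_in[OF z one_closed] by simp
    finally show ?thesis using \<gamma> by (simp add: translate_def)
  qed
  moreover have "translate h z (\<gamma> \<otimes> k) = c (inv k) (translate h z \<gamma>)" if "\<gamma> \<in> carrier \<Gamma>" "k \<in> H" for \<gamma> k
    using that h coind_mult[OF z, of "inv h \<otimes> \<gamma>" k] by (simp add: translate_def m_assoc)
  moreover have "translate h z \<in> (\<Pi>\<^sub>E \<gamma>\<in>carrier \<Gamma>. topspace B)"
    using coind_in[OF z] h by (auto simp: translate_def)
  ultimately show ?thesis by (simp add: coind_def)
qed

lemma translate_cont: "h \<in> H \<Longrightarrow> continuous_map pow_top pow_top (translate h)"
  using coordinate_cont by (auto simp: continuous_map_componentwise translate_def)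

lemma translate_mult:
  "h \<in> H \<Longrightarrow> k \<in> H \<Longrightarrow> z \<in> coind \<Longrightarrow> translate (h \<otimes> k) z = translate h (translate k z)"
  by (auto simp: translate_def fun_eq_iff inv_mult_group m_assoc)

lemma translate_one: "z \<in> coind \<Longrightarrow> translate \<one> z = z"
  using coind_ext by (intro extensionalityI[of _ "carrier \<Gamma>"]) (auto simp: translate_def)

text \<open>A point can be prescribed freely on one representative of each left coset of
  \<open>H\<close>, in the fibre demanded by a fixed \<open>x\<close>; equivariance determines the
  rest.\<close>

lemma coind_nonempty:
  assumes "topspace B \<noteq> {}"
  shows "coind \<noteq> {}"
proof -
  obtain x where x: "x \<in> topspace X" using assms \<pi>_in by blast
  \<comment> \<open>The choice is made from the coset itself, so \<open>r\<close> takes one value on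
    each coset.\<close>
  define r where "r \<gamma> = (SOME \<delta>. \<delta> \<in> \<gamma> <# H)" for \<gamma>
  have r_mem: "r \<gamma> \<in> \<gamma> <# H" if "\<gamma> \<in> carrier \<Gamma>" for \<gamma>
  proof -
    have "\<gamma> \<in> \<gamma> <# H" using that H_closed(3) by (force simp: l_coset_def)
    then show ?thesis unfolding r_def by (rule someI)
  qed
  have r: "r \<gamma> \<in> carrier \<Gamma>" "inv \<gamma> \<otimes> r \<gamma> \<in> H" if "\<gamma> \<in> carrier \<Gamma>" for \<gamma>
    using r_mem[OF that] that by (auto simp: l_coset_def)
  have coset: "(\<gamma> \<otimes> h) <# H = \<gamma> <# H" if "\<gamma> \<in> carrier \<Gamma>" "h \<in> H" for \<gamma> h
  proof -
    have "k \<in> H \<Longrightarrow> \<exists>l\<in>H. \<gamma> \<otimes> k = \<gamma> \<otimes> h \<otimes> l" for k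
      using that by (intro bexI[of _ "inv h \<otimes> k"]) (auto simp: m_assoc)
    moreover have "k \<in> H \<Longrightarrow> \<exists>l\<in>H. \<gamma> \<otimes> h \<otimes> k = \<gamma> \<otimes> l" for k
      using that by (intro bexI[of _ "h \<otimes> k"]) (auto simp: m_assoc)
    ultimately show ?thesis by (auto simp: l_coset_def)
  qed
  have "\<exists>y. y \<in> topspace B \<and> \<pi> y = a (inv \<delta>) x" if "\<delta> \<in> carrier \<Gamma>" for \<delta>
    using \<pi>_surj a_action(1)[of "inv \<delta>" x] x that by (metis imageE inv_closed)
  then obtain b where b: "\<And>\<delta>. \<delta> \<in> carrier \<Gamma> \<Longrightarrow> b \<delta> \<in> topspace B \<and> \<pi> (b \<delta>) = a (inv \<delta>) x" by metis
  \<comment> \<open>The element \<open>inv \<gamma> \<otimes> r \<gamma>\<close> of \<open>H\<close>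
    carries the fibre over \<open>a (inv (r \<gamma>)) x\<close> to the one over
    \<open>a (inv \<gamma>) x\<close>.\<close>
  define z where "z = (\<lambda>\<gamma>\<in>carrier \<Gamma>. c (inv \<gamma> \<otimes> r \<gamma>) (b (r \<gamma>)))"
  have "a \<gamma> (\<pi> (z \<gamma>)) = x" if \<gamma>: "\<gamma> \<in> carrier \<Gamma>" for \<gamma>
  proof -
    have "\<pi> (z \<gamma>) = a (inv \<gamma> \<otimes> r \<gamma>) (a (inv (r \<gamma>)) x)"
      using \<pi>_equiv[OF r(2)[OF \<gamma>]] b[OF r(1)[OF \<gamma>]] \<gamma> by (simp add: z_def)
    also have "\<dots> = a (inv \<gamma>) x"
      using a_action(2)[of "inv \<gamma> \<otimes> r \<gamma>" "inv (r \<gamma>)" x] r[OF \<gamma>] \<gamma> x by (simp add: m_assoc)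
    finally show ?thesis using a_action(2)[of \<gamma> "inv \<gamma>" x] a_action(3) \<gamma> x by simp
  qed
  moreover have "z (\<gamma> \<otimes> h) = c (inv h) (z \<gamma>)" if \<gamma>: "\<gamma> \<in> carrier \<Gamma>" and h: "h \<in> H" for \<gamma> h
  proof -
    have "r (\<gamma> \<otimes> h) = r \<gamma>" using coset[OF \<gamma> h] by (simp add: r_def)
    then have "z (\<gamma> \<otimes> h) = c (inv h \<otimes> (inv \<gamma> \<otimes> r \<gamma>)) (b (r \<gamma>))"
      using \<gamma> h r[OF \<gamma>] by (simp add: z_def inv_mult_group m_assoc)
    also have "\<dots> = c (inv h) (z \<gamma>)"
      using c_action(2)[of "inv h" "inv \<gamma> \<otimes> r \<gamma>" "b (r \<gamma>)"] \<gamma> h r[OF \<gamma>] b[OF r(1)[OF \<gamma>]]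
      by (simp add: z_def)
    finally show ?thesis .
  qed
  moreover have "z \<in> (\<Pi>\<^sub>E \<gamma>\<in>carrier \<Gamma>. topspace B)"
    using c_action(1) r b by (auto simp: z_def)
  moreover have "\<pi> (z \<one>) = x"
  proof -
    have "z \<one> \<in> topspace B" using c_action(1) r[OF one_closed] b by (simp add: z_def)
    then show ?thesis using a_action(3)[OF \<pi>_in] calculation(1)[OF one_closed] by simp
  qed
  ultimately have "z \<in> coind" by (auto simp: coind_def)
  then show ?thesis by blast
qed

lemma coinduced_boundary:
  assumes "topspace B \<noteq> {}"
  obtains M where "M \<subseteq> coind"
    "is_boundary (\<Gamma>\<lparr>carrier := H\<rparr>) X a (subtopology pow_top M) (\<lambda>h. \<lambda>z\<in>M. translate h z) (\<lambda>z. \<pi> (z \<one>))"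
proof -
  let ?G = "\<Gamma>\<lparr>carrier := H\<rparr>" and ?Y = "subtopology pow_top coind"
  have coind_sub: "coind \<subseteq> topspace pow_top" using closedin_coind closedin_subset by blast
  have "compact_space pow_top" using compact_B by (simp add: compact_space_product_topology)
  then have cY: "compact_space ?Y" using closedin_coind closedin_compact_space compact_space_subtopology by blast
  have tY: "topspace ?Y = coind" using coind_sub by auto
  obtain M where M: "closedin ?Y M" "M \<noteq> {}" "\<forall>g\<in>translate ` H. \<forall>y\<in>M. g y \<in> M"
    "\<forall>E. closedin ?Y E \<and> E \<noteq> {} \<and> E \<subseteq> M \<and> (\<forall>g\<in>translate ` H. \<forall>y\<in>E. g y \<in> E) \<longrightarrow> E = M"
    by (rule closed_invariant_minimal[OF cY, of "translate ` H"])
      (use tY coind_nonempty[OF assms] translate_coind in auto)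
  have Mc: "M \<subseteq> coind" using closedin_subset[OF M(1)] tY by simp
  have M_closed: "closedin pow_top M" using M(1) closedin_coind closedin_trans_full by blast
  let ?W = "subtopology pow_top M" and ?d = "\<lambda>h. \<lambda>z\<in>M. translate h z" and ?p = "\<lambda>z. \<pi> (z \<one>)"
  have tW: "topspace ?W = M" using Mc coind_sub by auto
  have M_inv: "translate h z \<in> M" if "h \<in> H" "z \<in> M" for h z using M(3) that by blast
  have GW: "G_space ?G ?W ?d"
    unfolding G_space_def
  proof (intro conjI ballI)
    show "compact_space ?W"
      using \<open>compact_space pow_top\<close> M_closed closedin_compact_space compact_space_subtopology by blast
    show "Hausdorff_space ?W"
      using Hausdorff_B by (simp add: Hausdorff_space_subtopology Hausdorff_space_product_topology)
    show "group_action ?G (topspace ?W) ?d"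
      unfolding tW
      by (rule group_actionI[OF H_group]) (use M_inv Mc translate_mult translate_one in auto)
    fix h assume "h \<in> carrier ?G"
    then have h: "h \<in> H" by simp
    have "continuous_map ?W pow_top (?d h)"
      using continuous_map_from_subtopology[OF translate_cont[OF h], of M]
      by (rule continuous_map_eq) (use tW in auto)
    then show "continuous_map ?W ?W (?d h)"
      using M_inv[OF h] by (auto simp: continuous_map_in_subtopology tW)
  qed
  have minimal: "minimal_G_space ?G ?W ?d"
  proof (rule minimal_G_spaceI[OF GW])
    fix E assume E: "closedin ?W E" "E \<noteq> {}" "\<And>g z. g \<in> carrier ?G \<Longrightarrow> z \<in> E \<Longrightarrow> ?d g z \<in> E"
    have EM: "E \<subseteq> M" using closedin_subset[OF E(1)] tW by simp
    have "closedin pow_top E" using E(1) M_closed closedin_trans_full by blast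
    then have "closedin ?Y E" using EM Mc by (metis closedin_subset_topspace order_trans)
    moreover have "translate h z \<in> E" if "h \<in> H" "z \<in> E" for h z
      using E(3)[of h z] that EM by auto
    ultimately show "E = topspace ?W" using M(4) E(2) EM tW by auto
  qed
  have p: "continuous_map ?W X ?p"
    using continuous_map_compose[OF continuous_map_from_subtopology[OF coordinate_cont[OF one_closed]] \<pi>_cont]
    by (simp add: o_def)
  have p_equiv: "?p (?d h z) = a h (?p z)" if "h \<in> H" "z \<in> M" for h z
  proof -
    have z: "z \<in> coind" using that Mc by blast
    have "translate h z \<one> = c h (z \<one>)"
      using that coind_mult[OF z one_closed, of "inv h"] by (simp add: translate_def)
    then show ?thesis using that \<pi>_equiv coind_in[OF z one_closed] by simp
  qed
  have fW: "factor_map ?G ?W ?d X a ?p"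
    unfolding factor_map_def
  proof (intro conjI GW X_H p ballI)
    have "compactin X (?p ` topspace ?W)"
      using GW p by (intro image_compactin[OF _ p]) (auto simp: G_space_def compact_space_def)
    then have "closedin X (?p ` topspace ?W)" by (rule compactin_imp_closedin[OF Hausdorff_X])
    moreover have "a h x \<in> ?p ` topspace ?W" if h: "h \<in> carrier ?G" and x: "x \<in> ?p ` topspace ?W" for h x
    proof -
      obtain z where "z \<in> M" "x = ?p z" using x tW by blast
      then have "a h x = ?p (translate h z)" "translate h z \<in> M"
        using h p_equiv[of h z] M_inv[of h z] by auto
      then show ?thesis using tW by blast
    qed
    ultimately show "?p ` topspace ?W = topspace X"
      using M(2) tW by (intro minimal_G_space_closed_invariant[OF X_minimal]) auto
    show "?p (?d h z) = a h (?p z)" if "h \<in> carrier ?G" "z \<in> topspace ?W" for h z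
      using that p_equiv[of h z] tW by simp
  qed
  have "strongly_proximal_extension ?G ?W ?d X a ?p"
  proof (rule strongly_proximal_of_coordinates[OF fW, of "\<lambda>\<gamma> z. z \<gamma>"])
    fix \<gamma> assume \<gamma>: "\<gamma> \<in> carrier \<Gamma>"
    show "continuous_map ?W B (\<lambda>z. z \<gamma>)"
      by (rule continuous_map_from_subtopology[OF coordinate_cont[OF \<gamma>]])
    fix z assume "z \<in> topspace ?W"
    then have z: "z \<in> M" "z \<in> coind" using tW Mc by auto
    have "\<pi> (z \<gamma>) = a (inv \<gamma> \<otimes> \<gamma>) (\<pi> (z \<gamma>))"
      using a_action(3) \<pi>_in coind_in[OF z(2) \<gamma>] \<gamma> by simp
    also have "\<dots> = a (inv \<gamma>) (a \<gamma> (\<pi> (z \<gamma>)))"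
      using \<pi>_in coind_in[OF z(2) \<gamma>] \<gamma> by (intro a_action(2)) auto
    finally show "\<pi> (z \<gamma>) = a (inv \<gamma>) (\<pi> (z \<one>))" using coind_fibre[OF z(2) \<gamma>] by simp
    fix h assume h: "h \<in> H" "inv \<gamma> \<otimes> h \<otimes> \<gamma> \<in> H"
    \<comment> \<open>Moving \<open>h\<close> past \<gamma> converts left translation into right
      multiplication by an element of \<open>H\<close>, which the equivariance of \<open>z\<close>
      turns into the twisted action.\<close>
    have "inv h \<otimes> \<gamma> = \<gamma> \<otimes> inv (inv \<gamma> \<otimes> h \<otimes> \<gamma>)"
      using \<gamma> h by (simp add: inv_mult_group m_assoc)
    then have "?d h z \<gamma> = z (\<gamma> \<otimes> inv (inv \<gamma> \<otimes> h \<otimes> \<gamma>))" using z \<gamma> by (simp add: translate_def)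
    also have "\<dots> = c (inv (inv (inv \<gamma> \<otimes> h \<otimes> \<gamma>))) (z \<gamma>)"
      using h by (intro coind_mult[OF z(2) \<gamma>]) simp
    also have "inv (inv (inv \<gamma> \<otimes> h \<otimes> \<gamma>)) = inv \<gamma> \<otimes> h \<otimes> \<gamma>" using \<gamma> h by (intro inv_inv) auto
    finally show "?d h z \<gamma> = c (inv \<gamma> \<otimes> h \<otimes> \<gamma>) (z \<gamma>)" .
  next
    fix z z' assume "z \<in> topspace ?W" "z' \<in> topspace ?W" and eq: "\<And>\<gamma>. \<gamma> \<in> carrier \<Gamma> \<Longrightarrow> z \<gamma> = z' \<gamma>"
    then have "z \<in> coind" "z' \<in> coind" using tW Mc by auto
    then show "z = z'" using coind_ext eq by (metis extensionalityI)
  qed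
  then show ?thesis using that[OF Mc] minimal by (simp add: is_boundary_def)
qed

section \<open>Existence and uniqueness of the extended action\<close>

definition extends_action :: "('g \<Rightarrow> 'b \<Rightarrow> 'b) \<Rightarrow> bool" where
  "extends_action T \<longleftrightarrow>
     (\<forall>\<gamma>\<in>carrier \<Gamma>. continuous_map B B (T \<gamma>)) \<and>
     (\<forall>\<gamma>\<in>carrier \<Gamma>. \<forall>\<delta>\<in>carrier \<Gamma>. \<forall>y\<in>topspace B. T (\<gamma> \<otimes> \<delta>) y = T \<gamma> (T \<delta> y)) \<and>
     (\<forall>h\<in>H. \<forall>y\<in>topspace B. T h y = c h y) \<and>
     (\<forall>\<gamma>\<in>carrier \<Gamma>. \<forall>y\<in>topspace B. \<pi> (T \<gamma> y) = a \<gamma> (\<pi> y))"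

lemma ex_extends_action:
  assumes univ: "is_furstenberg_boundary (\<Gamma>\<lparr>carrier := H\<rparr>) X a B c \<pi>"
  shows "\<exists>T. extends_action T"
proof (cases "topspace B = {}")
  \<comment> \<open>The coinduced space was built from a point of \<open>X\<close>; over the empty
    space all conditions are void.\<close>
  case True
  have "extends_action (\<lambda>\<gamma> y. y)" unfolding extends_action_def by (simp add: True)
  then show ?thesis by blast
next
  case False
  then obtain M where M: "M \<subseteq> coind" and
    bd: "is_boundary (\<Gamma>\<lparr>carrier := H\<rparr>) X a (subtopology pow_top M) (\<lambda>h. \<lambda>z\<in>M. translate h z) (\<lambda>z. \<pi> (z \<one>))"
    by (rule coinduced_boundary)
  obtain \<Phi> where \<Phi>: "factor_map (\<Gamma>\<lparr>carrier := H\<rparr>) B c (subtopology pow_top M) (\<lambda>h. \<lambda>z\<in>M. translate h z) \<Phi>"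
    and \<Phi>_fibre: "\<forall>y\<in>topspace B. \<pi> (\<Phi> y \<one>) = \<pi> y"
    using furstenberg_boundary_universal[OF univ bd] by blast
  have \<Phi>_cont: "continuous_map B pow_top \<Phi>" and \<Phi>_M: "\<And>y. y \<in> topspace B \<Longrightarrow> \<Phi> y \<in> M"
    using \<Phi> by (auto simp: factor_map_def continuous_map_in_subtopology)
  have \<Phi>_equiv: "\<Phi> (c h y) = translate h (\<Phi> y)" if "h \<in> H" "y \<in> topspace B" for h y
    using \<Phi> \<Phi>_M[OF that(2)] that by (simp add: factor_map_def)
  have \<Phi>_coind: "\<Phi> y \<in> coind" if "y \<in> topspace B" for y using \<Phi>_M[OF that] M by blast
  \<comment> \<open>With the inverse, equivariance of \<Phi> becomes \<open>T_right\<close> and the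
    defining relation of \<open>coind\<close> becomes \<open>T_left\<close>; together they give
    \<open>T_twist\<close>.\<close>
  define T where "T \<gamma> y = \<Phi> y (inv \<gamma>)" for \<gamma> y
  have T_in: "T \<gamma> y \<in> topspace B" if "\<gamma> \<in> carrier \<Gamma>" "y \<in> topspace B" for \<gamma> y
    using coind_in[OF \<Phi>_coind] that by (simp add: T_def)
  have T_cont: "continuous_map B B (T \<gamma>)" if "\<gamma> \<in> carrier \<Gamma>" for \<gamma>
    using continuous_map_compose[OF \<Phi>_cont coordinate_cont[of "inv \<gamma>"]] that
    by (simp add: T_def[abs_def] o_def)
  have T_right: "T \<gamma> (c h y) = T (\<gamma> \<otimes> h) y" if "\<gamma> \<in> carrier \<Gamma>" "h \<in> H" "y \<in> topspace B" for \<gamma> h y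
    using that by (simp add: T_def \<Phi>_equiv translate_def inv_mult_group)
  have T_left: "T (h \<otimes> \<gamma>) y = c h (T \<gamma> y)" if "\<gamma> \<in> carrier \<Gamma>" "h \<in> H" "y \<in> topspace B" for \<gamma> h y
    using that coind_mult[OF \<Phi>_coind[OF that(3)], of "inv \<gamma>" "inv h"] by (simp add: T_def inv_mult_group)
  have T_twist: "T \<gamma> (c k y) = c (\<gamma> \<otimes> k \<otimes> inv \<gamma>) (T \<gamma> y)"
    if "\<gamma> \<in> carrier \<Gamma>" "k \<in> H" "\<gamma> \<otimes> k \<otimes> inv \<gamma> \<in> H" "y \<in> topspace B" for \<gamma> k y
    using that T_right[of \<gamma> k y] T_left[of \<gamma> "\<gamma> \<otimes> k \<otimes> inv \<gamma>" y] by (simp add: m_assoc)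
  have T_fibre: "\<pi> (T \<gamma> y) = a \<gamma> (\<pi> y)" if \<gamma>: "\<gamma> \<in> carrier \<Gamma>" and y: "y \<in> topspace B" for \<gamma> y
  proof -
    have "a \<gamma> (\<pi> y) = a \<gamma> (a (inv \<gamma>) (\<pi> (T \<gamma> y)))"
      using coind_fibre[OF \<Phi>_coind[OF y], of "inv \<gamma>"] \<Phi>_fibre \<gamma> y by (simp add: T_def)
    also have "\<dots> = \<pi> (T \<gamma> y)"
      using a_action(2)[of \<gamma> "inv \<gamma>" "\<pi> (T \<gamma> y)"] a_action(3) \<pi>_in T_in[OF \<gamma> y] \<gamma> by simp
    finally show ?thesis by simp
  qed
  \<comment> \<open>Here a single pair suffices: \<open>T \<one>\<close> commutes with all of
    \<open>H\<close> and covers the identity of \<open>X\<close>, so its equalizer with the identity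
    map is already \<open>H\<close>-invariant.\<close>
  have T_one: "T \<one> y = y" if y: "y \<in> topspace B" for y
  proof (rule equalizer_topspace[where I = "{()}" and F = "\<lambda>_. {\<one>}" and \<gamma> = "\<lambda>_. \<one>"
        and f = "\<lambda>_. T \<one>" and f' = "\<lambda>_ y. y"])
    show "\<pi> (T \<one> y) = \<pi> y" if "y \<in> topspace B" for y
      using T_fibre[OF one_closed that] a_action(3) \<pi>_in[OF that] by simp
    have comm: "T \<one> (c k y) = c k (T \<one> y)" if "k \<in> H" "y \<in> topspace B" for k y
      using T_right[OF one_closed that] T_left[OF one_closed that] that by simp
    show "T \<one> (c k y) = c (\<one> \<otimes> k \<otimes> inv \<one>) (T \<one> y)" if "k \<in> small {\<one>}" "y \<in> topspace B" for k y
      using comm[of k y] that small_subset[of "{\<one>}"] by auto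
    show "c k y = c (\<one> \<otimes> k \<otimes> inv \<one>) y" if "k \<in> small {\<one>}" for k y
      using that small_subset[of "{\<one>}"] by auto
    show "\<forall>i\<in>{()}. T \<one> (c h y) = c h y"
      if "h \<in> H" "y \<in> topspace B" "\<And>i. i \<in> {()} \<Longrightarrow> T \<one> y = y" for h y
      using comm that by simp
  qed (use T_cont y in auto)
  have T_mult: "T \<gamma> (T \<delta> y) = T (\<gamma> \<otimes> \<delta>) y"
    if "\<gamma> \<in> carrier \<Gamma>" "\<delta> \<in> carrier \<Gamma>" and y: "y \<in> topspace B" for \<gamma> \<delta> y
  proof -
    let ?f = "\<lambda>i y. T (fst i) (T (snd i) y)" and ?f' = "\<lambda>i. T (fst i \<otimes> snd i)"
    have "?f (\<gamma>, \<delta>) y = ?f' (\<gamma>, \<delta>) y"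
    \<comment> \<open>All pairs are treated together because replacing \<open>y\<close> by
      \<open>c h y\<close> exchanges the pair \<open>(\<gamma>, \<delta>)\<close> for
      \<open>(\<gamma>, \<delta> \<otimes> h)\<close>. The set \<open>F\<close> makes both the inner
      twist by \<delta> and the total twist by \<open>\<gamma> \<otimes> \<delta>\<close> stay in
      \<open>H\<close>.\<close>
    proof (rule equalizer_topspace[where I = "carrier \<Gamma> \<times> carrier \<Gamma>"
          and F = "\<lambda>i. {snd i, fst i \<otimes> snd i}" and \<gamma> = "\<lambda>i. fst i \<otimes> snd i" and f = ?f and f' = ?f'])
      fix i assume "i \<in> carrier \<Gamma> \<times> carrier \<Gamma>"
      then obtain \<gamma> \<delta> where i: "i = (\<gamma>, \<delta>)" and \<gamma>: "\<gamma> \<in> carrier \<Gamma>" and \<delta>: "\<delta> \<in> carrier \<Gamma>" by auto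
      show "finite {snd i, fst i \<otimes> snd i} \<and> {snd i, fst i \<otimes> snd i} \<subseteq> carrier \<Gamma> \<and>
          fst i \<otimes> snd i \<in> {snd i, fst i \<otimes> snd i}"
        using \<gamma> \<delta> i by simp
      show "continuous_map B B (?f i)"
        using continuous_map_compose[OF T_cont[OF \<delta>] T_cont[OF \<gamma>]] i by (simp add: o_def)
      show "continuous_map B B (?f' i)" using T_cont \<gamma> \<delta> i by simp
      fix y assume y: "y \<in> topspace B"
      show "\<pi> (?f i y) = \<pi> (?f' i y)"
        using i y \<gamma> \<delta> T_fibre T_in a_action(2)[OF \<gamma> \<delta>] \<pi>_in by simp
      fix k assume k: "k \<in> small {snd i, fst i \<otimes> snd i}"
      then have kH: "k \<in> H" "\<delta> \<otimes> k \<otimes> inv \<delta> \<in> H" "(\<gamma> \<otimes> \<delta>) \<otimes> k \<otimes> inv (\<gamma> \<otimes> \<delta>) \<in> H"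
        using i by (auto simp: small_def)
      have conj: "\<gamma> \<otimes> (\<delta> \<otimes> k \<otimes> inv \<delta>) \<otimes> inv \<gamma> = (\<gamma> \<otimes> \<delta>) \<otimes> k \<otimes> inv (\<gamma> \<otimes> \<delta>)"
        using \<gamma> \<delta> kH(1) by (simp add: m_assoc inv_mult_group)
      show "?f i (c k y) = c (fst i \<otimes> snd i \<otimes> k \<otimes> inv (fst i \<otimes> snd i)) (?f i y)"
        using T_twist[OF \<delta> kH(1,2) y] T_twist[OF \<gamma> kH(2) _ T_in[OF \<delta> y]] kH(3) conj i by simp
      show "?f' i (c k y) = c (fst i \<otimes> snd i \<otimes> k \<otimes> inv (fst i \<otimes> snd i)) (?f' i y)"
        using T_twist[OF m_closed[OF \<gamma> \<delta>] kH(1,3) y] i by simp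
    next
      fix h y assume h: "h \<in> H" and y: "y \<in> topspace B"
        and eq: "\<And>i. i \<in> carrier \<Gamma> \<times> carrier \<Gamma> \<Longrightarrow> ?f i y = ?f' i y"
      have "T \<gamma> (T \<delta> (c h y)) = T (\<gamma> \<otimes> \<delta>) (c h y)" if "\<gamma> \<in> carrier \<Gamma>" "\<delta> \<in> carrier \<Gamma>" for \<gamma> \<delta>
        using that h y T_right eq[of "(\<gamma>, \<delta> \<otimes> h)"] by (simp add: m_assoc)
      then show "\<forall>i\<in>carrier \<Gamma> \<times> carrier \<Gamma>. ?f i (c h y) = ?f' i (c h y)" by simp
    qed (use that in auto)
    then show ?thesis by simp
  qed
  have "T h y = c h y" if "h \<in> H" "y \<in> topspace B" for h y
    using T_left[OF one_closed that] T_one[OF that(2)] that(1) by simp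
  then have "extends_action T"
    using T_cont T_mult T_fibre by (simp add: extends_action_def)
  then show ?thesis by blast
qed

text \<open>Any extension satisfies the same twisted equivariance and covers the same map of
  \<open>X\<close>, and moving \<open>y\<close> by \<open>h\<close> exchanges \<gamma> for
  \<open>\<gamma> \<otimes> h\<close>. So two extensions, compared at all \<gamma> together, are
  equal.\<close>

lemma extends_action_unique:
  assumes T: "extends_action T" and T': "extends_action T'"
    and \<gamma>: "\<gamma> \<in> carrier \<Gamma>" and y: "y \<in> topspace B"
  shows "T \<gamma> y = T' \<gamma> y"
proof -
  have right: "S \<gamma> (c h y) = S (\<gamma> \<otimes> h) y" and twist: "\<gamma> \<otimes> h \<otimes> inv \<gamma> \<in> H \<Longrightarrow> S \<gamma> (c h y) = c (\<gamma> \<otimes> h \<otimes> inv \<gamma>) (S \<gamma> y)"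
    if S: "extends_action S" and "\<gamma> \<in> carrier \<Gamma>" "h \<in> H" "y \<in> topspace B" for S \<gamma> h y
  proof -
    show *: "S \<gamma> (c h y) = S (\<gamma> \<otimes> h) y" using that by (simp add: extends_action_def)
    have "S \<gamma> y \<in> topspace B" using that by (auto simp: extends_action_def continuous_map_def)
    moreover assume "\<gamma> \<otimes> h \<otimes> inv \<gamma> \<in> H"
    ultimately have "S ((\<gamma> \<otimes> h \<otimes> inv \<gamma>) \<otimes> \<gamma>) y = c (\<gamma> \<otimes> h \<otimes> inv \<gamma>) (S \<gamma> y)"
      using that H_carrier by (simp add: extends_action_def)
    moreover have "(\<gamma> \<otimes> h \<otimes> inv \<gamma>) \<otimes> \<gamma> = \<gamma> \<otimes> h" using that by (simp add: m_assoc)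
    ultimately show "S \<gamma> (c h y) = c (\<gamma> \<otimes> h \<otimes> inv \<gamma>) (S \<gamma> y)" using * by simp
  qed
  show ?thesis
  proof (rule equalizer_topspace[where I = "carrier \<Gamma>" and F = "\<lambda>\<gamma>. {\<gamma>}" and \<gamma> = "\<lambda>\<gamma>. \<gamma>" and f = T and f' = T'])
    fix \<gamma> k y assume "\<gamma> \<in> carrier \<Gamma>" "k \<in> small {\<gamma>}" "y \<in> topspace B"
    then show "T \<gamma> (c k y) = c (\<gamma> \<otimes> k \<otimes> inv \<gamma>) (T \<gamma> y)" "T' \<gamma> (c k y) = c (\<gamma> \<otimes> k \<otimes> inv \<gamma>) (T' \<gamma> y)"
      using twist[OF T, of \<gamma> k y] twist[OF T', of \<gamma> k y] by (auto simp: small_def)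
  next
    fix h y assume "h \<in> H" "y \<in> topspace B" "\<And>\<gamma>. \<gamma> \<in> carrier \<Gamma> \<Longrightarrow> T \<gamma> y = T' \<gamma> y"
    then show "\<forall>\<gamma>\<in>carrier \<Gamma>. T \<gamma> (c h y) = T' \<gamma> (c h y)"
      using right[OF T] right[OF T'] by simp
  qed (use T T' \<gamma> y in \<open>auto simp: extends_action_def\<close>)
qed

text \<open>Inverses are supplied by \<open>inv \<gamma>\<close>: the unit law holds because \<one>
  lies in \<open>H\<close>, where \<open>T\<close> agrees with \<open>c\<close>. Restriction to
  \<open>topspace B\<close> gives the extensional maps demanded of a
  \<open>group_action\<close>.\<close>

lemma extends_action_restrict:
  assumes T: "extends_action T"
  defines "S \<equiv> \<lambda>\<gamma>\<in>carrier \<Gamma>. \<lambda>y\<in>topspace B. T \<gamma> y"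
  shows "group_action \<Gamma> (topspace B) S" and "\<gamma> \<in> carrier \<Gamma> \<Longrightarrow> homeomorphic_map B B (S \<gamma>)"
proof -
  have in_B: "T \<gamma> y \<in> topspace B" if "\<gamma> \<in> carrier \<Gamma>" "y \<in> topspace B" for \<gamma> y
    using T that by (auto simp: extends_action_def continuous_map_def)
  have one: "T \<one> y = y" if "y \<in> topspace B" for y
    using T that c_action(3) by (simp add: extends_action_def)
  have mult: "T \<gamma> (T \<delta> y) = T (\<gamma> \<otimes> \<delta>) y"
    if "\<gamma> \<in> carrier \<Gamma>" "\<delta> \<in> carrier \<Gamma>" "y \<in> topspace B" for \<gamma> \<delta> y
    using T that by (simp add: extends_action_def)
  show "group_action \<Gamma> (topspace B) S"
    by (rule group_actionI[OF group]) (use in_B one mult in \<open>auto simp: S_def\<close>)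
  assume \<gamma>: "\<gamma> \<in> carrier \<Gamma>"
  have cont: "continuous_map B B (S \<delta>)" if "\<delta> \<in> carrier \<Gamma>" for \<delta>
    using T that by (auto simp: S_def extends_action_def intro: continuous_map_eq)
  have "homeomorphic_maps B B (S \<gamma>) (S (inv \<gamma>))"
    using cont \<gamma> in_B mult one by (simp add: homeomorphic_maps_def S_def)
  then show "homeomorphic_map B B (S \<gamma>)" using homeomorphic_map_maps by blast
qed

end

theorem theorem4p2:
  fixes \<Gamma> :: "('g, 'm) monoid_scheme" and H :: "'g set"
    and X :: "'x topology" and a :: "'g \<Rightarrow> 'x \<Rightarrow> 'x"
    and B :: "'b topology" and c :: "'g \<Rightarrow> 'b \<Rightarrow> 'b" and \<pi>\<^sub>H :: "'b \<Rightarrow> 'x"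
  assumes "group \<Gamma>"
    and "subgroup H \<Gamma>"
    and "commensurated \<Gamma> H"
    and "minimal_G_space \<Gamma> X a"
    and "is_furstenberg_boundary (\<Gamma>\<lparr>carrier := H\<rparr>) X a B c \<pi>\<^sub>H"
  shows "\<exists>!T. T \<in> extensional (carrier \<Gamma>) \<and>
              group_action \<Gamma> (topspace B) T \<and>
              (\<forall>g\<in>carrier \<Gamma>. homeomorphic_map B B (T g)) \<and>
              (\<forall>h\<in>H. \<forall>y\<in>topspace B. T h y = c h y) \<and>
              (\<forall>g\<in>carrier \<Gamma>. \<forall>y\<in>topspace B. \<pi>\<^sub>H (T g y) = a g (\<pi>\<^sub>H y))"
proof -
  interpret commensurated_boundary \<Gamma> H X a B c \<pi>\<^sub>H
    using assms
    by (intro commensurated_boundary.intro) (auto simp: minimal_G_space_def is_furstenberg_boundary_def)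
  obtain T where T: "extends_action T" using ex_extends_action[OF assms(5)] by blast
  let ?T = "\<lambda>\<gamma>\<in>carrier \<Gamma>. \<lambda>y\<in>topspace B. T \<gamma> y"
  show ?thesis
  proof (rule ex1I[of _ ?T])
    show "?T \<in> extensional (carrier \<Gamma>) \<and> group_action \<Gamma> (topspace B) ?T \<and>
        (\<forall>g\<in>carrier \<Gamma>. homeomorphic_map B B (?T g)) \<and>
        (\<forall>h\<in>H. \<forall>y\<in>topspace B. ?T h y = c h y) \<and>
        (\<forall>g\<in>carrier \<Gamma>. \<forall>y\<in>topspace B. \<pi>\<^sub>H (?T g y) = a g (\<pi>\<^sub>H y))"
    proof (intro conjI ballI)
      show "group_action \<Gamma> (topspace B) ?T" by (rule extends_action_restrict(1)[OF T])
      show "homeomorphic_map B B (?T g)" if "g \<in> carrier \<Gamma>" for g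
        by (rule extends_action_restrict(2)[OF T that])
    qed (use T in \<open>auto simp: extends_action_def\<close>)
  next
    fix S assume S: "S \<in> extensional (carrier \<Gamma>) \<and> group_action \<Gamma> (topspace B) S \<and>
        (\<forall>g\<in>carrier \<Gamma>. homeomorphic_map B B (S g)) \<and>
        (\<forall>h\<in>H. \<forall>y\<in>topspace B. S h y = c h y) \<and>
        (\<forall>g\<in>carrier \<Gamma>. \<forall>y\<in>topspace B. \<pi>\<^sub>H (S g y) = a g (\<pi>\<^sub>H y))"
    then interpret S: group_action \<Gamma> "topspace B" S by blast
    have "\<forall>g\<in>carrier \<Gamma>. continuous_map B B (S g)"
      using S homeomorphic_imp_continuous_map by blast
    then have "extends_action S"
      using S S.composition_rule by (simp add: extends_action_def)
    then have eq: "S g y = ?T g y" if "g \<in> carrier \<Gamma>" "y \<in> topspace B" for g y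
      using extends_action_unique[OF _ T] that by simp
    have "S g = ?T g" if g: "g \<in> carrier \<Gamma>" for g
      by (rule extensionalityI[of _ "topspace B"])
        (use S.bij_prop0[OF g] eq[OF g] g in \<open>auto simp: Bij_def\<close>)
    then show "S = ?T" using S by (intro extensionalityI[of _ "carrier \<Gamma>"]) auto
  qed
qed

end
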